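(* Let $K$ be a field complete with respect to a nontrivial non-archimedean absolute value, let $\mathcal{A}$ be an affinoid algebra over $K$, and let $X=\operatorname{Max}(\mathcal{A})$. Let $\mathcal{C}_L$ be the collection of all coverings of $X$ that are refined by some finite covering of $X$ by open Laurent domains. Then $\mathcal{C}_L$ is a Hausdorff uniform structure on $X$, and its completion $(\hat{X},\hat{\mathcal{C}}_L)$ is isomorphic, as a uniform space (and in particular as a topological space), to the Berkovich analytic space $X^{\mathrm{an}}$ of $X$, where $X^{\mathrm{an}}$ is equipped with the unique uniform structure compatible with its compact Hausdorff topology.
   Context: Rigid analysis. An affinoid algebra over $K$ is a quotient ring of the ring $T_n$ of restricted power series over $K$ in $n$ variables (coefficients tending to zero) for some $n\ge 1$; it is a $K$-Banach algebra, with norm well defined up to equivalence (a residue norm of the Gauss norm). $\operatorname{Max}(\mathcal{A})$ is the set of maximal ideals of $\mathcal{A}$. For $x\in X$ corresponding to the maximal ideal $\mathfrak{m}$ and $f\in\mathcal{A}$, $f(x)$ is the image of $f$ in $\mathcal{A}/\mathfrak{m}$, a finite extension of $K$, and $|f(x)|$ is its absolute value under the unique extension of the absolute value of $K$. Put $\sqrt{|K^*|}=\{\alpha>0 : \alpha^n=|z| \text{ for some } z\in K \text{ and some integer } n\ge 1\}$. An open Laurent domain in $X$ is a set of the form $\{x\in X : |f_i(x)|<\alpha_i\ (1\le i\le s),\ |g_j(x)|>\beta_j\ (1\le j\le t)\}$ with $f_i,g_j\in\mathcal{A}$ and $\alpha_i,\beta_j\in\sqrt{|K^*|}$. Berkovich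 space. $X^{\mathrm{an}}$ is the set of all bounded multiplicative seminorms on $\mathcal{A}$, i.e. functions $|\cdot|_x:\mathcal{A}\to\mathbb{R}_{\ge 0}$ with $|0|_x=0$, $|1|_x=1$, $|fg|_x=|f|_x|g|_x$, $|f+g|_x\le\max\{|f|_x,|g|_x\}$ for all $f,g\in\mathcal{A}$, and such that there is a constant $c>0$ with $|f|_x\le c\|f\|$ for all $f\in\mathcal{A}$, where $\|\cdot\|$ is a residue norm on $\mathcal{A}$ of the Gauss norm on $T_n$, for some presentation of $\mathcal{A}$ as a quotient of $T_n$ (the condition does not depend on the choice, since any two such norms are equivalent). Its topology is the coarsest for which $x\mapsto|f|_x$ is continuous for every $f\in\mathcal{A}$. By a theorem of Berkovich, $X^{\mathrm{an}}$ is a compact Hausdorff space; every compact Hausdorff space has a unique uniform structure inducing its topology. Uniform spaces (via uniform covers). A covering of a set $X$ is a collection of subsets of $X$ with union $X$. A covering $C$ refines a covering $D$ (written $C<D$) if every element of $C$ is contained in some element of $D$; $C$ star-refines $D$ if for every $U\in C$ the union of all elements of $C$ meeting $U$ is contained in some element of $D$. A uniform structure on $X$ is a collection $\mathcal{C}$ of coverings (the uniform coverings) such that (C1) if $C\in\mathcal{C}$ and $C<D$ then $D\in\mathcal{C}$; (C2) for all $D_1,D_2\in\mathcal{C}$ there is $C\in\mathcal{C}$ star-refining both $D_1$ and $D_2$. It is Hausdorff if for all distinct $x,y\in X$ there is $C\in\mathcal{C}$ no element of which contains both $x$ and $y$. In the associated uniform topology, $U\subseteq X$ is open iff for each $x\in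 U$ there is $C\in\mathcal{C}$ such that the union of all elements of $C$ containing $x$ lies in $U$. A map $f:(X,\mathcal{C}_X)\to(Y,\mathcal{C}_Y)$ is uniformly continuous if $\{f^{-1}(U):U\in C\}\in\mathcal{C}_X$ for every $C\in\mathcal{C}_Y$; an isomorphism of uniform spaces is a bijection that is uniformly continuous in both directions. A filter is Cauchy if it contains some element of each uniform covering; a uniform space is complete if every Cauchy filter converges. The completion of a Hausdorff uniform space $(X,\mathcal{C})$ is the complete Hausdorff uniform space, unique up to uniform isomorphism, containing $X$ as a dense subspace with $\mathcal{C}$ as induced uniform structure. *)

theory Defs
  imports "HOL-Analysis.Analysis" "HOL-Algebra.QuotRing" "HOL-Library.Poly_Mapping"
begin

section \<open>Uniform spaces via uniform coverings\<close>

text \<open>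
  Coverings and uniform structures are required to be nonempty collections. For a nonempty set
  this excludes nothing of interest: a covering is then nonempty anyway, and the empty collection
  of coverings does not induce a topology. On the empty set (which occurs, as the spectrum of the
  zero algebra) it leaves exactly one uniform structure; otherwise \<open>{{{}}}\<close> and \<open>{{}, {{}}}\<close>
  would be two different ones inducing the same topology.
\<close>

definition covering :: "'a set \<Rightarrow> 'a set set \<Rightarrow> bool" where
  "covering X C \<longleftrightarrow> C \<noteq> {} \<and> \<Union>C = X"

definition refines :: "'a set set \<Rightarrow> 'a set set \<Rightarrow> bool" where
  "refines C D \<longleftrightarrow> (\<forall>U\<in>C. \<exists>V\<in>D. U \<subseteq> V)"

definition star_refines :: "'a set set \<Rightarrow> 'a set set \<Rightarrow> bool" where
  "star_refines C D \<longleftrightarrow> (\<forall>U\<in>C. \<exists>V\<in>D. \<Union>{W\<in>C. W \<inter> U \<noteq> {}} \<subseteq> V)"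

definition uniform_structure :: "'a set \<Rightarrow> 'a set set set \<Rightarrow> bool" where
  "uniform_structure X \<C> \<longleftrightarrow>
     \<C> \<noteq> {} \<and>
     (\<forall>C\<in>\<C>. covering X C) \<and>
     (\<forall>C\<in>\<C>. \<forall>D. covering X D \<and> refines C D \<longrightarrow> D \<in> \<C>) \<and>
     (\<forall>D\<^sub>1\<in>\<C>. \<forall>D\<^sub>2\<in>\<C>. \<exists>C\<in>\<C>. star_refines C D\<^sub>1 \<and> star_refines C D\<^sub>2)"

definition Hausdorff_uniform_structure :: "'a set \<Rightarrow> 'a set set set \<Rightarrow> bool" where
  "Hausdorff_uniform_structure X \<C> \<longleftrightarrow>
     uniform_structure X \<C> \<and>
     (\<forall>x\<in>X. \<forall>y\<in>X. x \<noteq> y \<longrightarrow> (\<exists>C\<in>\<C>. \<forall>U\<in>C. \<not> (x \<in> U \<and> y \<in> U)))"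

definition uniform_open :: "'a set \<Rightarrow> 'a set set set \<Rightarrow> 'a set \<Rightarrow> bool" where
  "uniform_open X \<C> U \<longleftrightarrow> U \<subseteq> X \<and> (\<forall>x\<in>U. \<exists>C\<in>\<C>. \<Union>{V\<in>C. x \<in> V} \<subseteq> U)"

definition uniform_topology :: "'a set \<Rightarrow> 'a set set set \<Rightarrow> 'a topology" where
  "uniform_topology X \<C> = topology (uniform_open X \<C>)"

lemma istopology_uniform_open:
  assumes "uniform_structure X \<C>"
  shows "istopology (uniform_open X \<C>)"
  unfolding istopology_def
proof (intro conjI allI impI)
  fix S T assume ST: "uniform_open X \<C> S" "uniform_open X \<C> T"
  show "uniform_open X \<C> (S \<inter> T)"
    unfolding uniform_open_def
  proof (intro conjI ballI)
    show "S \<inter> T \<subseteq> X" using ST by (auto simp: uniform_open_def)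
    fix x assume x: "x \<in> S \<inter> T"
    obtain D E where D: "D \<in> \<C>" "\<Union>{V\<in>D. x \<in> V} \<subseteq> S" and E: "E \<in> \<C>" "\<Union>{V\<in>E. x \<in> V} \<subseteq> T"
      using ST x unfolding uniform_open_def by blast
    obtain C where C: "C \<in> \<C>" "star_refines C D" "star_refines C E"
      using assms D(1) E(1) unfolding uniform_structure_def by blast
    have "V \<subseteq> S \<inter> T" if V: "V \<in> C" "x \<in> V" for V
    proof -
      obtain P where P: "P \<in> D" "\<Union>{W\<in>C. W \<inter> V \<noteq> {}} \<subseteq> P"
        using C(2) V(1) unfolding star_refines_def by blast
      obtain Q where Q: "Q \<in> E" "\<Union>{W\<in>C. W \<inter> V \<noteq> {}} \<subseteq> Q"
        using C(3) V(1) unfolding star_refines_def by blast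
      have "V \<subseteq> \<Union>{W\<in>C. W \<inter> V \<noteq> {}}" using V by blast
      then have "V \<subseteq> P" "V \<subseteq> Q" using P Q by auto
      then show ?thesis using D E P Q V by blast
    qed
    then show "\<exists>C\<in>\<C>. \<Union>{V\<in>C. x \<in> V} \<subseteq> S \<inter> T" using C(1) by blast
  qed
next
  fix K assume K: "\<forall>S\<in>K. uniform_open X \<C> S"
  show "uniform_open X \<C> (\<Union>K)"
    unfolding uniform_open_def
  proof (intro conjI ballI)
    show "\<Union>K \<subseteq> X" using K by (auto simp: uniform_open_def)
    fix x assume "x \<in> \<Union>K"
    then obtain S where "S \<in> K" "x \<in> S" by blast
    then show "\<exists>C\<in>\<C>. \<Union>{V\<in>C. x \<in> V} \<subseteq> \<Union>K"
      using K unfolding uniform_open_def by (meson Sup_upper order_trans)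
  qed
qed

definition uniformly_continuous_map ::
  "'a set \<Rightarrow> 'a set set set \<Rightarrow> 'b set \<Rightarrow> 'b set set set \<Rightarrow> ('a \<Rightarrow> 'b) \<Rightarrow> bool" where
  "uniformly_continuous_map X \<C> Y \<D> f \<longleftrightarrow>
     f \<in> X \<rightarrow> Y \<and> (\<forall>D\<in>\<D>. (\<lambda>U. f -` U \<inter> X) ` D \<in> \<C>)"

definition uniform_isomorphism ::
  "'a set \<Rightarrow> 'a set set set \<Rightarrow> 'b set \<Rightarrow> 'b set set set \<Rightarrow> ('a \<Rightarrow> 'b) \<Rightarrow> bool" where
  "uniform_isomorphism X \<C> Y \<D> f \<longleftrightarrow>
     bij_betw f X Y \<and> uniformly_continuous_map X \<C> Y \<D> f \<and>
     uniformly_continuous_map Y \<D> X \<C> (inv_into X f)"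

definition Cauchy_filter_in :: "'a set \<Rightarrow> 'a set set set \<Rightarrow> 'a filter \<Rightarrow> bool" where
  "Cauchy_filter_in X \<C> F \<longleftrightarrow>
     F \<noteq> bot \<and> F \<le> principal X \<and> (\<forall>C\<in>\<C>. \<exists>U\<in>C. \<forall>\<^sub>F x in F. x \<in> U)"

definition complete_uniform :: "'a set \<Rightarrow> 'a set set set \<Rightarrow> bool" where
  "complete_uniform X \<C> \<longleftrightarrow>
     (\<forall>F. Cauchy_filter_in X \<C> F \<longrightarrow> (\<exists>l. limitin (uniform_topology X \<C>) (\<lambda>x. x) l F))"

definition induced_coverings :: "'a set \<Rightarrow> ('a \<Rightarrow> 'b) \<Rightarrow> 'b set set set \<Rightarrow> 'a set set set" where
  "induced_coverings X i \<D> =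
     {C. covering X C \<and> (\<exists>D\<in>\<D>. refines ((\<lambda>U. i -` U \<inter> X) ` D) C)}"

definition is_completion ::
  "'a set \<Rightarrow> 'a set set set \<Rightarrow> 'b set \<Rightarrow> 'b set set set \<Rightarrow> ('a \<Rightarrow> 'b) \<Rightarrow> bool" where
  "is_completion X \<C> Y \<D> i \<longleftrightarrow>
     Hausdorff_uniform_structure Y \<D> \<and> complete_uniform Y \<D> \<and>
     i \<in> X \<rightarrow> Y \<and> inj_on i X \<and>
     uniform_topology Y \<D> closure_of (i ` X) = Y \<and>
     induced_coverings X i \<D> = \<C>"

definition compatible_uniform_structure :: "'a topology \<Rightarrow> 'a set set set \<Rightarrow> bool" where
  "compatible_uniform_structure T \<C> \<longleftrightarrow>
     uniform_structure (topspace T) \<C> \<and> uniform_topology (topspace T) \<C> = T"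

definition the_uniform_structure :: "'a topology \<Rightarrow> 'a set set set" where
  "the_uniform_structure T = (THE \<C>. compatible_uniform_structure T \<C>)"


section \<open>Affinoid algebras\<close>

locale complete_nonarch_field =
  fixes v :: "'k::field \<Rightarrow> real"
  assumes nonneg: "0 \<le> v x"
    and eq_0_iff: "v x = 0 \<longleftrightarrow> x = 0"
    and mult: "v (x * y) = v x * v y"
    and ultrametric: "v (x + y) \<le> max (v x) (v y)"
    and nontrivial: "\<exists>x. x \<noteq> 0 \<and> v x \<noteq> 1"
    and complete: "Metric_space.mcomplete UNIV (\<lambda>x y. v (x - y))"

text \<open>
  A power series in the variables with indices below \<open>n\<close> is its coefficient function; a monomial
  is a finitely supported exponent vector \<open>m :: nat \<Rightarrow>\<^sub>0 nat\<close> with \<open>keys m \<subseteq> {..<n}\<close>, so that the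
  rings for all \<open>n\<close> live in one type.
\<close>

definition restricted_series :: "('k::field \<Rightarrow> real) \<Rightarrow> nat \<Rightarrow> ((nat \<Rightarrow>\<^sub>0 nat) \<Rightarrow> 'k) set" where
  "restricted_series v n =
     {f. (\<forall>m. f m \<noteq> 0 \<longrightarrow> Poly_Mapping.keys m \<subseteq> {..<n}) \<and> ((\<lambda>m. v (f m)) \<longlongrightarrow> 0) cofinite}"

definition tate_algebra :: "('k::field \<Rightarrow> real) \<Rightarrow> nat \<Rightarrow> ((nat \<Rightarrow>\<^sub>0 nat) \<Rightarrow> 'k) ring" where
  "tate_algebra v n =
     \<lparr>carrier = restricted_series v n,
      mult = (\<lambda>f g m. \<Sum>(a, b) | a + b = m. f a * g b),
      one = (\<lambda>m. 1 when m = 0),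
      zero = (\<lambda>m. 0),
      add = (\<lambda>f g m. f m + g m)\<rparr>"

lemma finite_exponent_splittings: "finite {(a, b). a + b = (m :: nat \<Rightarrow>\<^sub>0 nat)}"
proof -
  define L where "L = Poly_Mapping.lookup m"
  have "finite {f. \<forall>i. (i \<in> Poly_Mapping.keys m \<longrightarrow> f i \<in> {..Max (range L)}) \<and>
      (i \<notin> Poly_Mapping.keys m \<longrightarrow> f i = (0::nat))}" (is "finite ?F")
    by (intro finite_set_of_finite_funs) auto
  moreover have "Poly_Mapping.lookup ` {a. \<exists>b. a + b = m} \<subseteq> ?F"
  proof safe
    fix a b i assume m: "m = a + b"
    have le: "Poly_Mapping.lookup a j \<le> L j" for j by (simp add: L_def m lookup_add)
    have "range L \<subseteq> insert 0 (L ` Poly_Mapping.keys m)"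
      by (auto simp: L_def in_keys_iff)
    then have "finite (range L)" by (rule finite_subset) auto
    then have "L i \<le> Max (range L)" by simp
    with le[of i] show "Poly_Mapping.lookup a i \<le> Max (range L)" by linarith
    assume "i \<notin> Poly_Mapping.keys (a + b)"
    then have "L i = 0" by (simp add: L_def m in_keys_iff)
    with le[of i] show "Poly_Mapping.lookup a i = 0" by simp
  qed
  ultimately have "finite (Poly_Mapping.lookup ` {a. \<exists>b. a + b = m})"
    by (rule finite_subset[rotated])
  then have "finite {a. \<exists>b. a + b = m}"
    by (rule finite_imageD) (simp add: inj_on_def lookup_inject)
  then have "finite ((\<lambda>a. (a, m - a)) ` {a. \<exists>b. a + b = m})" by (rule finite_imageI)
  moreover have "{(a, b). a + b = m} \<subseteq> (\<lambda>a. (a, m - a)) ` {a. \<exists>b. a + b = m}" by auto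
  ultimately show ?thesis by (rule finite_subset[rotated])
qed

definition gauss_norm :: "('k::field \<Rightarrow> real) \<Rightarrow> ((nat \<Rightarrow>\<^sub>0 nat) \<Rightarrow> 'k) \<Rightarrow> real" where
  "gauss_norm v f = (SUP m. v (f m))"

text \<open>
  A \<open>K\<close>-algebra is a ring \<open>A\<close> with a structure map \<open>\<sigma>\<close> from \<open>K\<close>; a presentation of it as a quotient
  of the Tate algebra in \<open>n\<close> variables is a surjective \<open>K\<close>-algebra homomorphism \<open>\<pi>\<close>.
\<close>

definition presentation ::
  "('k::field \<Rightarrow> real) \<Rightarrow> ('a, 'm) ring_scheme \<Rightarrow> ('k \<Rightarrow> 'a) \<Rightarrow> nat \<Rightarrow>
    (((nat \<Rightarrow>\<^sub>0 nat) \<Rightarrow> 'k) \<Rightarrow> 'a) \<Rightarrow> bool" where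
  "presentation v A \<sigma> n \<pi> \<longleftrightarrow>
     1 \<le> n \<and> \<pi> \<in> ring_hom (tate_algebra v n) A \<and>
     \<pi> ` carrier (tate_algebra v n) = carrier A \<and>
     (\<forall>c. \<pi> (\<lambda>m. c when m = 0) = \<sigma> c)"

definition affinoid_algebra ::
  "('k::field \<Rightarrow> real) \<Rightarrow> ('a, 'm) ring_scheme \<Rightarrow> ('k \<Rightarrow> 'a) \<Rightarrow> bool" where
  "affinoid_algebra v A \<sigma> \<longleftrightarrow> cring A \<and> (\<exists>n \<pi>. presentation v A \<sigma> n \<pi>)"

definition residue_norm ::
  "('k::field \<Rightarrow> real) \<Rightarrow> nat \<Rightarrow> (((nat \<Rightarrow>\<^sub>0 nat) \<Rightarrow> 'k) \<Rightarrow> 'a) \<Rightarrow> 'a \<Rightarrow> real" where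
  "residue_norm v n \<pi> f = Inf {gauss_norm v t |t. t \<in> carrier (tate_algebra v n) \<and> \<pi> t = f}"


section \<open>The maximal spectrum and Laurent domains\<close>

definition max_spec :: "('a, 'm) ring_scheme \<Rightarrow> 'a set set" where
  "max_spec A = {x. maximalideal x A}"

definition nonarch_absolute_value :: "('a, 'm) ring_scheme \<Rightarrow> ('a \<Rightarrow> real) \<Rightarrow> bool" where
  "nonarch_absolute_value F w \<longleftrightarrow>
     (\<forall>a\<in>carrier F. 0 \<le> w a \<and> (w a = 0 \<longleftrightarrow> a = \<zero>\<^bsub>F\<^esub>)) \<and>
     (\<forall>a\<in>carrier F. \<forall>b\<in>carrier F. w (a \<otimes>\<^bsub>F\<^esub> b) = w a * w b \<and> w (a \<oplus>\<^bsub>F\<^esub> b) \<le> max (w a) (w b))"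

text \<open>
  \<open>|f(x)|\<close>: the common value at the class of \<open>f\<close> of all absolute values \<open>w\<close> on the residue field
  extending \<open>v\<close>; such a \<open>w\<close> is unique only as a function on the carrier.
\<close>

definition abs_at ::
  "('k::field \<Rightarrow> real) \<Rightarrow> ('a, 'm) ring_scheme \<Rightarrow> ('k \<Rightarrow> 'a) \<Rightarrow> 'a \<Rightarrow> 'a set \<Rightarrow> real" where
  "abs_at v A \<sigma> f x =
     (THE r. \<exists>w. nonarch_absolute_value (A Quot x) w \<and>
                 (\<forall>c. w (x +>\<^bsub>A\<^esub> \<sigma> c) = v c) \<and> r = w (x +>\<^bsub>A\<^esub> f))"

definition sqrt_value_group :: "('k::field \<Rightarrow> real) \<Rightarrow> real set" where
  "sqrt_value_group v = {\<alpha>. 0 < \<alpha> \<and> (\<exists>z. \<exists>n\<ge>1. \<alpha> ^ n = v z)}"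

definition open_Laurent_domain ::
  "('k::field \<Rightarrow> real) \<Rightarrow> ('a, 'm) ring_scheme \<Rightarrow> ('k \<Rightarrow> 'a) \<Rightarrow> 'a set set \<Rightarrow> bool" where
  "open_Laurent_domain v A \<sigma> U \<longleftrightarrow>
     (\<exists>(s::nat) (t::nat) f g \<alpha> \<beta>.
        (\<forall>i\<in>{1..s}. f i \<in> carrier A \<and> \<alpha> i \<in> sqrt_value_group v) \<and>
        (\<forall>j\<in>{1..t}. g j \<in> carrier A \<and> \<beta> j \<in> sqrt_value_group v) \<and>
        U = {x \<in> max_spec A. (\<forall>i\<in>{1..s}. abs_at v A \<sigma> (f i) x < \<alpha> i) \<and>
                             (\<forall>j\<in>{1..t}. abs_at v A \<sigma> (g j) x > \<beta> j)})"

definition Laurent_coverings ::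
  "('k::field \<Rightarrow> real) \<Rightarrow> ('a, 'm) ring_scheme \<Rightarrow> ('k \<Rightarrow> 'a) \<Rightarrow> 'a set set set set" where
  "Laurent_coverings v A \<sigma> =
     {C. covering (max_spec A) C \<and>
         (\<exists>D. finite D \<and> covering (max_spec A) D \<and> (\<forall>U\<in>D. open_Laurent_domain v A \<sigma> U) \<and>
              refines D C)}"


section \<open>The Berkovich space\<close>

text \<open>
  Seminorms are functions on the carrier of \<open>A\<close>, made extensional so that each is represented once.
\<close>

definition berkovich_space ::
  "('k::field \<Rightarrow> real) \<Rightarrow> ('a, 'm) ring_scheme \<Rightarrow> ('k \<Rightarrow> 'a) \<Rightarrow> ('a \<Rightarrow> real) set" where
  "berkovich_space v A \<sigma> =
     {p \<in> carrier A \<rightarrow>\<^sub>E {0..}.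
        p \<zero>\<^bsub>A\<^esub> = 0 \<and> p \<one>\<^bsub>A\<^esub> = 1 \<and>
        (\<forall>f\<in>carrier A. \<forall>g\<in>carrier A.
           p (f \<otimes>\<^bsub>A\<^esub> g) = p f * p g \<and> p (f \<oplus>\<^bsub>A\<^esub> g) \<le> max (p f) (p g)) \<and>
        (\<exists>n \<pi>. presentation v A \<sigma> n \<pi> \<and>
           (\<exists>c>0. \<forall>f\<in>carrier A. p f \<le> c * residue_norm v n \<pi> f))}"

definition berkovich_topology ::
  "('k::field \<Rightarrow> real) \<Rightarrow> ('a, 'm) ring_scheme \<Rightarrow> ('k \<Rightarrow> 'a) \<Rightarrow> ('a \<Rightarrow> real) topology" where
  "berkovich_topology v A \<sigma> =
     topology_generated_by {{p \<in> berkovich_space v A \<sigma>. p f \<in> U} |f U. f \<in> carrier A \<and> open U}"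

end

theory Submission
  imports Defs
begin

text \<open>
  The Berkovich space is a compact Hausdorff space whose uniform coverings are those refined by an
  open covering. Evaluation at maximal ideals embeds \<open>Max A\<close> into it, and everything rests on one
  density statement: a seminorm satisfying finitely many inequalities \<open>|f| \<le> \<alpha>\<close>, \<open>|g| \<ge> \<beta>\<close> with
  \<open>\<alpha>\<close>, \<open>\<beta>\<close> in the divisible closure of the value group can be replaced by a maximal ideal
  satisfying them. Consequently a finite family of open Laurent domains covers \<open>Max A\<close> iff its
  analogue covers the Berkovich space, the Laurent coverings are exactly the traces of the uniform
  coverings, and the image of \<open>Max A\<close> is dense.

  For the density, the inequalities define a proper ideal of a Tate algebra in more variables. A
  maximal ideal above it has a residue field finite over \<open>K\<close> (Nullstellensatz), hence contracts to a
  maximal ideal of \<open>A\<close>. The absolute value of the residue field is obtained as a minimal bounded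
  seminorm; it is unique because all norms on a finite-dimensional space are equivalent.
\<close>

section \<open>Uniform coverings\<close>

text \<open>Weak inequalities are the right form of the density statement: a point outside a finite
  family of open Laurent domains violates one strict inequality of each member, and the negations
  are finitely many weak ones. A maximal ideal satisfying them lies in no member either. A power of
  a threshold in the divisible closure of the value group is the value of a constant, so every
  condition can be rescaled to a comparison with 1; such thresholds are also dense, so a strict
  condition can be tightened to a weak one. The given seminorm itself witnesses that the ideal in
  the larger Tate algebra is proper: the ideal consists of the series whose scaled truncations are
  asymptotically negligible for this seminorm, and no completed localisation has to be formed. The
  Nullstellensatz is proved approximately, without Weierstrass division: finiteness and relations
  hold only modulo a constant of absolute value less than 1, and exact coefficients appear only when
  no variables remain, by successive approximation in the complete field.\<close>

definition star_of :: "'a set set \<Rightarrow> 'a \<Rightarrow> 'a set" where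
  "star_of C x = \<Union>{V\<in>C. x \<in> V}"

lemma star_ofI: "V \<in> C \<Longrightarrow> x \<in> V \<Longrightarrow> y \<in> V \<Longrightarrow> y \<in> star_of C x"
  by (auto simp: star_of_def)

lemma star_ofE: "y \<in> star_of C x \<Longrightarrow> (\<And>V. V \<in> C \<Longrightarrow> x \<in> V \<Longrightarrow> y \<in> V \<Longrightarrow> P) \<Longrightarrow> P"
  by (auto simp: star_of_def)

lemma star_of_sym: "y \<in> star_of C x \<longleftrightarrow> x \<in> star_of C y"
  by (auto simp: star_of_def)

lemma star_refines_starE:
  assumes "star_refines C D" "x \<in> P" "P \<in> C"
  obtains V where "V \<in> D" "star_of C x \<subseteq> V"
proof -
  obtain V where V: "V \<in> D" "\<Union>{W\<in>C. W \<inter> P \<noteq> {}} \<subseteq> V"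
    using assms(1,3) unfolding star_refines_def by blast
  have "star_of C x \<subseteq> \<Union>{W\<in>C. W \<inter> P \<noteq> {}}" using assms(2) unfolding star_of_def by blast
  then show ?thesis using that[OF V(1)] V(2) by (meson order_trans)
qed

lemma star_refines_meet:
  assumes "star_refines C D" "P \<in> C" "Q \<in> C" "P \<inter> Q \<noteq> {}"
  obtains V where "V \<in> D" "P \<union> Q \<subseteq> V"
proof -
  obtain V where V: "V \<in> D" "\<Union>{W\<in>C. W \<inter> P \<noteq> {}} \<subseteq> V"
    using assms unfolding star_refines_def by blast
  have "P \<union> Q \<subseteq> \<Union>{W\<in>C. W \<inter> P \<noteq> {}}" using assms(2-4) by blast
  then show ?thesis using that[OF V(1)] V(2) by (meson order_trans)
qed

text \<open>The triangle inequality of uniform coverings: two steps of size \<open>C\<close> make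
  one step of size \<open>D\<close>. It plays the role of halving an epsilon.\<close>

lemma star_refines_trans_star:
  assumes "star_refines C D" "y \<in> star_of C x" "z \<in> star_of C y"
  shows "z \<in> star_of D x"
proof -
  obtain P where P: "P \<in> C" "x \<in> P" "y \<in> P" using assms(2) by (rule star_ofE)
  obtain Q where Q: "Q \<in> C" "y \<in> Q" "z \<in> Q" using assms(3) by (rule star_ofE)
  have "P \<inter> Q \<noteq> {}" using P Q by blast
  then obtain V where "V \<in> D" "P \<union> Q \<subseteq> V" using star_refines_meet[OF assms(1) P(1) Q(1)] by blast
  then show ?thesis using P Q by (auto intro: star_ofI)
qed

lemma star_refines_imp_refines: "star_refines C D \<Longrightarrow> refines C D"
  unfolding refines_def
proof
  fix U assume CD: "star_refines C D" and U: "U \<in> C"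
  obtain V where V: "V \<in> D" "\<Union>{W\<in>C. W \<inter> U \<noteq> {}} \<subseteq> V"
    using CD U unfolding star_refines_def by blast
  have "U \<subseteq> \<Union>{W\<in>C. W \<inter> U \<noteq> {}}" using U by blast
  then show "\<exists>V\<in>D. U \<subseteq> V" using V by blast
qed

lemma refines_trans: "refines C D \<Longrightarrow> refines D E \<Longrightarrow> refines C E"
  unfolding refines_def by (meson order_trans)

lemma star_refines_refines:
  "star_refines C D \<Longrightarrow> refines D E \<Longrightarrow> star_refines C E"
  unfolding star_refines_def refines_def by (meson order_trans)

lemma refines_star_of_mono:
  assumes "refines C D" "y \<in> star_of C x" shows "y \<in> star_of D x"
  using assms unfolding refines_def by (meson star_ofE star_ofI subsetD)

lemma uniform_structureD:
  assumes "uniform_structure X \<C>"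
  shows "\<C> \<noteq> {}" "\<And>C. C \<in> \<C> \<Longrightarrow> covering X C"
    "\<And>C D. C \<in> \<C> \<Longrightarrow> covering X D \<Longrightarrow> refines C D \<Longrightarrow> D \<in> \<C>"
  using assms unfolding uniform_structure_def by blast+

lemma uniform_structure_star:
  assumes "uniform_structure X \<C>" "D \<in> \<C>" "E \<in> \<C>"
  obtains C where "C \<in> \<C>" "star_refines C D" "star_refines C E"
  using assms unfolding uniform_structure_def by meson

lemma covering_star_self:
  assumes "covering X C" "x \<in> X" shows "x \<in> star_of C x"
  using assms unfolding covering_def star_of_def by blast

lemma star_of_subset: "covering X C \<Longrightarrow> star_of C x \<subseteq> X"
  unfolding covering_def star_of_def by blast

lemma openin_uniform_topology:
  assumes "uniform_structure X \<C>"
  shows "openin (uniform_topology X \<C>) U \<longleftrightarrow> U \<subseteq> X \<and> (\<forall>x\<in>U. \<exists>C\<in>\<C>. star_of C x \<subseteq> U)"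
  unfolding uniform_topology_def topology_inverse'[OF istopology_uniform_open[OF assms]]
  by (simp add: uniform_open_def star_of_def)

lemma topspace_uniform_topology:
  assumes "uniform_structure X \<C>" shows "topspace (uniform_topology X \<C>) = X"
proof -
  have "openin (uniform_topology X \<C>) X"
    using uniform_structureD(1)[OF assms] star_of_subset[OF uniform_structureD(2)[OF assms]]
    unfolding openin_uniform_topology[OF assms] by fast
  moreover have "topspace (uniform_topology X \<C>) \<subseteq> X"
    using openin_topspace[of "uniform_topology X \<C>"] unfolding openin_uniform_topology[OF assms] by blast
  ultimately show ?thesis using openin_subset by blast
qed

text \<open>A star need not be open. The points having some star inside the given one form an open
  set: if \<open>E\<close> star-refines \<open>D\<close>, then for \<open>z\<close> in the
  \<open>E\<close>-star of \<open>y\<close> the \<open>E\<close>-star of \<open>z\<close> stays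
  inside the \<open>D\<close>-star of \<open>y\<close>.\<close>

lemma star_contains_open:
  assumes U: "uniform_structure X \<C>" and C: "C \<in> \<C>" and x: "x \<in> X"
  obtains W where "openin (uniform_topology X \<C>) W" "x \<in> W" "W \<subseteq> star_of C x"
proof
  define W where "W = {y\<in>X. \<exists>D\<in>\<C>. star_of D y \<subseteq> star_of C x}"
  show "openin (uniform_topology X \<C>) W"
    unfolding openin_uniform_topology[OF U]
  proof (intro conjI ballI)
    show "W \<subseteq> X" by (auto simp: W_def)
    fix y assume "y \<in> W"
    then obtain D where D: "y \<in> X" "D \<in> \<C>" "star_of D y \<subseteq> star_of C x" by (auto simp: W_def)
    obtain E where E: "E \<in> \<C>" "star_refines E D" using uniform_structure_star[OF U D(2) D(2)] by blast
    have "z \<in> W" if z: "z \<in> star_of E y" for z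
    proof -
      have "star_of E z \<subseteq> star_of C x"
        using star_refines_trans_star[OF E(2) z] D(3) by blast
      moreover have "z \<in> X" using z star_of_subset[OF uniform_structureD(2)[OF U E(1)]] by blast
      ultimately show ?thesis using E(1) by (auto simp: W_def)
    qed
    then show "\<exists>C\<in>\<C>. star_of C y \<subseteq> W" using E(1) by blast
  qed
  show "x \<in> W" using C x by (auto simp: W_def)
  show "W \<subseteq> star_of C x"
    using covering_star_self uniform_structureD(2)[OF U] by (fastforce simp: W_def)
qed

lemma limitin_star:
  assumes U: "uniform_structure X \<C>" and "limitin (uniform_topology X \<C>) (\<lambda>x. x) l F" "C \<in> \<C>"
  shows "l \<in> X" "\<forall>\<^sub>F x in F. x \<in> star_of C l"
proof -
  show l: "l \<in> X" using assms(2) by (simp add: limitin_def topspace_uniform_topology[OF U])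
  obtain W where W: "openin (uniform_topology X \<C>) W" "l \<in> W" "W \<subseteq> star_of C l"
    using star_contains_open[OF U assms(3) l] .
  then have "\<forall>\<^sub>F x in F. x \<in> W" using assms(2) by (simp add: limitin_def)
  then show "\<forall>\<^sub>F x in F. x \<in> star_of C l" by (rule eventually_mono) (use W in blast)
qed

subsection \<open>The uniform structure of a compact Hausdorff space\<close>

lemma compact_space_subcover:
  assumes T: "compact_space T" and V: "\<And>x. x \<in> topspace T \<Longrightarrow> openin T (V x) \<and> x \<in> V x"
  obtains S where "finite S" "S \<subseteq> topspace T" "topspace T \<subseteq> (\<Union>s\<in>S. V s)"
proof -
  have "\<forall>U\<in>V ` topspace T. openin T U" "topspace T \<subseteq> \<Union>(V ` topspace T)" using V by blast+
  then obtain \<F> where "finite \<F>" "\<F> \<subseteq> V ` topspace T" "topspace T \<subseteq> \<Union>\<F>"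
    using T unfolding compact_space_alt by meson
  then show ?thesis using that by (metis finite_subset_image)
qed

definition open_coverings :: "'a topology \<Rightarrow> 'a set set set" where
  "open_coverings T = {C. covering (topspace T) C \<and>
     (\<exists>D. covering (topspace T) D \<and> (\<forall>U\<in>D. openin T U) \<and> refines D C)}"

lemma open_coveringsI:
  "covering (topspace T) C \<Longrightarrow> (\<And>U. U \<in> C \<Longrightarrow> openin T U) \<Longrightarrow> C \<in> open_coverings T"
  unfolding open_coverings_def refines_def by blast

text \<open>Regularity shrinks members of \<open>D\<close> to closed sets \<open>K s\<close>, and
  compactness leaves finitely many \<open>s\<close>. The neighbourhood of \<open>x\<close> is
  dictated by which \<open>K s\<close> contain \<open>x\<close>, so all neighbourhoods containing a
  given point of \<open>V s\<close> lie in the one set \<open>U s\<close>.\<close>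

lemma barycentric_refinement:
  assumes T: "compact_space T" "Hausdorff_space T"
    and D: "covering (topspace T) D" "\<forall>U\<in>D. openin T U"
  obtains W where "covering (topspace T) W" "\<forall>U\<in>W. openin T U" "\<And>y. \<exists>U\<in>D. star_of W y \<subseteq> U"
proof -
  have reg: "regular_space T" by (simp add: T compact_Hausdorff_imp_regular_space)
  have "\<exists>U V K. U \<in> D \<and> openin T V \<and> closedin T K \<and> x \<in> V \<and> V \<subseteq> K \<and> K \<subseteq> U"
    if x: "x \<in> topspace T" for x
  proof -
    obtain U where U: "U \<in> D" "x \<in> U" using D x unfolding covering_def by blast
    then have "openin T U" using D by blast
    then have "closedin T (topspace T - U)" "x \<in> topspace T - (topspace T - U)" using x U by auto
    then obtain V V' where V: "openin T V" "openin T V'" "x \<in> V" "topspace T - U \<subseteq> V'" "disjnt V V'"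
      using reg[unfolded regular_space_def, rule_format, of "topspace T - U" x] by blast
    have "V \<subseteq> topspace T - V'" using V(5) openin_subset[OF V(1)] by (auto simp: disjnt_iff)
    moreover have "topspace T - V' \<subseteq> U" using V(4) by blast
    moreover have "closedin T (topspace T - V')" using V(2) by blast
    ultimately show ?thesis using U(1) V(1,3) by blast
  qed
  then obtain U V K where UVK: "\<And>x. x \<in> topspace T \<Longrightarrow> U x \<in> D \<and> openin T (V x) \<and> closedin T (K x) \<and> x \<in> V x \<and> V x \<subseteq> K x \<and> K x \<subseteq> U x"
    by metis
  obtain S where S: "finite S" "S \<subseteq> topspace T" "topspace T \<subseteq> (\<Union>s\<in>S. V s)"
    using compact_space_subcover[OF T(1), of V] UVK by metis
  \<comment> \<open>Finiteness of \<open>S\<close> makes \<open>W x\<close> open. If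
    \<open>y\<close> lies in \<open>K s\<close> and in \<open>W x\<close>, the second clause forces
    \<open>x\<close> into \<open>K s\<close>, and then the first clause puts \<open>W x\<close> into
    \<open>U s\<close>.\<close>
  define W where "W x = {y\<in>topspace T. (\<forall>s\<in>S. x \<in> K s \<longrightarrow> y \<in> U s) \<and> (\<forall>s\<in>S. x \<notin> K s \<longrightarrow> y \<notin> K s)}" for x
  have opW: "openin T (W x)" for x
  proof -
    define N where "N s = (if x \<in> K s then U s else topspace T - K s)" for s
    have eq: "W x = topspace T \<inter> \<Inter>(N ` S)"
      unfolding W_def N_def by (auto split: if_splits)
    have "openin T (N s)" if "s \<in> S" for s
      using UVK[of s] that S(2) D(2) by (auto simp: N_def)
    then have "openin T (topspace T \<inter> \<Inter>(N ` S))"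
      using S(1) by (cases "S = {}") (auto intro!: openin_Int openin_Inter)
    then show ?thesis unfolding eq by blast
  qed
  have xW: "x \<in> W x" if "x \<in> topspace T" for x
    using that UVK S(2) by (auto simp: W_def)
  \<comment> \<open>The empty set keeps the covering nonempty when the space has no points.\<close>
  define W' where "W' = insert {} (W ` topspace T)"
  have "covering (topspace T) W'"
    unfolding covering_def W'_def
  proof (intro conjI equalityI subsetI)
    show "y \<in> topspace T" if "y \<in> \<Union>(insert {} (W ` topspace T))" for y using that by (auto simp: W_def)
    show "y \<in> \<Union>(insert {} (W ` topspace T))" if "y \<in> topspace T" for y using that xW by auto
  qed simp
  moreover have "\<forall>U\<in>W'. openin T U" using opW by (auto simp: W'_def)
  moreover have "\<exists>U\<in>D. star_of W' y \<subseteq> U" for y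
  proof (cases "y \<in> topspace T")
    case True
    then obtain s where s: "s \<in> S" "y \<in> V s" using S(3) by blast
    then have ys: "y \<in> K s" "U s \<in> D" using UVK[of s] S(2) by auto
    have "star_of W' y \<subseteq> U s"
    proof
      fix z assume "z \<in> star_of W' y"
      then obtain x where "x \<in> topspace T" "y \<in> W x" "z \<in> W x"
        by (auto simp: star_of_def W'_def)
      then show "z \<in> U s" using ys s by (auto simp: W_def)
    qed
    then show ?thesis using ys by blast
  next
    case False
    then have "star_of W' y = {}" by (auto simp: star_of_def W'_def W_def)
    then show ?thesis using D(1) by (auto simp: covering_def)
  qed
  ultimately show ?thesis using that by blast
qed

text \<open>Two barycentric refinements in succession: a member \<open>Q\<close> meeting
  \<open>P\<close> in \<open>z\<close> lies together with \<open>P\<close> in the star of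
  \<open>z\<close>, hence in a member of \<open>W\<close>, and all these members of \<open>W\<close>
  contain one fixed point of \<open>P\<close>.\<close>

lemma open_star_refinement:
  assumes T: "compact_space T" "Hausdorff_space T"
    and D: "covering (topspace T) D" "\<forall>U\<in>D. openin T U"
  obtains W where "covering (topspace T) W" "\<forall>U\<in>W. openin T U" "star_refines W D"
proof -
  obtain W where W: "covering (topspace T) W" "\<forall>U\<in>W. openin T U" "\<And>y. \<exists>U\<in>D. star_of W y \<subseteq> U"
    using barycentric_refinement[OF T D] by blast
  obtain W' where W': "covering (topspace T) W'" "\<forall>U\<in>W'. openin T U" "\<And>y. \<exists>U\<in>W. star_of W' y \<subseteq> U"
    using barycentric_refinement[OF T W(1,2)] by blast
  have "star_refines W' D"
    unfolding star_refines_def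
  proof
    fix P assume P: "P \<in> W'"
    show "\<exists>V\<in>D. \<Union> {Q \<in> W'. Q \<inter> P \<noteq> {}} \<subseteq> V"
    proof (cases "P = {}")
      case True then show ?thesis using D(1) by (auto simp: covering_def)
    next
      case False
      then obtain y where y: "y \<in> P" by blast
      obtain U where U: "U \<in> D" "star_of W y \<subseteq> U" using W(3) by blast
      have "Q \<subseteq> U" if Q: "Q \<in> W'" "Q \<inter> P \<noteq> {}" for Q
      proof -
        obtain z where z: "z \<in> Q" "z \<in> P" using Q by blast
        obtain V where V: "V \<in> W" "star_of W' z \<subseteq> V" using W'(3) by blast
        have "y \<in> V" "Q \<subseteq> V" using V P Q y z unfolding star_of_def by blast+
        then show ?thesis using U V unfolding star_of_def by blast
      qed
      then show ?thesis using U by blast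
    qed
  qed
  with W' that show ?thesis by blast
qed

lemma open_coverings_uniform:
  assumes T: "compact_space T" "Hausdorff_space T"
  shows "Hausdorff_uniform_structure (topspace T) (open_coverings T)"
proof -
  have "\<exists>C\<in>open_coverings T. star_refines C D1 \<and> star_refines C D2"
    if D1: "D1 \<in> open_coverings T" and D2: "D2 \<in> open_coverings T" for D1 D2
  proof -
    obtain E1 where E1: "covering (topspace T) E1" "\<forall>U\<in>E1. openin T U" "refines E1 D1"
      using D1 by (auto simp: open_coverings_def)
    obtain E2 where E2: "covering (topspace T) E2" "\<forall>U\<in>E2. openin T U" "refines E2 D2"
      using D2 by (auto simp: open_coverings_def)
    define E where "E = {U \<inter> V |U V. U \<in> E1 \<and> V \<in> E2}"
    have cE: "covering (topspace T) E"
      using E1(1) E2(1) unfolding covering_def E_def by blast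
    have oE: "\<forall>U\<in>E. openin T U" using E1(2) E2(2) by (auto simp: E_def)
    obtain W where W: "covering (topspace T) W" "\<forall>U\<in>W. openin T U" "star_refines W E"
      using open_star_refinement[OF T cE oE] .
    have "refines E E1" "refines E E2" unfolding E_def refines_def by auto
    then have "star_refines W D1" "star_refines W D2"
      using star_refines_refines[OF W(3)] refines_trans E1(3) E2(3) by metis+
    moreover have "W \<in> open_coverings T"
      using open_coveringsI[OF W(1)] W(2) by blast
    ultimately show ?thesis by blast
  qed
  moreover have "{topspace T} \<in> open_coverings T"
    by (intro open_coveringsI) (auto simp: covering_def)
  moreover have "\<exists>C\<in>open_coverings T. \<forall>U\<in>C. \<not> (x \<in> U \<and> y \<in> U)"
    if "x \<in> topspace T" "y \<in> topspace T" "x \<noteq> y" for x y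
  proof
    have "closedin T {x}" "closedin T {y}"
      using T(2) that by (simp_all add: closedin_Hausdorff_singleton)
    moreover have "covering (topspace T) {topspace T - {x}, topspace T - {y}}" using that by (auto simp: covering_def)
    ultimately show "{topspace T - {x}, topspace T - {y}} \<in> open_coverings T"
      by (intro open_coveringsI) auto
  qed auto
  ultimately show ?thesis
    unfolding Hausdorff_uniform_structure_def uniform_structure_def
    by (auto simp: open_coverings_def intro: refines_trans)
qed

lemma open_coverings_compatible:
  assumes T: "compact_space T" "Hausdorff_space T"
  shows "compatible_uniform_structure T (open_coverings T)"
proof -
  have U: "uniform_structure (topspace T) (open_coverings T)"
    using open_coverings_uniform[OF T] by (simp add: Hausdorff_uniform_structure_def)
  have "openin (uniform_topology (topspace T) (open_coverings T)) S \<longleftrightarrow> openin T S" for S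
  proof
    assume S: "openin T S"
    have "\<exists>C\<in>open_coverings T. star_of C x \<subseteq> S" if x: "x \<in> S" for x
    proof
      have "closedin T {x}"
        using T(2) x openin_subset[OF S] by (auto simp: closedin_Hausdorff_singleton)
      moreover have "covering (topspace T) {S, topspace T - {x}}"
        using x openin_subset[OF S] by (auto simp: covering_def)
      ultimately show "{S, topspace T - {x}} \<in> open_coverings T"
        using S by (intro open_coveringsI) auto
    qed (auto simp: star_of_def)
    then show "openin (uniform_topology (topspace T) (open_coverings T)) S"
      using openin_subset[OF S] by (simp add: openin_uniform_topology[OF U])
  next
    assume S: "openin (uniform_topology (topspace T) (open_coverings T)) S"
    show "openin T S"
      unfolding openin_subopen[of T S]
    proof
      fix x assume x: "x \<in> S"
      then obtain C where C: "C \<in> open_coverings T" "star_of C x \<subseteq> S" "x \<in> topspace T"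
        using S unfolding openin_uniform_topology[OF U] by blast
      then obtain D where D: "covering (topspace T) D" "\<forall>U\<in>D. openin T U" "refines D C"
        by (auto simp: open_coverings_def)
      then obtain V where V: "V \<in> D" "x \<in> V" using C(3) unfolding covering_def by blast
      then obtain P where "P \<in> C" "V \<subseteq> P" using D(3) unfolding refines_def by blast
      then have "V \<subseteq> S" using V C(2) unfolding star_of_def by blast
      then show "\<exists>V. openin T V \<and> x \<in> V \<and> V \<subseteq> S" using V D(2) by blast
    qed
  qed
  then have "uniform_topology (topspace T) (open_coverings T) = T" by (simp add: topology_eq)
  with U show ?thesis by (simp add: compatible_uniform_structure_def)
qed

lemma finite_common_refinement:
  assumes U: "uniform_structure X \<C>" and "finite S" "\<And>s. s \<in> S \<Longrightarrow> f s \<in> \<C>"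
  shows "\<exists>E\<in>\<C>. \<forall>s\<in>S. refines E (f s)"
  using assms(2,3)
proof (induction S rule: finite_induct)
  case empty
  then show ?case using uniform_structureD(1)[OF U] by blast
next
  case (insert s S)
  then obtain E where E: "E \<in> \<C>" "\<forall>s\<in>S. refines E (f s)" by blast
  obtain E' where "E' \<in> \<C>" "star_refines E' E" "star_refines E' (f s)"
    using uniform_structure_star[OF U E(1) insert.prems[of s]] by blast
  then show ?case using E by (metis insert_iff refines_trans star_refines_imp_refines)
qed

text \<open>One inclusion holds because the star of a point contains an open neighbourhood of it.
  The other is the existence of a Lebesgue number: finitely many points control the given open
  covering, and a common refinement of the uniform coverings chosen at them works
  everywhere.\<close>

lemma compatible_unique:
  assumes T: "compact_space T" and \<D>: "compatible_uniform_structure T \<D>"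
  shows "\<D> = open_coverings T"
proof -
  have U: "uniform_structure (topspace T) \<D>" and eq: "uniform_topology (topspace T) \<D> = T"
    using \<D> by (auto simp: compatible_uniform_structure_def)
  show ?thesis
  proof (intro equalityI subsetI)
    fix C assume C: "C \<in> \<D>"
    obtain C' where C': "C' \<in> \<D>" "star_refines C' C" using uniform_structure_star[OF U C C] by blast
    define D where "D = {U. openin T U \<and> (\<exists>V\<in>C. U \<subseteq> V)}"
    have cov: "covering (topspace T) C" "covering (topspace T) C'" using uniform_structureD(2)[OF U] C C' by auto
    have "\<exists>W\<in>D. x \<in> W" if x: "x \<in> topspace T" for x
    proof -
      obtain W where W: "openin T W" "x \<in> W" "W \<subseteq> star_of C' x"
        using star_contains_open[OF U C'(1) x] unfolding eq .
      obtain P where P: "P \<in> C'" "x \<in> P" using cov(2) x unfolding covering_def by blast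
      obtain V where "V \<in> C" "star_of C' x \<subseteq> V" using star_refines_starE[OF C'(2) P(2,1)] .
      then show ?thesis using W unfolding D_def by blast
    qed
    moreover have "{} \<in> D" using cov(1) by (auto simp: D_def covering_def)
    moreover have "U \<subseteq> topspace T" if "U \<in> D" for U using that openin_subset unfolding D_def by blast
    ultimately have "covering (topspace T) D"
      unfolding covering_def by fast
    moreover have "refines D C" by (auto simp: D_def refines_def)
    ultimately show "C \<in> open_coverings T" using cov(1) by (auto simp: open_coverings_def D_def)
  next
    fix C assume "C \<in> open_coverings T"
    then obtain D where C: "covering (topspace T) C" and D: "covering (topspace T) D" "\<forall>U\<in>D. openin T U" "refines D C"
      by (auto simp: open_coverings_def)
    have "\<exists>U E' W. U \<in> D \<and> E' \<in> \<D> \<and> openin T W \<and> x \<in> W \<and> (\<forall>y\<in>W. \<forall>z. z \<in> star_of E' y \<longrightarrow> z \<in> U)"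
      if x: "x \<in> topspace T" for x
    proof -
      obtain U1 where U1: "U1 \<in> D" "x \<in> U1" using D(1) x unfolding covering_def by blast
      then have "openin (uniform_topology (topspace T) \<D>) U1" using D(2) eq by simp
      then obtain E where E: "E \<in> \<D>" "star_of E x \<subseteq> U1"
        using U1(2) unfolding openin_uniform_topology[OF U] by blast
      obtain E' where E': "E' \<in> \<D>" "star_refines E' E" using uniform_structure_star[OF U E(1) E(1)] by blast
      obtain W where W: "openin T W" "x \<in> W" "W \<subseteq> star_of E' x"
        using star_contains_open[OF U E'(1) x] unfolding eq .
      have "\<forall>y\<in>W. \<forall>z. z \<in> star_of E' y \<longrightarrow> z \<in> U1"
        using star_refines_trans_star[OF E'(2)] W(3) E(2) by blast
      then show ?thesis using U1 E' W by blast
    qed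
    then obtain Uf Ef Wf where f: "\<And>x. x \<in> topspace T \<Longrightarrow> Uf x \<in> D \<and> Ef x \<in> \<D> \<and> openin T (Wf x) \<and> x \<in> Wf x \<and> (\<forall>y\<in>Wf x. \<forall>z. z \<in> star_of (Ef x) y \<longrightarrow> z \<in> Uf x)"
      by metis
    obtain S where S: "finite S" "S \<subseteq> topspace T" "topspace T \<subseteq> (\<Union>s\<in>S. Wf s)"
      using compact_space_subcover[OF T, of Wf] f by metis
    obtain E where E: "E \<in> \<D>" "\<And>s. s \<in> S \<Longrightarrow> refines E (Ef s)"
      using finite_common_refinement[OF U S(1), of Ef] f S(2) by blast
    have "refines E D"
      unfolding refines_def
    proof
      fix V assume V: "V \<in> E"
      show "\<exists>W\<in>D. V \<subseteq> W"
      proof (cases "V = {}")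
        case True then show ?thesis using D(1) by (auto simp: covering_def)
      next
        case False
        then obtain y where y: "y \<in> V" by blast
        then have "y \<in> topspace T" using V uniform_structureD(2)[OF U E(1)] unfolding covering_def by blast
        then obtain s where s: "s \<in> S" "y \<in> Wf s" using S(3) by blast
        have "V \<subseteq> Uf s"
        proof
          fix z assume "z \<in> V"
          then have "z \<in> star_of E y" using V y by (auto intro: star_ofI)
          then have "z \<in> star_of (Ef s) y" using refines_star_of_mono[OF E(2)[OF s(1)]] by blast
          then show "z \<in> Uf s" using f[of s] s S(2) by blast
        qed
        then show ?thesis using f s(1) S(2) by blast
      qed
    qed
    then show "C \<in> \<D>" using uniform_structureD(3)[OF U E(1) C] D(3) refines_trans by blast
  qed
qed

lemma the_uniform_structure_eq:
  assumes "compact_space T" "Hausdorff_space T"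
  shows "\<exists>!\<U>. compatible_uniform_structure T \<U>" "the_uniform_structure T = open_coverings T"
  using open_coverings_compatible[OF assms] compatible_unique[OF assms(1)]
  unfolding the_uniform_structure_def by (blast, metis the_equality)

text \<open>If no point were a limit, the neighbourhoods witnessing this would form a uniform covering
  none of whose members belongs to the filter.\<close>

lemma compact_complete_uniform:
  assumes T: "compact_space T" "Hausdorff_space T"
  shows "complete_uniform (topspace T) (open_coverings T)"
  unfolding complete_uniform_def
proof (intro allI impI)
  fix F assume F: "Cauchy_filter_in (topspace T) (open_coverings T) F"
  have eq: "uniform_topology (topspace T) (open_coverings T) = T"
    using open_coverings_compatible[OF T] by (simp add: compatible_uniform_structure_def)
  show "\<exists>l. limitin (uniform_topology (topspace T) (open_coverings T)) (\<lambda>x. x) l F"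
  proof (rule ccontr)
    assume "\<nexists>l. limitin (uniform_topology (topspace T) (open_coverings T)) (\<lambda>x. x) l F"
    then have n: "\<And>l. l \<in> topspace T \<Longrightarrow> \<exists>W. openin T W \<and> l \<in> W \<and> \<not> (\<forall>\<^sub>F x in F. x \<in> W)"
      unfolding eq limitin_def by blast
    define C where "C = {W. openin T W \<and> \<not> (\<forall>\<^sub>F x in F. x \<in> W)}"
    have "{} \<in> C" using F by (auto simp: C_def Cauchy_filter_in_def trivial_limit_def)
    moreover have "\<exists>W\<in>C. l \<in> W" if "l \<in> topspace T" for l using n[OF that] by (auto simp: C_def)
    moreover have "W \<subseteq> topspace T" if "W \<in> C" for W using that openin_subset unfolding C_def by blast
    ultimately have "covering (topspace T) C"
      unfolding covering_def by fast
    then have "C \<in> open_coverings T" by (auto simp: open_coverings_def C_def refines_def)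
    then show False using F by (auto simp: Cauchy_filter_in_def C_def)
  qed
qed


subsection \<open>Induced structures and completions\<close>

lemma induced_uniform:
  assumes U: "uniform_structure Y \<D>" and i: "i \<in> X \<rightarrow> Y"
  shows "uniform_structure X (induced_coverings X i \<D>)"
proof -
  let ?pb = "\<lambda>D. (\<lambda>U. i -` U \<inter> X) ` D"
  have cov: "covering X (?pb D)" if "D \<in> \<D>" for D
    using uniform_structureD(2)[OF U that] i unfolding covering_def by auto
  have mem: "?pb D \<in> induced_coverings X i \<D>" if "D \<in> \<D>" for D
    using cov[OF that] that unfolding induced_coverings_def refines_def by blast
  have sr: "star_refines (?pb C) (?pb D)" if CD: "star_refines C D" for C D
    unfolding star_refines_def
  proof
    fix P assume "P \<in> ?pb C"
    then obtain Q where Q: "Q \<in> C" "P = i -` Q \<inter> X" by blast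
    obtain V where V: "V \<in> D" "\<Union>{W\<in>C. W \<inter> Q \<noteq> {}} \<subseteq> V" using CD Q(1) unfolding star_refines_def by blast
    then have *: "W \<subseteq> V" if "W \<in> C" "W \<inter> Q \<noteq> {}" for W using that by blast
    have "\<Union>{W\<in>?pb C. W \<inter> P \<noteq> {}} \<subseteq> i -` V \<inter> X"
    proof
      fix z assume "z \<in> \<Union>{W\<in>?pb C. W \<inter> P \<noteq> {}}"
      then obtain W y where W: "W \<in> C" "z \<in> i -` W \<inter> X" "y \<in> i -` W \<inter> X" "y \<in> P" by blast
      then have "W \<inter> Q \<noteq> {}" using Q by blast
      then show "z \<in> i -` V \<inter> X" using *[OF W(1)] W(2) by blast
    qed
    then show "\<exists>V\<in>?pb D. \<Union>{W\<in>?pb C. W \<inter> P \<noteq> {}} \<subseteq> V" using V(1) by blast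
  qed
  show ?thesis
    unfolding uniform_structure_def
  proof (intro conjI ballI allI impI)
    obtain D where "D \<in> \<D>" using uniform_structureD(1)[OF U] by blast
    then show "induced_coverings X i \<D> \<noteq> {}" using mem by blast
    fix C assume C: "C \<in> induced_coverings X i \<D>"
    then show "covering X C" by (simp add: induced_coverings_def)
    fix D assume "covering X D \<and> refines C D"
    then show "D \<in> induced_coverings X i \<D>"
      using C unfolding induced_coverings_def by (blast intro: refines_trans)
  next
    fix D1 D2 assume "D1 \<in> induced_coverings X i \<D>" "D2 \<in> induced_coverings X i \<D>"
    then obtain E1 E2 where E: "E1 \<in> \<D>" "refines (?pb E1) D1" "E2 \<in> \<D>" "refines (?pb E2) D2"
      unfolding induced_coverings_def by blast
    obtain C where C: "C \<in> \<D>" "star_refines C E1" "star_refines C E2"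
      using uniform_structure_star[OF U E(1,3)] .
    have "star_refines (?pb C) D1" "star_refines (?pb C) D2"
      using sr[OF C(2)] sr[OF C(3)] E(2,4) star_refines_refines by blast+
    then show "\<exists>C\<in>induced_coverings X i \<D>. star_refines C D1 \<and> star_refines C D2"
      using mem[OF C(1)] by blast
  qed
qed

lemma induced_Hausdorff:
  assumes U: "Hausdorff_uniform_structure Y \<D>" and i: "i \<in> X \<rightarrow> Y" "inj_on i X"
  shows "Hausdorff_uniform_structure X (induced_coverings X i \<D>)"
  unfolding Hausdorff_uniform_structure_def
proof (intro conjI ballI impI)
  have U': "uniform_structure Y \<D>" using U by (simp add: Hausdorff_uniform_structure_def)
  show "uniform_structure X (induced_coverings X i \<D>)" by (rule induced_uniform[OF U' i(1)])
  fix x y assume xy: "x \<in> X" "y \<in> X" "x \<noteq> y"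
  then have "i x \<in> Y" "i y \<in> Y" "i x \<noteq> i y" using i by (auto simp: inj_on_def)
  then obtain D where D: "D \<in> \<D>" "\<forall>U\<in>D. \<not> (i x \<in> U \<and> i y \<in> U)"
    using U unfolding Hausdorff_uniform_structure_def by blast
  have "covering X ((\<lambda>U. i -` U \<inter> X) ` D)"
    using uniform_structureD(2)[OF U' D(1)] i unfolding covering_def by auto
  then have "(\<lambda>U. i -` U \<inter> X) ` D \<in> induced_coverings X i \<D>"
    using D(1) unfolding induced_coverings_def refines_def by blast
  moreover have "\<forall>U\<in>(\<lambda>U. i -` U \<inter> X) ` D. \<not> (x \<in> U \<and> y \<in> U)" using D(2) by simp
  ultimately show "\<exists>C\<in>induced_coverings X i \<D>. \<forall>U\<in>C. \<not> (x \<in> U \<and> y \<in> U)" by (rule bexI[rotated])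
qed

lemma closure_meets_star:
  assumes U: "uniform_structure Y \<D>" and d: "uniform_topology Y \<D> closure_of S = Y"
    and y: "y \<in> Y" and D: "D \<in> \<D>"
  obtains s where "s \<in> S" "s \<in> star_of D y"
proof -
  obtain W where W: "openin (uniform_topology Y \<D>) W" "y \<in> W" "W \<subseteq> star_of D y"
    using star_contains_open[OF U D y] .
  have "y \<in> uniform_topology Y \<D> closure_of S" using y d by simp
  then obtain s where "s \<in> S" "s \<in> W" using W unfolding in_closure_of by blast
  then show ?thesis using W that by blast
qed

text \<open>The value of the extension at \<open>y\<close> is the limit of the Cauchy filter on \<open>Z\<close> generated by the
  images of the traces on \<open>X\<close> of the stars of \<open>y\<close>.\<close>

lemma extension_to_complete:
  assumes U: "uniform_structure Y \<D>" and i: "i \<in> X \<rightarrow> Y"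
    and d: "uniform_topology Y \<D> closure_of (i ` X) = Y"
    and HZ: "Hausdorff_uniform_structure Z \<E>" and cZ: "complete_uniform Z \<E>" and j: "j \<in> X \<rightarrow> Z"
    and ind: "induced_coverings X j \<E> \<subseteq> induced_coverings X i \<D>"
  obtains e where "uniformly_continuous_map Y \<D> Z \<E> e" "\<And>x. x \<in> X \<Longrightarrow> e (i x) = j x"
proof -
  have UZ: "uniform_structure Z \<E>" using HZ by (simp add: Hausdorff_uniform_structure_def)
  define tr where "tr y D = j ` (i -` (star_of D y) \<inter> X)" for y D
  define F where "F y = (INF D\<in>\<D>. principal (tr y D))" for y
  have evF: "eventually P (F y) \<longleftrightarrow> (\<exists>D\<in>\<D>. \<forall>z\<in>tr y D. P z)" for y P
  proof -
    have "eventually P (F y) \<longleftrightarrow> (\<exists>D\<in>\<D>. eventually P (principal (tr y D)))"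
      unfolding F_def
    proof (rule eventually_INF_base)
      show "\<D> \<noteq> {}" using uniform_structureD(1)[OF U] .
      fix D E assume DE: "D \<in> \<D>" "E \<in> \<D>"
      obtain C where C: "C \<in> \<D>" "star_refines C D" "star_refines C E"
        using uniform_structure_star[OF U DE] .
      have "tr y C \<subseteq> tr y D" "tr y C \<subseteq> tr y E"
        using refines_star_of_mono[OF star_refines_imp_refines[OF C(2)]]
          refines_star_of_mono[OF star_refines_imp_refines[OF C(3)]] unfolding tr_def by auto
      then show "\<exists>x\<in>\<D>. principal (tr y x) \<le> inf (principal (tr y D)) (principal (tr y E))"
        using C(1) by auto
    qed
    then show ?thesis by (simp add: eventually_principal)
  qed
  \<comment> \<open>The essential uniformity: \<open>G\<close> depends on the member
    \<open>P\<close> only and not on the point \<open>y\<close> in it. Applied to one point this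
    gives the Cauchy property, applied to a whole \<open>P\<close> the uniform continuity of the
    extension.\<close>
  have key: "\<exists>D\<in>\<D>. \<forall>P\<in>D. \<exists>G\<in>E. \<forall>y\<in>P. \<forall>\<^sub>F z in F y. z \<in> G" if E: "E \<in> \<E>" for E
  proof -
    have "covering X ((\<lambda>U. j -` U \<inter> X) ` E)"
      using uniform_structureD(2)[OF UZ E] j unfolding covering_def by auto
    then have "(\<lambda>U. j -` U \<inter> X) ` E \<in> induced_coverings X j \<E>"
      using E unfolding induced_coverings_def refines_def by blast
    then obtain D where D: "D \<in> \<D>" "refines ((\<lambda>U. i -` U \<inter> X) ` D) ((\<lambda>U. j -` U \<inter> X) ` E)"
      using ind unfolding induced_coverings_def by blast
    obtain D' where D': "D' \<in> \<D>" "star_refines D' D" using uniform_structure_star[OF U D(1) D(1)] by metis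
    have "\<exists>G\<in>E. \<forall>y\<in>P. \<forall>\<^sub>F z in F y. z \<in> G" if P: "P \<in> D'" for P
    proof -
      obtain V where V: "V \<in> D" "\<Union>{W\<in>D'. W \<inter> P \<noteq> {}} \<subseteq> V"
        using D'(2) P unfolding star_refines_def by blast
      obtain G where G: "G \<in> E" "i -` V \<inter> X \<subseteq> j -` G \<inter> X" using D(2) V(1) unfolding refines_def by blast
      have "\<forall>z\<in>tr y D'. z \<in> G" if y: "y \<in> P" for y
      proof
        fix z assume "z \<in> tr y D'"
        then obtain x where x: "x \<in> X" "i x \<in> star_of D' y" "z = j x" unfolding tr_def by blast
        obtain W where "W \<in> D'" "y \<in> W" "i x \<in> W" using x(2) by (rule star_ofE)
        then have "i x \<in> V" using y V(2) by blast
        then show "z \<in> G" using G(2) x by blast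
      qed
      then show ?thesis using G(1) D'(1) unfolding evF by blast
    qed
    then show ?thesis using D'(1) by blast
  qed
  have nb: "F y \<noteq> bot" if y: "y \<in> Y" for y
  proof
    assume "F y = bot"
    then have "eventually (\<lambda>z. False) (F y)" by simp
    then obtain D where D: "D \<in> \<D>" "tr y D = {}" unfolding evF by blast
    obtain s where "s \<in> i ` X" "s \<in> star_of D y" using closure_meets_star[OF U d y D(1)] .
    then show False using D(2) unfolding tr_def by blast
  qed
  have "\<exists>l. limitin (uniform_topology Z \<E>) (\<lambda>x. x) l (F y)" if y: "y \<in> Y" for y
  proof -
    have "Cauchy_filter_in Z \<E> (F y)"
      unfolding Cauchy_filter_in_def
    proof (intro conjI ballI)
      show "F y \<noteq> bot" by (rule nb[OF y])
      obtain D where "D \<in> \<D>" using uniform_structureD(1)[OF U] by blast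
      then have "\<forall>\<^sub>F z in F y. z \<in> Z" using j unfolding evF tr_def by blast
      then show "F y \<le> principal Z" by (simp add: le_principal)
      fix E assume "E \<in> \<E>"
      then obtain D where D: "D \<in> \<D>" "\<forall>P\<in>D. \<exists>G\<in>E. \<forall>y\<in>P. \<forall>\<^sub>F z in F y. z \<in> G" using key by blast
      then obtain P where "P \<in> D" "y \<in> P" using uniform_structureD(2)[OF U D(1)] y unfolding covering_def by blast
      then show "\<exists>G\<in>E. \<forall>\<^sub>F z in F y. z \<in> G" using D(2) by blast
    qed
    then show ?thesis using cZ unfolding complete_uniform_def by blast
  qed
  then obtain e where e: "\<And>y. y \<in> Y \<Longrightarrow> limitin (uniform_topology Z \<E>) (\<lambda>x. x) (e y) (F y)" by metis
  have eZ: "e y \<in> Z" if "y \<in> Y" for y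
    using e[OF that] by (simp add: limitin_def topspace_uniform_topology[OF UZ])
  have "uniformly_continuous_map Y \<D> Z \<E> e"
    unfolding uniformly_continuous_map_def
  proof (intro conjI ballI)
    show "e \<in> Y \<rightarrow> Z" using eZ by blast
    fix E assume E: "E \<in> \<E>"
    \<comment> \<open>The limit of a filter that is eventually in \<open>G\<close> need not lie in
      \<open>G\<close>, but it lies in a member of \<open>E1\<close> meeting \<open>G\<close>; hence
      the passage to a star refinement.\<close>
    obtain E1 where E1: "E1 \<in> \<E>" "star_refines E1 E" using uniform_structure_star[OF UZ E E] by metis
    obtain D where D: "D \<in> \<D>" "\<forall>P\<in>D. \<exists>G\<in>E1. \<forall>y\<in>P. \<forall>\<^sub>F z in F y. z \<in> G" using key[OF E1(1)] by blast
    have "refines D ((\<lambda>U. e -` U \<inter> Y) ` E)"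
      unfolding refines_def
    proof
      fix P assume P: "P \<in> D"
      then have PY: "P \<subseteq> Y" using uniform_structureD(2)[OF U D(1)] unfolding covering_def by blast
      obtain G where G: "G \<in> E1" "\<forall>y\<in>P. \<forall>\<^sub>F z in F y. z \<in> G" using D(2) P by blast
      obtain H where H: "H \<in> E" "\<Union>{W\<in>E1. W \<inter> G \<noteq> {}} \<subseteq> H" using E1(2) G(1) unfolding star_refines_def by blast
      have "e y \<in> H" if y: "y \<in> P" for y
      proof -
        have yY: "y \<in> Y" using y PY by blast
        have "\<forall>\<^sub>F z in F y. z \<in> star_of E1 (e y)" using limitin_star(2)[OF UZ e[OF yY] E1(1)] .
        moreover have "\<forall>\<^sub>F z in F y. z \<in> G" using G(2) y by blast
        ultimately have "\<forall>\<^sub>F z in F y. z \<in> star_of E1 (e y) \<and> z \<in> G" by (rule eventually_conj)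
        then obtain z where z: "z \<in> star_of E1 (e y)" "z \<in> G" using eventually_happens' nb[OF yY] by blast
        obtain W where "W \<in> E1" "e y \<in> W" "z \<in> W" using z(1) by (rule star_ofE)
        then show ?thesis using H(2) z(2) by blast
      qed
      then have "P \<subseteq> e -` H \<inter> Y" using PY by auto
      then show "\<exists>V\<in>(\<lambda>U. e -` U \<inter> Y) ` E. P \<subseteq> V" using H(1) by (metis imageI)
    qed
    moreover have "covering Y ((\<lambda>U. e -` U \<inter> Y) ` E)"
      using uniform_structureD(2)[OF UZ E] eZ unfolding covering_def by auto
    ultimately show "(\<lambda>U. e -` U \<inter> Y) ` E \<in> \<D>"
      using uniform_structureD(3)[OF U D(1)] by blast
  qed
  moreover have "e (i x) = j x" if x: "x \<in> X" for x
  proof (rule ccontr)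
    assume ne: "e (i x) \<noteq> j x"
    have ix: "i x \<in> Y" "j x \<in> Z" using i j x by blast+
    obtain E where E: "E \<in> \<E>" "\<forall>U\<in>E. \<not> (e (i x) \<in> U \<and> j x \<in> U)"
      using HZ ne eZ[OF ix(1)] ix(2) unfolding Hausdorff_uniform_structure_def by blast
    have "\<forall>\<^sub>F z in F (i x). z \<in> star_of E (e (i x))" using limitin_star(2)[OF UZ e[OF ix(1)] E(1)] .
    then obtain D where D: "D \<in> \<D>" "\<forall>z\<in>tr (i x) D. z \<in> star_of E (e (i x))" unfolding evF by blast
    have "j x \<in> tr (i x) D"
      unfolding tr_def using x covering_star_self[OF uniform_structureD(2)[OF U D(1)] ix(1)] by blast
    then have "j x \<in> star_of E (e (i x))" using D(2) by blast
    then show False using E(2) by (auto simp: star_of_def)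
  qed
  ultimately show ?thesis using that by blast
qed

text \<open>For \<open>s\<close> in the dense set and near \<open>y\<close>, uniform continuity puts
  \<open>f y\<close> near \<open>f s = s\<close>. So \<open>f y\<close> and \<open>y\<close> lie in
  a common member of each uniform covering, and the Hausdorff axiom identifies them.\<close>

lemma uniformly_continuous_id_on_dense:
  assumes H: "Hausdorff_uniform_structure Y \<D>" and d: "uniform_topology Y \<D> closure_of S = Y"
    and f: "uniformly_continuous_map Y \<D> Y \<D> f" and id: "\<And>s. s \<in> S \<Longrightarrow> f s = s" and y: "y \<in> Y"
  shows "f y = y"
proof (rule ccontr)
  assume ne: "f y \<noteq> y"
  have U: "uniform_structure Y \<D>" using H by (simp add: Hausdorff_uniform_structure_def)
  have fy: "f y \<in> Y" using f y unfolding uniformly_continuous_map_def by blast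
  obtain D where D: "D \<in> \<D>" "\<forall>U\<in>D. \<not> (f y \<in> U \<and> y \<in> U)"
    using H ne fy y unfolding Hausdorff_uniform_structure_def by blast
  obtain D1 where D1: "D1 \<in> \<D>" "star_refines D1 D" using uniform_structure_star[OF U D(1) D(1)] by metis
  have D2: "(\<lambda>U. f -` U \<inter> Y) ` D1 \<in> \<D>" using f D1(1) unfolding uniformly_continuous_map_def by blast
  obtain D3 where D3: "D3 \<in> \<D>" "star_refines D3 D1" "star_refines D3 ((\<lambda>U. f -` U \<inter> Y) ` D1)"
    using uniform_structure_star[OF U D1(1) D2] .
  obtain s where s: "s \<in> S" "s \<in> star_of D3 y" using closure_meets_star[OF U d y D3(1)] .
  have "s \<in> star_of D1 y" using refines_star_of_mono[OF star_refines_imp_refines[OF D3(2)] s(2)] .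
  moreover have "s \<in> star_of ((\<lambda>U. f -` U \<inter> Y) ` D1) y"
    using refines_star_of_mono[OF star_refines_imp_refines[OF D3(3)] s(2)] .
  then have "f s \<in> star_of D1 (f y)" unfolding star_of_def by blast
  then have "y \<in> star_of D1 s \<and> s \<in> star_of D1 (f y)" using id[OF s(1)] calculation star_of_sym by metis
  then have "y \<in> star_of D (f y)" using star_refines_trans_star[OF D1(2)] by blast
  then show False using D(2) by (auto simp: star_of_def)
qed

lemma uniformly_continuous_compose:
  assumes "uniformly_continuous_map X \<C> Y \<D> f" "uniformly_continuous_map Y \<D> Z \<E> g"
  shows "uniformly_continuous_map X \<C> Z \<E> (g \<circ> f)"
  unfolding uniformly_continuous_map_def
proof (intro conjI ballI)
  have f: "f \<in> X \<rightarrow> Y" and g: "g \<in> Y \<rightarrow> Z" using assms unfolding uniformly_continuous_map_def by blast+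
  then show "g \<circ> f \<in> X \<rightarrow> Z" by auto
  fix E assume "E \<in> \<E>"
  then have "(\<lambda>U. f -` U \<inter> X) ` (\<lambda>U. g -` U \<inter> Y) ` E \<in> \<C>"
    using assms unfolding uniformly_continuous_map_def by blast
  moreover have "(\<lambda>U. f -` U \<inter> X) ` (\<lambda>U. g -` U \<inter> Y) ` E = (\<lambda>U. (g \<circ> f) -` U \<inter> X) ` E"
    unfolding image_image by (rule image_cong) (use f in auto)
  ultimately show "(\<lambda>U. (g \<circ> f) -` U \<inter> X) ` E \<in> \<C>" by simp
qed

lemma uniformly_continuous_map_cong:
  assumes "uniformly_continuous_map X \<C> Y \<D> f" "\<And>x. x \<in> X \<Longrightarrow> f x = g x"
  shows "uniformly_continuous_map X \<C> Y \<D> g"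
proof -
  have eq: "(\<lambda>U. g -` U \<inter> X) = (\<lambda>U. f -` U \<inter> X)" using assms(2) by auto
  have "g \<in> X \<rightarrow> Y" using assms unfolding uniformly_continuous_map_def by (metis Pi_cong)
  then show ?thesis using assms(1) unfolding uniformly_continuous_map_def eq by blast
qed

text \<open>Each embedding extends along the other one. The two composites fix the dense image of
  \<open>X\<close>, hence are identities.\<close>

lemma completion_unique:
  assumes Y: "is_completion X \<C> Y \<D> i" and Z: "is_completion X \<C> Z \<E> j"
  shows "\<exists>h. uniform_isomorphism Y \<D> Z \<E> h"
proof -
  have HY: "Hausdorff_uniform_structure Y \<D>" and HZ: "Hausdorff_uniform_structure Z \<E>"
    and UY: "uniform_structure Y \<D>" and UZ: "uniform_structure Z \<E>"
    and cY: "complete_uniform Y \<D>" and cZ: "complete_uniform Z \<E>"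
    and i: "i \<in> X \<rightarrow> Y" and j: "j \<in> X \<rightarrow> Z"
    and dY: "uniform_topology Y \<D> closure_of (i ` X) = Y"
    and dZ: "uniform_topology Z \<E> closure_of (j ` X) = Z"
    and ind: "induced_coverings X j \<E> = induced_coverings X i \<D>"
    using Y Z unfolding is_completion_def Hausdorff_uniform_structure_def by simp_all
  obtain e where e: "uniformly_continuous_map Y \<D> Z \<E> e" "\<And>x. x \<in> X \<Longrightarrow> e (i x) = j x"
    using extension_to_complete[OF UY i dY HZ cZ j] ind by blast
  obtain f where f: "uniformly_continuous_map Z \<E> Y \<D> f" "\<And>x. x \<in> X \<Longrightarrow> f (j x) = i x"
    using extension_to_complete[OF UZ j dZ HY cY i] ind by blast
  have fe: "f (e y) = y" if "y \<in> Y" for y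
  proof -
    have "(f \<circ> e) y = y"
      by (rule uniformly_continuous_id_on_dense[OF HY dY uniformly_continuous_compose[OF e(1) f(1)] _ that])
        (use e(2) f(2) in auto)
    then show ?thesis by simp
  qed
  have ef: "e (f z) = z" if "z \<in> Z" for z
  proof -
    have "(e \<circ> f) z = z"
      by (rule uniformly_continuous_id_on_dense[OF HZ dZ uniformly_continuous_compose[OF f(1) e(1)] _ that])
        (use e(2) f(2) in auto)
    then show ?thesis by simp
  qed
  have eY: "e \<in> Y \<rightarrow> Z" and fZ: "f \<in> Z \<rightarrow> Y" using e(1) f(1) unfolding uniformly_continuous_map_def by blast+
  have b: "bij_betw e Y Z"
    by (rule bij_betwI[OF eY fZ]) (auto simp: fe ef)
  have "f z = inv_into Y e z" if "z \<in> Z" for z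
    using b ef[OF that] fZ that by (metis PiE bij_betw_inv_into_left)
  then have "uniformly_continuous_map Z \<E> Y \<D> (inv_into Y e)"
    using uniformly_continuous_map_cong[OF f(1)] by blast
  then show ?thesis using b e(1) unfolding uniform_isomorphism_def by blast
qed

section \<open>From uniform isomorphisms to homeomorphisms\<close>

lemma uniformly_continuous_imp_continuous:
  assumes UX: "uniform_structure X \<C>" and UY: "uniform_structure Y \<D>" and f: "uniformly_continuous_map X \<C> Y \<D> f"
  shows "continuous_map (uniform_topology X \<C>) (uniform_topology Y \<D>) f"
  unfolding continuous_map topspace_uniform_topology[OF UX] topspace_uniform_topology[OF UY]
proof (intro conjI allI impI)
  have fX: "f \<in> X \<rightarrow> Y" using f by (simp add: uniformly_continuous_map_def)
  then show "f ` X \<subseteq> Y" by blast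
  fix S assume S: "openin (uniform_topology Y \<D>) S"
  have "\<exists>C\<in>\<C>. star_of C x \<subseteq> {x\<in>X. f x \<in> S}" if x: "x \<in> X" "f x \<in> S" for x
  proof -
    obtain D where D: "D \<in> \<D>" "star_of D (f x) \<subseteq> S" using S x(2) unfolding openin_uniform_topology[OF UY] by blast
    have "(\<lambda>U. f -` U \<inter> X) ` D \<in> \<C>" using f D(1) unfolding uniformly_continuous_map_def by blast
    moreover have "star_of ((\<lambda>U. f -` U \<inter> X) ` D) x \<subseteq> {x\<in>X. f x \<in> S}"
      using D(2) unfolding star_of_def by blast
    ultimately show ?thesis by blast
  qed
  then show "openin (uniform_topology X \<C>) {x\<in>X. f x \<in> S}" unfolding openin_uniform_topology[OF UX] by blast
qed

lemma uniform_isomorphism_homeomorphic: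
  assumes UX: "uniform_structure X \<C>" and UY: "uniform_structure Y \<D>" and h: "uniform_isomorphism X \<C> Y \<D> h"
  shows "uniform_topology X \<C> homeomorphic_space uniform_topology Y \<D>"
proof -
  have "homeomorphic_maps (uniform_topology X \<C>) (uniform_topology Y \<D>) h (inv_into X h)"
    unfolding homeomorphic_maps_def topspace_uniform_topology[OF UX] topspace_uniform_topology[OF UY]
    using h uniformly_continuous_imp_continuous[OF UX UY] uniformly_continuous_imp_continuous[OF UY UX]
    unfolding uniform_isomorphism_def by (auto simp: bij_betw_inv_into_left bij_betw_inv_into_right)
  then show ?thesis unfolding homeomorphic_space_def by blast
qed

section \<open>Power series over a complete non-archimedean field\<close>

text \<open>All formal power series in countably many variables form a commutative ring as a type, of
  which the Tate algebras are subrings; this makes type-class algebra available for them.\<close>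

typedef 'k mser = "UNIV :: ((nat \<Rightarrow>\<^sub>0 nat) \<Rightarrow> 'k) set"
  morphisms cf Ser by simp

lemma cf_Ser [simp]: "cf (Ser f) = f" by (simp add: Ser_inverse)

lemma mser_eqI: "(\<And>m. cf f m = cf g m) \<Longrightarrow> f = g"
  by (metis cf_inject ext)

instantiation mser :: (comm_ring_1) comm_ring_1
begin

definition "0 = Ser (\<lambda>m. 0)"
definition "1 = Ser (\<lambda>m. 1 when m = 0)"
definition "f + g = Ser (\<lambda>m. cf f m + cf g m)"
definition "f - g = Ser (\<lambda>m. cf f m - cf g m)" for f :: "'a mser"
definition "- f = Ser (\<lambda>m. - cf f m)" for f :: "'a mser"
definition "f * g = Ser (\<lambda>m. \<Sum>(a, b) | a + b = m. cf f a * cf g b)"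

instance
proof
  fix f g h :: "'a mser"
  show "f * g * h = f * (g * h)"
  proof (rule mser_eqI)
    fix m
    let ?S = "\<lambda>m :: nat \<Rightarrow>\<^sub>0 nat. {(a, b). a + b = m}"
    have "cf (f * g * h) m = (\<Sum>p\<in>?S m. \<Sum>q\<in>?S (fst p). cf f (fst q) * cf g (snd q) * cf h (snd p))"
      by (simp add: times_mser_def case_prod_unfold sum_distrib_right)
    also have "\<dots> = (\<Sum>(p, q)\<in>(SIGMA p:?S m. ?S (fst p)). cf f (fst q) * cf g (snd q) * cf h (snd p))"
      by (rule sum.Sigma) (auto simp: finite_exponent_splittings)
    \<comment> \<open>Both double sums run over the decompositions of \<open>m\<close> into three
      exponents; the bijection only moves the bracket.\<close>
    also have "\<dots> = (\<Sum>(p, q)\<in>(SIGMA p:?S m. ?S (snd p)). cf f (fst p) * (cf g (fst q) * cf h (snd q)))"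
      by (rule sum.reindex_bij_witness[where i = "\<lambda>(p, q). ((fst p + fst q, snd q), (fst p, fst q))"
            and j = "\<lambda>(p, q). ((fst q, snd q + snd p), (snd q, snd p))"])
        (auto simp: algebra_simps)
    also have "\<dots> = (\<Sum>p\<in>?S m. \<Sum>q\<in>?S (snd p). cf f (fst p) * (cf g (fst q) * cf h (snd q)))"
      by (rule sum.Sigma[symmetric]) (auto simp: finite_exponent_splittings)
    also have "\<dots> = cf (f * (g * h)) m"
      by (simp add: times_mser_def case_prod_unfold sum_distrib_left)
    finally show "cf (f * g * h) m = cf (f * (g * h)) m" .
  qed
  show "f * g = g * f"
  proof (rule mser_eqI)
    fix m
    show "cf (f * g) m = cf (g * f) m"
      unfolding times_mser_def cf_Ser
      by (rule sum.reindex_bij_witness[where i = prod.swap and j = prod.swap]) (auto simp: algebra_simps)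
  qed
  show "1 * f = f"
  proof (rule mser_eqI)
    fix m
    have "cf (1 * f) m = (\<Sum>(a, b)\<in>{(0, m)}. cf 1 a * cf f b)"
      unfolding times_mser_def cf_Ser
      by (rule sum.mono_neutral_right) (auto simp: finite_exponent_splittings one_mser_def when_def split: if_splits)
    then show "cf (1 * f) m = cf f m" by (simp add: one_mser_def)
  qed
  show "(f + g) * h = f * h + g * h"
    by (rule mser_eqI) (simp add: times_mser_def plus_mser_def case_prod_unfold algebra_simps sum.distrib)
  show "f + g + h = f + (g + h)" by (rule mser_eqI) (simp add: plus_mser_def algebra_simps)
  show "f + g = g + f" by (rule mser_eqI) (simp add: plus_mser_def algebra_simps)
  show "0 + f = f" by (rule mser_eqI) (simp add: plus_mser_def zero_mser_def)
  show "- f + f = 0" by (rule mser_eqI) (simp add: plus_mser_def uminus_mser_def zero_mser_def)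
  show "f - g = f + - g" by (rule mser_eqI) (simp add: plus_mser_def uminus_mser_def minus_mser_def)
  have "cf (0 :: 'a mser) 0 \<noteq> cf 1 0" by (simp add: zero_mser_def one_mser_def)
  then show "(0 :: 'a mser) \<noteq> 1" by metis
qed

end

section \<open>Coefficients, constants, monomials and variables\<close>

lemma cf_simps [simp]:
  "cf 0 m = 0" "cf (f + g) m = cf f m + cf g m" "cf (f - g) m = cf f m - cf g m" "cf (- f) m = - cf f m"
  for f g :: "'k::comm_ring_1 mser"
  by (simp_all add: zero_mser_def plus_mser_def minus_mser_def uminus_mser_def)

lemma cf_1: "cf (1 :: 'k::comm_ring_1 mser) m = (1 when m = 0)"
  by (simp add: one_mser_def)

lemma cf_mult: "cf (f * g) m = (\<Sum>(a, b) | a + b = m. cf f a * cf g b)" for f :: "'k::comm_ring_1 mser"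
  by (simp add: times_mser_def)

lemma cf_sum: "cf (sum f A) m = (\<Sum>a\<in>A. cf (f a) m)" for f :: "'b \<Rightarrow> 'k::comm_ring_1 mser"
  by (induction A rule: infinite_finite_induct) auto

definition const :: "'k \<Rightarrow> 'k::comm_ring_1 mser" where
  "const c = Ser (\<lambda>m. c when m = 0)"

definition mnm :: "(nat \<Rightarrow>\<^sub>0 nat) \<Rightarrow> 'k::comm_ring_1 mser" where
  "mnm a = Ser (\<lambda>m. 1 when m = a)"

lemma cf_const: "cf (const c) m = (c when m = 0)" by (simp add: const_def)

lemma cf_const_mult [simp]: "cf (const c * f) m = c * cf f m"
proof -
  have "cf (const c * f) m = (\<Sum>(a, b)\<in>{(0, m)}. cf (const c) a * cf f b)"
    unfolding cf_mult
    by (rule sum.mono_neutral_right) (auto simp: finite_exponent_splittings const_def when_def split: if_splits)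
  then show ?thesis by (simp add: const_def)
qed

lemma const_simps [simp]:
  "const 0 = 0" "const 1 = 1" "const (a + b) = const a + const b" "const (a - b) = const a - const b"
  "const (- a) = - const a"
  by (rule mser_eqI, simp add: cf_const cf_1 when_def)+

lemma const_mult: "const (a * b) = const a * const b"
  by (rule mser_eqI) (simp add: cf_const when_def)

lemma const_power: "const (a ^ n) = const a ^ n"
  by (induction n) (auto simp: const_mult)

lemma const_sum: "const (sum f A) = (\<Sum>a\<in>A. const (f a))"
  by (induction A rule: infinite_finite_induct) auto

lemma const_inverse: "c \<noteq> 0 \<Longrightarrow> const c * const (inverse c) = 1" "c \<noteq> 0 \<Longrightarrow> const (inverse c) * const c = 1"
  for c :: "'k::field"
  by (simp_all add: const_mult[symmetric] del: const_simps(2)) simp_all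

lemma cf_mnm: "cf (mnm a) m = (1 when m = a)" by (simp add: mnm_def)

lemma mnm_0: "mnm 0 = 1" by (rule mser_eqI) (simp add: cf_mnm cf_1)

lemma mnm_add: "mnm (a + b) = mnm a * mnm b"
proof (rule mser_eqI)
  fix m
  have "cf (mnm a * mnm b) m = (\<Sum>(c, d)\<in>{(c, d). a = c \<and> b = d \<and> a + b = m}. cf (mnm a) c * cf (mnm b) d)"
    unfolding cf_mult by (rule sum.mono_neutral_right) (auto simp: finite_exponent_splittings cf_mnm when_def split: if_splits)
  also have "\<dots> = (1 when a + b = m)"
  proof (cases "a + b = m")
    case True
    then have "{(c, d). a = c \<and> b = d \<and> a + b = m} = {(a, b)}" by auto
    then show ?thesis using True by (simp add: cf_mnm)
  next
    case False
    then have "{(c, d). a = c \<and> b = d \<and> a + b = m} = {}" by auto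
    then show ?thesis using False by simp
  qed
  finally show "cf (mnm (a + b)) m = cf (mnm a * mnm b) m" by (auto simp: cf_mnm when_def)
qed

definition var :: "nat \<Rightarrow> 'k::comm_ring_1 mser" where
  "var i = mnm (Poly_Mapping.single i 1)"

lemma var_power: "var i ^ k = mnm (Poly_Mapping.single i k)"
  by (induction k) (auto simp: mnm_0 var_def mnm_add[symmetric] single_add[symmetric])

text \<open>Exponents outside \<open>{..<n}\<close> are ignored by \<open>mon\<close>.\<close>

definition mon :: "nat \<Rightarrow> (nat \<Rightarrow> 'r::comm_ring_1) \<Rightarrow> (nat \<Rightarrow>\<^sub>0 nat) \<Rightarrow> 'r" where
  "mon n t a = (\<Prod>i<n. t i ^ Poly_Mapping.lookup a i)"

lemma mon_0 [simp]: "mon n t 0 = 1" by (simp add: mon_def)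

lemma mon_add: "mon n t (a + b) = mon n t a * mon n t b"
  by (simp add: mon_def lookup_add power_add prod.distrib)

lemma mon_single: "i < n \<Longrightarrow> mon n t (Poly_Mapping.single i k) = t i ^ k"
proof -
  assume i: "i < n"
  have "mon n t (Poly_Mapping.single i k) = (\<Prod>j<n. if j = i then t i ^ k else 1)"
    unfolding mon_def by (rule prod.cong) (auto simp: lookup_single when_def)
  then show ?thesis using i by simp
qed

definition Exp :: "nat \<Rightarrow> (nat \<Rightarrow>\<^sub>0 nat) set" where
  "Exp n = {a. Poly_Mapping.keys a \<subseteq> {..<n}}"

lemma Exp_0 [simp]: "0 \<in> Exp n" by (simp add: Exp_def)

lemma Exp_add: "a \<in> Exp n \<Longrightarrow> b \<in> Exp n \<Longrightarrow> a + b \<in> Exp n"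
  using Poly_Mapping.keys_add[of a b] by (auto simp: Exp_def)

lemma Exp_addD: "a + b \<in> Exp n \<Longrightarrow> a \<in> Exp n \<and> b \<in> Exp n"
  by (auto simp: Exp_def in_keys_iff lookup_add subset_iff)

lemma Exp_single: "i < n \<Longrightarrow> Poly_Mapping.single i k \<in> Exp n"
  by (auto simp: Exp_def)

lemma Exp_mono: "n \<le> n' \<Longrightarrow> Exp n \<subseteq> Exp n'"
  by (auto simp: Exp_def)

lemma Exp_zero_iff [simp]: "a \<in> Exp 0 \<longleftrightarrow> a = 0"
  by (auto simp: Exp_def)

lemma mnm_eq_mon: "a \<in> Exp n \<Longrightarrow> mnm a = mon n var a"
proof -
  assume a: "a \<in> Exp n"
  have "(\<Sum>i<k. Poly_Mapping.single i (Poly_Mapping.lookup a i)) = a \<Longrightarrow> mnm a = mon k var a" for k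
  proof -
    have "mnm (\<Sum>i<k. Poly_Mapping.single i (Poly_Mapping.lookup a i)) = mon k var a"
      unfolding mon_def by (induction k) (auto simp: mnm_0 mnm_add var_power)
    then show "(\<Sum>i<k. Poly_Mapping.single i (Poly_Mapping.lookup a i)) = a \<Longrightarrow> mnm a = mon k var a" by simp
  qed
  moreover have "(\<Sum>i<n. Poly_Mapping.single i (Poly_Mapping.lookup a i)) = a"
  proof (rule poly_mapping_eqI)
    fix j
    have "Poly_Mapping.lookup (\<Sum>i<n. Poly_Mapping.single i (Poly_Mapping.lookup a i)) j = (\<Sum>i<n. if i = j then Poly_Mapping.lookup a j else 0)"
      unfolding lookup_sum by (rule sum.cong) (auto simp: lookup_single when_def)
    also have "\<dots> = Poly_Mapping.lookup a j"
      using a by (auto simp: Exp_def in_keys_iff subset_iff)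
    finally show "Poly_Mapping.lookup (\<Sum>i<n. Poly_Mapping.single i (Poly_Mapping.lookup a i)) j = Poly_Mapping.lookup a j" .
  qed
  ultimately show ?thesis by blast
qed

lemma cf_poly:
  assumes "finite A"
  shows "cf (\<Sum>a\<in>A. const (c a) * mnm a) m = (c m when m \<in> A)"
proof -
  have "cf (\<Sum>a\<in>A. const (c a) * mnm a) m = (\<Sum>a\<in>A. if a = m then c m else 0)"
    unfolding cf_sum by (rule sum.cong) (auto simp: cf_mnm when_def)
  then show ?thesis using assms by (simp add: when_def)
qed

section \<open>Elementary estimates and limits for the absolute value\<close>

context complete_nonarch_field
begin

lemma v_0 [simp]: "v 0 = 0" using eq_0_iff by simp

lemma v_pos: "x \<noteq> 0 \<Longrightarrow> 0 < v x" using eq_0_iff nonneg by (metis less_eq_real_def)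

lemma v_1 [simp]: "v 1 = 1"
proof -
  have "v 1 * v 1 = v 1 * 1" using mult[of 1 1] by simp
  moreover have "v 1 \<noteq> 0" by (simp add: eq_0_iff)
  ultimately show ?thesis using mult_left_cancel by blast
qed

lemma v_minus [simp]: "v (- x) = v x"
proof -
  have "v (-1) ^ 2 = 1" by (simp add: power2_eq_square mult[symmetric])
  then have "v (-1) = 1" using nonneg[of "-1"] by (simp add: power2_eq_1_iff)
  then show ?thesis using mult[of "-1" x] by simp
qed

lemma v_diff: "v (x - y) \<le> max (v x) (v y)" using ultrametric[of x "- y"] by simp

lemma v_power: "v (x ^ n) = v x ^ n" by (induction n) (auto simp: mult)

lemma v_inverse: "v (inverse x) = inverse (v x)"
proof (cases "x = 0")
  case False
  then have "v (inverse x) * v x = 1" by (simp add: mult[symmetric])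
  then show ?thesis by (metis inverse_unique mult.commute)
qed auto

lemma v_divide: "v (x / y) = v x / v y" by (simp add: divide_inverse mult v_inverse)

lemma v_sum_le: "0 \<le> r \<Longrightarrow> (\<And>a. a \<in> A \<Longrightarrow> v (f a) \<le> r) \<Longrightarrow> v (sum f A) \<le> r"
proof (induction A rule: infinite_finite_induct)
  case (insert x F)
  then show ?case using ultrametric[of "f x" "sum f F"] by force
qed auto

lemma v_sum_less: "0 < r \<Longrightarrow> (\<And>a. a \<in> A \<Longrightarrow> v (f a) < r) \<Longrightarrow> v (sum f A) < r"
proof (induction A rule: infinite_finite_induct)
  case (insert x F)
  then show ?case using ultrametric[of "f x" "sum f F"] by force
qed auto

lemma small_const: "\<exists>c. c \<noteq> 0 \<and> v c < 1"
proof -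
  obtain x where x: "x \<noteq> 0" "v x \<noteq> 1" using nontrivial by blast
  show ?thesis
  proof (cases "v x < 1")
    case False
    then have "v (inverse x) < 1" using x by (simp add: v_inverse inverse_less_1_iff)
    then show ?thesis using x by (metis inverse_nonzero_iff_nonzero)
  qed (use x in blast)
qed

lemma tiny_const: "0 < e \<Longrightarrow> \<exists>c. c \<noteq> 0 \<and> v c < e"
proof -
  assume e: "0 < e"
  obtain c where c: "c \<noteq> 0" "v c < 1" using small_const by blast
  obtain n where "v c ^ n < e" using real_arch_pow_inv[OF e c(2)] by blast
  then have "c ^ n \<noteq> 0 \<and> v (c ^ n) < e" using c by (simp add: v_power)
  then show ?thesis by blast
qed

lemma huge_const: "\<exists>c. c \<noteq> 0 \<and> v c > e"
proof -
  have "0 < 1 / max e 1" by simp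
  then obtain c where c: "c \<noteq> 0" "v c < 1 / max e 1" using tiny_const by blast
  have "inverse (1 / max e 1) < inverse (v c)"
    using c(2) v_pos[OF c(1)] by (rule less_imp_inverse_less)
  then have "e < v (inverse c)" by (simp add: v_inverse)
  then show ?thesis using c by (metis inverse_nonzero_iff_nonzero)
qed

lemma v_Cauchy_limit:
  fixes s :: "nat \<Rightarrow> 'k"
  assumes "\<And>e. 0 < e \<Longrightarrow> \<exists>N. \<forall>m\<ge>N. \<forall>n\<ge>N. v (s m - s n) < e"
  obtains l where "\<And>e. 0 < e \<Longrightarrow> \<exists>N. \<forall>n\<ge>N. v (s n - l) < e"
proof -
  interpret M: Metric_space UNIV "\<lambda>x y. v (x - y)"
  proof
    show "v (x - y) = v (y - x)" for x y using v_minus[of "x - y"] by simp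
    show "v (x - z) \<le> v (x - y) + v (y - z)" for x y z
      using ultrametric[of "x - y" "y - z"] nonneg[of "x - y"] nonneg[of "y - z"] by simp
  qed (auto simp: nonneg eq_0_iff)
  have "M.MCauchy s" using assms by (auto simp: M.MCauchy_def)
  then obtain l where "limitin M.mtopology s l sequentially" using complete by (auto simp: M.mcomplete_def)
  then show ?thesis using that by (auto simp: M.limit_metric_sequentially)
qed

text \<open>By the ultrametric inequality the bound on one increment bounds all later differences
  without any extra factor, so the limit is approximated with the same rate.\<close>

lemma v_geometric_limit:
  assumes r: "0 \<le> r" "r < 1" and s: "\<And>n. v (s (Suc n) - s n) \<le> r ^ n"
  obtains l where "\<And>n. v (s n - l) \<le> r ^ n"
proof -
  have d: "v (s (n + k) - s n) \<le> r ^ n" for n k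
  proof (induction k)
    case (Suc k)
    have "v (s (n + Suc k) - s n) \<le> max (v (s (Suc (n + k)) - s (n + k))) (v (s (n + k) - s n))"
      using ultrametric[of "s (Suc (n + k)) - s (n + k)" "s (n + k) - s n"] by simp
    moreover have "v (s (Suc (n + k)) - s (n + k)) \<le> r ^ n"
      using s[of "n + k"] power_decreasing[of n "n + k" r] r by simp
    ultimately show ?case using Suc by simp
  qed (use r in simp)
  have c: "\<exists>N. \<forall>m\<ge>N. \<forall>n\<ge>N. v (s m - s n) < e" if e: "0 < e" for e
  proof -
    obtain N where N: "r ^ N < e" using real_arch_pow_inv[OF e r(2)] by blast
    have "v (s m - s n) < e" if "m \<ge> N" "n \<ge> N" for m n
    proof -
      have "v (s m - s N) \<le> r ^ N" "v (s n - s N) \<le> r ^ N"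
        using d[of N "m - N"] d[of N "n - N"] that by simp_all
      then have "v (s m - s n) \<le> r ^ N" using v_diff[of "s m - s N" "s n - s N"] by simp
      then show ?thesis using N by simp
    qed
    then show ?thesis by blast
  qed
  obtain l where l: "\<And>e. 0 < e \<Longrightarrow> \<exists>N. \<forall>n\<ge>N. v (s n - l) < e" using v_Cauchy_limit[OF c] by blast
  have "v (s n - l) \<le> r ^ n" for n
  proof (rule field_le_epsilon)
    fix e :: real assume "0 < e"
    then obtain N where "\<forall>n\<ge>N. v (s n - l) < e" using l by blast
    then have "v (s (n + N) - l) < e" by simp
    moreover have "v (s n - l) \<le> max (v (s (n + N) - l)) (v (s (n + N) - s n))"
      using v_diff[of "s (n + N) - l" "s (n + N) - s n"] by simp
    ultimately show "v (s n - l) \<le> r ^ n + e" using d[of n N] nonneg[of "s (n + N) - l"] r(1) by (smt (verit) zero_le_power)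
  qed
  then show ?thesis using that by blast
qed

subsection \<open>Tate algebras as subrings\<close>

text \<open>On a Tate algebra this says that the Gauss norm is at most \<open>r\<close>. The
  predicate avoids the supremum and makes sense for every formal power series.\<close>

definition bd :: "real \<Rightarrow> 'k mser \<Rightarrow> bool" where
  "bd r f \<longleftrightarrow> (\<forall>m. v (cf f m) \<le> r)"

definition T :: "nat \<Rightarrow> 'k mser set" where
  "T n = {f. (\<forall>m. cf f m \<noteq> 0 \<longrightarrow> m \<in> Exp n) \<and> (\<forall>e>0. finite {m. e \<le> v (cf f m)})}"

lemma T_restricted: "f \<in> T n \<longleftrightarrow> cf f \<in> restricted_series v n"
proof -
  have "((\<lambda>m. v (cf f m)) \<longlongrightarrow> 0) cofinite \<longleftrightarrow> (\<forall>e>0. finite {m. e \<le> v (cf f m)})"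
    unfolding tendsto_iff eventually_cofinite using nonneg by (simp add: not_less)
  then show ?thesis by (auto simp: T_def restricted_series_def Exp_def)
qed

lemma bd_mono: "bd r f \<Longrightarrow> r \<le> s \<Longrightarrow> bd s f" unfolding bd_def by (meson order_trans)
lemma bd_nonneg: "bd r f \<Longrightarrow> 0 \<le> r" unfolding bd_def using nonneg by (meson order_trans)
lemma bd_add: "bd r f \<Longrightarrow> bd r g \<Longrightarrow> bd r (f + g)" unfolding bd_def using ultrametric by (smt (verit) cf_simps(2))
lemma bd_diff: "bd r f \<Longrightarrow> bd r g \<Longrightarrow> bd r (f - g)" unfolding bd_def using v_diff by (smt (verit) cf_simps(3))
lemma bd_uminus: "bd r f \<Longrightarrow> bd r (- f)" unfolding bd_def by simp
lemma bd_0: "0 \<le> r \<Longrightarrow> bd r 0" unfolding bd_def by simp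
lemma bd_const: "bd (v c) (const c)" unfolding bd_def by (simp add: cf_const when_def nonneg)
lemma bd_mnm: "bd 1 (mnm a)" unfolding bd_def by (simp add: cf_mnm when_def)
lemma bd_1: "bd 1 1" using bd_mnm[of 0] by (simp add: mnm_0)
lemma bd_var: "bd 1 (var i)" by (simp add: var_def bd_mnm)
lemma bd_const_mult: "bd r f \<Longrightarrow> bd (v c * r) (const c * f)"
  unfolding bd_def by (simp add: mult mult_left_mono nonneg)

lemma bd_mult: assumes "bd r f" "bd s g" shows "bd (r * s) (f * g)"
  unfolding bd_def cf_mult
proof
  fix m
  show "v (\<Sum>(a, b) | a + b = m. cf f a * cf g b) \<le> r * s"
    using assms bd_nonneg[OF assms(1)] bd_nonneg[OF assms(2)]
    by (intro v_sum_le) (auto simp: mult bd_def nonneg intro!: mult_mono)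
qed

lemma bd_power: "bd r f \<Longrightarrow> bd (r ^ n) (f ^ n)"
  by (induction n) (auto simp: bd_1 bd_mult)

lemma bd_eq_0: assumes "\<And>e. 0 < e \<Longrightarrow> bd e f" shows "f = 0"
proof (rule mser_eqI)
  fix m
  have "v (cf f m) \<le> e" if "0 < e" for e using assms[OF that] by (simp add: bd_def)
  then have "v (cf f m) \<le> 0" using field_le_epsilon[of "v (cf f m)" 0] by simp
  then show "cf f m = cf 0 m" using nonneg[of "cf f m"] eq_0_iff by simp
qed

lemma T_bd: assumes "f \<in> T n" obtains r where "0 < r" "bd r f"
proof -
  let ?A = "{m. 1 \<le> v (cf f m)}"
  have fin: "finite ?A" using assms by (simp add: T_def)
  define r where "r = Max (insert 1 ((\<lambda>m. v (cf f m)) ` ?A))"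
  have "v (cf f m) \<le> r" for m
  proof (cases "m \<in> ?A")
    case True then show ?thesis unfolding r_def using fin by (intro Max_ge) auto
  next
    case False
    have "1 \<le> r" unfolding r_def using fin by (intro Max_ge) auto
    then show ?thesis using False by auto
  qed
  moreover have "1 \<le> r" unfolding r_def using fin by (intro Max_ge) auto
  ultimately show ?thesis using that[of r] by (auto simp: bd_def)
qed

lemma T_0 [simp]: "0 \<in> T n" by (auto simp: T_def)

lemma T_add: assumes f: "f \<in> T n" and g: "g \<in> T n" shows "f + g \<in> T n"
proof -
  have "finite {m. e \<le> v (cf (f + g) m)}" if e: "0 < e" for e
  proof (rule finite_subset)
    show "{m. e \<le> v (cf (f + g) m)} \<subseteq> {m. e \<le> v (cf f m)} \<union> {m. e \<le> v (cf g m)}"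
      using ultrametric by (fastforce simp: le_max_iff_disj intro: order_trans)
    show "finite ({m. e \<le> v (cf f m)} \<union> {m. e \<le> v (cf g m)})" using f g e by (auto simp: T_def)
  qed
  moreover have "m \<in> Exp n" if "cf (f + g) m \<noteq> 0" for m
    using f g that by (cases "cf f m = 0") (auto simp: T_def)
  ultimately show ?thesis by (simp add: T_def)
qed

lemma T_uminus: "f \<in> T n \<Longrightarrow> - f \<in> T n" by (simp add: T_def)

lemma T_diff: "f \<in> T n \<Longrightarrow> g \<in> T n \<Longrightarrow> f - g \<in> T n"
  using T_add[OF _ T_uminus, of f n g] by simp

lemma T_mult: assumes f: "f \<in> T n" and g: "g \<in> T n" shows "f * g \<in> T n"
proof -
  obtain r s where rs: "0 < r" "bd r f" "0 < s" "bd s g" using T_bd[OF f] T_bd[OF g] by metis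
  have "finite {m. e \<le> v (cf (f * g) m)}" if e: "0 < e" for e
  proof (rule finite_subset)
    \<comment> \<open>By the ultrametric inequality a coefficient of size at least \<open>e\<close>
      has a summand of that size; bounding one factor of this summand by its Gauss norm forces the
      other to be large.\<close>
    show "{m. e \<le> v (cf (f * g) m)} \<subseteq> (\<lambda>(a, b). a + b) ` ({m. e / s \<le> v (cf f m)} \<times> {m. e / r \<le> v (cf g m)})"
    proof
      fix m assume "m \<in> {m. e \<le> v (cf (f * g) m)}"
      then have "\<not> v (\<Sum>(a, b) | a + b = m. cf f a * cf g b) < e" by (simp add: cf_mult)
      then obtain a b where ab: "a + b = m" "e \<le> v (cf f a * cf g b)"
        using v_sum_less[OF e, of "{(a, b). a + b = m}" "\<lambda>(a, b). cf f a * cf g b"] by (force simp: not_less)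
      then have "e \<le> v (cf f a) * v (cf g b)" by (simp add: mult)
      moreover have "v (cf f a) * v (cf g b) \<le> v (cf f a) * s" "v (cf f a) * v (cf g b) \<le> r * v (cf g b)"
        using rs nonneg by (auto simp: bd_def intro!: mult_mono)
      ultimately have "e / s \<le> v (cf f a)" "e / r \<le> v (cf g b)"
        using rs by (simp_all add: field_simps)
      then show "m \<in> (\<lambda>(a, b). a + b) ` ({m. e / s \<le> v (cf f m)} \<times> {m. e / r \<le> v (cf g m)})"
        using ab(1) by force
    qed
    show "finite ((\<lambda>(a, b). a + b) ` ({m. e / s \<le> v (cf f m)} \<times> {m. e / r \<le> v (cf g m)}))"
      using f g e rs by (auto simp: T_def)
  qed
  moreover have "m \<in> Exp n" if "cf (f * g) m \<noteq> 0" for m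
  proof -
    obtain p where "p \<in> {(a, b). a + b = m}" "(case p of (a, b) \<Rightarrow> cf f a * cf g b) \<noteq> 0"
      using \<open>cf (f * g) m \<noteq> 0\<close> unfolding cf_mult by (rule sum.not_neutral_contains_not_neutral)
    then obtain a b where ab: "a + b = m" "cf f a * cf g b \<noteq> 0" by auto
    then show ?thesis using f g Exp_add[of a n b] by (auto simp: T_def)
  qed
  ultimately show ?thesis by (simp add: T_def)
qed

lemma T_mnm: "a \<in> Exp n \<Longrightarrow> mnm a \<in> T n"
proof -
  assume a: "a \<in> Exp n"
  have "finite {m. e \<le> v (cf (mnm a) m)}" if "0 < e" for e
    by (rule finite_subset[of _ "{a}"]) (use that in \<open>auto simp: cf_mnm when_def split: if_splits\<close>)
  then show ?thesis using a by (auto simp: T_def cf_mnm when_def split: if_splits)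
qed

lemma T_1: "1 \<in> T n" using T_mnm[of 0 n] by (simp add: mnm_0)

lemma T_const: "const c \<in> T n"
proof -
  have "finite {m. e \<le> v (cf (const c) m)}" if "0 < e" for e
    by (rule finite_subset[of _ "{0}"]) (use that in \<open>auto simp: cf_const when_def split: if_splits\<close>)
  then show ?thesis by (auto simp: T_def cf_const when_def split: if_splits)
qed

lemma T_sum: "(\<And>a. a \<in> A \<Longrightarrow> f a \<in> T n) \<Longrightarrow> sum f A \<in> T n"
  by (induction A rule: infinite_finite_induct) (auto simp: T_add)

lemma T_prod: "(\<And>a. a \<in> A \<Longrightarrow> f a \<in> T n) \<Longrightarrow> prod f A \<in> T n"
  by (induction A rule: infinite_finite_induct) (auto simp: T_mult T_1)

lemma T_power: "f \<in> T n \<Longrightarrow> f ^ k \<in> T n"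
  by (induction k) (auto simp: T_mult T_1)

lemma T_var: "i < n \<Longrightarrow> var i \<in> T n"
  by (simp add: var_def T_mnm Exp_single)

lemma T_mono: "n \<le> n' \<Longrightarrow> T n \<subseteq> T n'"
  using Exp_mono[of n n'] unfolding T_def by auto

lemma T_closed:
  assumes "\<And>e. 0 < e \<Longrightarrow> \<exists>g\<in>T n. bd e (f - g)"
  shows "f \<in> T n"
proof -
  have "finite {m. e \<le> v (cf f m)}" if e: "0 < e" for e
  proof -
    obtain g where g: "g \<in> T n" "bd (e / 2) (f - g)" using assms[of "e / 2"] e by auto
    have "{m. e \<le> v (cf f m)} \<subseteq> {m. e \<le> v (cf g m)}"
    proof safe
      fix m assume m: "e \<le> v (cf f m)"
      have "v (cf f m - cf g m) \<le> e / 2" using g(2) unfolding bd_def by (metis cf_simps(3))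
      then show "e \<le> v (cf g m)" using m e ultrametric[of "cf f m - cf g m" "cf g m"] by simp
    qed
    then show ?thesis using g(1) e by (auto simp: T_def intro: finite_subset)
  qed
  moreover have "m \<in> Exp n" if m: "cf f m \<noteq> 0" for m
  proof -
    have p: "0 < v (cf f m)" using m by (rule v_pos)
    obtain g where g: "g \<in> T n" "bd (v (cf f m) / 2) (f - g)" using assms[of "v (cf f m) / 2"] p by auto
    have "v (cf f m - cf g m) \<le> v (cf f m) / 2" using g(2) unfolding bd_def by (metis cf_simps(3))
    then have "cf g m \<noteq> 0" using p by auto
    then show ?thesis using g(1) by (simp add: T_def)
  qed
  ultimately show ?thesis by (simp add: T_def)
qed

text \<open>The inverse is the geometric series. Its partial sums converge at the rate
  \<open>r ^ k\<close> uniformly in the monomial, so the coefficientwise limit is a limit in the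
  Gauss norm and stays in \<open>T n\<close>.\<close>

lemma T_unit:
  assumes f: "f \<in> T n" and r: "bd r f" "r < 1"
  obtains h where "h \<in> T n" "(1 - f) * h = 1"
proof -
  have r0: "0 \<le> r" using bd_nonneg[OF r(1)] .
  define s where "s k = (\<Sum>j<k. f ^ j)" for k
  have "\<exists>l. \<forall>k. v (cf (s k) m - l) \<le> r ^ k" for m
  proof -
    have "v (cf (s (Suc k)) m - cf (s k) m) \<le> r ^ k" for k
      using bd_power[OF r(1), of k] by (simp add: s_def bd_def)
    then show ?thesis using v_geometric_limit[OF r0 r(2), of "\<lambda>k. cf (s k) m"] by metis
  qed
  then obtain l where l: "\<And>m k. v (cf (s k) m - l m) \<le> r ^ k" by metis
  define h where "h = Ser l"
  have hs: "bd (r ^ k) (s k - h)" for k using l by (simp add: bd_def h_def)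
  have sT: "s k \<in> T n" for k unfolding s_def by (intro T_sum T_power f)
  have "h \<in> T n"
  proof (rule T_closed)
    fix e :: real assume "0 < e"
    then obtain k where "r ^ k < e" using real_arch_pow_inv[OF _ r(2)] by blast
    then have "bd e (h - s k)" using bd_mono[OF bd_uminus[OF hs[of k]], of e] by simp
    then show "\<exists>g\<in>T n. bd e (h - g)" using sT by blast
  qed
  moreover have "(1 - f) * h - 1 = 0"
  proof (rule bd_eq_0)
    fix e :: real assume "0 < e"
    then obtain k where k: "r ^ k < e" using real_arch_pow_inv[OF _ r(2)] by blast
    have sk: "(1 - f) * s k = 1 - f ^ k" unfolding s_def by (rule one_diff_power_eq[symmetric])
    have "bd (1 * r ^ k) ((1 - f) * (s k - h))"
      by (intro bd_mult bd_diff bd_1 hs bd_mono[OF r(1)]) (use r in simp)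
    moreover have "(1 - f) * h - 1 = - ((1 - f) * (s k - h)) - f ^ k"
      using sk by (simp add: algebra_simps)
    ultimately have "bd (r ^ k) ((1 - f) * h - 1)" using bd_power[OF r(1), of k] bd_diff bd_uminus by simp
    then show "bd e ((1 - f) * h - 1)" using k bd_mono by (meson less_imp_le)
  qed
  ultimately show ?thesis using that[of h] by simp
qed

lemma T_truncate:
  assumes f: "f \<in> T n" and e: "0 < e"
  obtains A where "finite A" "A \<subseteq> Exp n" "bd e (f - (\<Sum>a\<in>A. const (cf f a) * mnm a))"
proof
  let ?A = "{m. e \<le> v (cf f m)}"
  show fin: "finite ?A" using f e by (simp add: T_def)
  show "?A \<subseteq> Exp n"
  proof
    fix m assume "m \<in> ?A"
    then have "cf f m \<noteq> 0" using e by auto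
    then show "m \<in> Exp n" using f by (simp add: T_def)
  qed
  show "bd e (f - (\<Sum>a\<in>?A. const (cf f a) * mnm a))"
    unfolding bd_def cf_simps cf_poly[OF fin] using e by (auto simp: when_def)
qed

lemma gauss_norm_le: "gauss_norm v (cf f) \<le> r \<longleftrightarrow> bd r f" if "f \<in> T n"
proof -
  obtain s where "bd s f" using T_bd[OF \<open>f \<in> T n\<close>] by blast
  then have "bdd_above (range (\<lambda>m. v (cf f m)))" unfolding bd_def by (auto intro!: bdd_aboveI)
  then show ?thesis unfolding gauss_norm_def bd_def by (subst cSUP_le_iff) auto
qed

lemma bd_gauss_norm: "f \<in> T n \<Longrightarrow> bd (gauss_norm v (cf f)) f"
  using gauss_norm_le by blast

end

section \<open>Subrings, maximal ideals and multiplicative seminorms\<close>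

definition subrng :: "'r::comm_ring_1 set \<Rightarrow> bool" where
  "subrng S \<longleftrightarrow> 1 \<in> S \<and> (\<forall>f\<in>S. \<forall>g\<in>S. f + g \<in> S \<and> f - g \<in> S \<and> f * g \<in> S)"

definition submod :: "'r::comm_ring_1 set \<Rightarrow> 'r set \<Rightarrow> bool" where
  "submod S E \<longleftrightarrow> 0 \<in> E \<and> (\<forall>f\<in>E. \<forall>g\<in>E. f + g \<in> E) \<and> (\<forall>s\<in>S. \<forall>f\<in>E. s * f \<in> E)"

text \<open>Maximality is encoded as invertibility modulo \<open>x\<close> of all elements outside
  \<open>x\<close>, the form in which it is used.\<close>

definition maxid :: "'r::comm_ring_1 set \<Rightarrow> 'r set \<Rightarrow> bool" where
  "maxid S x \<longleftrightarrow> x \<subseteq> S \<and> submod S x \<and> 1 \<notin> x \<and> (\<forall>f\<in>S. f \<notin> x \<longrightarrow> (\<exists>z\<in>S. f * z - 1 \<in> x))"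

lemma subrngD:
  assumes "subrng S"
  shows "1 \<in> S" "0 \<in> S" "f \<in> S \<Longrightarrow> g \<in> S \<Longrightarrow> f + g \<in> S" "f \<in> S \<Longrightarrow> g \<in> S \<Longrightarrow> f - g \<in> S"
    "f \<in> S \<Longrightarrow> g \<in> S \<Longrightarrow> f * g \<in> S" "f \<in> S \<Longrightarrow> - f \<in> S"
proof -
  show 0: "0 \<in> S" using assms unfolding subrng_def by (metis diff_self)
  show "f \<in> S \<Longrightarrow> - f \<in> S" using assms 0 unfolding subrng_def by (metis diff_0)
qed (use assms in \<open>auto simp: subrng_def\<close>)

lemma subrng_power: "subrng S \<Longrightarrow> f \<in> S \<Longrightarrow> f ^ n \<in> S"
  by (induction n) (auto simp: subrngD)

lemma submodD:
  assumes "submod S E"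
  shows "0 \<in> E" "f \<in> E \<Longrightarrow> g \<in> E \<Longrightarrow> f + g \<in> E" "s \<in> S \<Longrightarrow> f \<in> E \<Longrightarrow> s * f \<in> E"
    "s \<in> S \<Longrightarrow> f \<in> E \<Longrightarrow> f * s \<in> E"
  using assms by (auto simp: submod_def mult.commute)

lemma submod_uminus: "subrng S \<Longrightarrow> submod S E \<Longrightarrow> f \<in> E \<Longrightarrow> - f \<in> E"
  using submodD(3)[of S E "-1" f] subrngD(1)[of S] subrngD(6)[of S 1] by simp

lemma submod_diff: "subrng S \<Longrightarrow> submod S E \<Longrightarrow> f \<in> E \<Longrightarrow> g \<in> E \<Longrightarrow> f - g \<in> E"
  using submodD(2)[of S E f "- g"] submod_uminus[of S E g] by simp

lemma submod_sum: "submod S E \<Longrightarrow> (\<And>a. a \<in> A \<Longrightarrow> f a \<in> E) \<Longrightarrow> sum f A \<in> E"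
  by (induction A rule: infinite_finite_induct) (auto simp: submodD)

lemma maxidD:
  assumes "maxid S x"
  shows "x \<subseteq> S" "submod S x" "1 \<notin> x" "f \<in> S \<Longrightarrow> f \<notin> x \<Longrightarrow> \<exists>z\<in>S. f * z - 1 \<in> x"
  using assms by (auto simp: maxid_def)

text \<open>A determinant-free Cayley--Hamilton argument: eliminating one unknown after the other keeps the
  diagonal entries congruent to a power of \<open>c\<close> and the other entries in \<open>I\<close>.\<close>

lemma elimination:
  fixes q :: "'r::comm_ring_1 \<Rightarrow> 'r \<Rightarrow> 'r" and u :: "'r \<Rightarrow> 'r"
  assumes S: "subrng S" and I: "submod S I" and E: "submod S E"
  shows "finite J \<Longrightarrow> j \<notin> J \<Longrightarrow> c \<in> S \<Longrightarrow>
    (\<And>i k. i \<in> insert j J \<Longrightarrow> k \<in> insert j J \<Longrightarrow> q i k \<in> S) \<Longrightarrow>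
    (\<And>i. i \<in> insert j J \<Longrightarrow> q i i - c \<in> I) \<Longrightarrow>
    (\<And>i k. i \<in> insert j J \<Longrightarrow> k \<in> insert j J \<Longrightarrow> i \<noteq> k \<Longrightarrow> q i k \<in> I) \<Longrightarrow>
    (\<And>i. i \<in> insert j J \<Longrightarrow> (\<Sum>k\<in>insert j J. q i k * u k) \<in> E) \<Longrightarrow>
    \<exists>p\<in>S. p - c ^ (2 ^ card J) \<in> I \<and> p * u j \<in> E"
proof (induction J arbitrary: q c rule: finite_induct)
  case empty
  then show ?case by auto
next
  case (insert l J)
  define L where "L = insert j J"
  have lL: "l \<notin> L" "finite L" and eq: "insert j (insert l J) = insert l L"
    using insert by (auto simp: L_def)
  note qS = insert.prems(3)[unfolded eq] and qd = insert.prems(4)[unfolded eq]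
    and qI = insert.prems(5)[unfolded eq] and qE = insert.prems(6)[unfolded eq]
  \<comment> \<open>Row \<open>i\<close> times the pivot minus a multiple of row \<open>l\<close>
    removes the unknown \<open>u l\<close> without division. The diagonal becomes congruent to
    \<open>c * c\<close>, so the exponent of \<open>c\<close> doubles with every unknown.\<close>
  define Q where "Q i k = q l l * q i k - q i l * q l k" for i k
  have "\<exists>p\<in>S. p - (c * c) ^ (2 ^ card J) \<in> I \<and> p * u j \<in> E"
  proof (rule insert.IH[of "c * c" Q, folded L_def])
    show "j \<notin> J" using insert by auto
    show "c * c \<in> S" using insert.prems(2) subrngD[OF S] by auto
    fix i assume i: "i \<in> L"
    then have il: "i \<noteq> l" using lL by auto
    show "Q i k \<in> S" if "k \<in> L" for k
      unfolding Q_def using qS i that by (auto intro!: subrngD[OF S])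
    have "q l l * (q i i - c) \<in> I" "c * (q l l - c) \<in> I" "q i l * q l i \<in> I"
      using qS qd qI i il insert.prems(2) by (auto intro!: submodD(3)[OF I])
    then have "q l l * (q i i - c) + c * (q l l - c) - q i l * q l i \<in> I"
      by (intro submod_diff[OF S I] submodD(2)[OF I])
    moreover have "Q i i - c * c = q l l * (q i i - c) + c * (q l l - c) - q i l * q l i"
      by (simp add: Q_def algebra_simps)
    ultimately show "Q i i - c * c \<in> I" by simp
    show "Q i k \<in> I" if "k \<in> L" "i \<noteq> k" for k
      unfolding Q_def using qS qI i il that lL by (intro submod_diff[OF S I] submodD(3)[OF I]) auto
    have "(\<Sum>k\<in>L. Q i k * u k) = q l l * (\<Sum>k\<in>L. q i k * u k) - q i l * (\<Sum>k\<in>L. q l k * u k)"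
      by (simp add: Q_def algebra_simps sum_subtractf sum_distrib_left)
    also have "\<dots> = q l l * (\<Sum>k\<in>insert l L. q i k * u k) - q i l * (\<Sum>k\<in>insert l L. q l k * u k)"
      using lL by (simp add: algebra_simps)
    also have "\<dots> \<in> E"
      using qS qE i by (intro submod_diff[OF S E] submodD(3)[OF E]) auto
    finally show "(\<Sum>k\<in>L. Q i k * u k) \<in> E" .
  qed
  moreover have "(c * c) ^ (2 ^ card J) = c ^ (2 ^ card (insert l J))"
    using insert.hyps by (simp add: power_mult power2_eq_square)
  ultimately show ?case by simp
qed

lemma exists_maxid:
  assumes S: "subrng S" and I: "I \<subseteq> S" "submod S I" "1 \<notin> I"
  obtains x where "maxid S x" "I \<subseteq> x"
proof -
  let ?A = "{x. x \<subseteq> S \<and> submod S x \<and> 1 \<notin> x \<and> I \<subseteq> x}"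
  have "\<exists>x\<in>?A. \<forall>y\<in>?A. x \<subseteq> y \<longrightarrow> y = x"
  proof (rule subset_Zorn_nonempty)
    show "?A \<noteq> {}" using I by blast
    fix C assume C: "C \<noteq> {}" "subset.chain ?A C"
    then have CA: "C \<subseteq> ?A" and ch: "\<And>a b. a \<in> C \<Longrightarrow> b \<in> C \<Longrightarrow> a \<subseteq> b \<or> b \<subseteq> a"
      by (auto simp: subset.chain_def subset_chain_def)
    have "submod S (\<Union>C)"
      unfolding submod_def
    proof (intro conjI ballI)
      obtain c where "c \<in> C" using C(1) by blast
      then show "0 \<in> \<Union>C" using CA submodD(1) by blast
      fix f g assume "f \<in> \<Union>C" "g \<in> \<Union>C"
      then obtain a b where ab: "a \<in> C" "f \<in> a" "b \<in> C" "g \<in> b" by blast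
      then obtain d where d: "d \<in> C" "f \<in> d" "g \<in> d" using ch[of a b] by blast
      then have "f + g \<in> d" using CA submodD(2) by blast
      then show "f + g \<in> \<Union>C" using d by blast
    next
      fix s f assume "s \<in> S" "f \<in> \<Union>C"
      then obtain a where "a \<in> C" "f \<in> a" by blast
      then have "s * f \<in> a" using CA submodD(3) \<open>s \<in> S\<close> by blast
      then show "s * f \<in> \<Union>C" using \<open>a \<in> C\<close> by blast
    qed
    then show "\<Union>C \<in> ?A" using CA C(1) by blast
  qed
  then obtain x where x: "x \<subseteq> S" "submod S x" "1 \<notin> x" "I \<subseteq> x"
    and mx: "\<And>y. y \<subseteq> S \<Longrightarrow> submod S y \<Longrightarrow> 1 \<notin> y \<Longrightarrow> x \<subseteq> y \<Longrightarrow> y = x" by (smt (verit) mem_Collect_eq subset_trans)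
  have "\<exists>z\<in>S. f * z - 1 \<in> x" if f: "f \<in> S" "f \<notin> x" for f
  proof -
    define y where "y = {a + f * z |a z. a \<in> x \<and> z \<in> S}"
    have "submod S y"
      unfolding submod_def
    proof (intro conjI ballI)
      have "0 = 0 + f * 0" by simp
      then show "0 \<in> y" unfolding y_def using submodD(1)[OF x(2)] subrngD(2)[OF S] by blast
      fix g h assume "g \<in> y" "h \<in> y"
      then obtain a z a' z' where "g = a + f * z" "h = a' + f * z'" and m: "a \<in> x" "a' \<in> x" "z \<in> S" "z' \<in> S"
        unfolding y_def by blast
      then have "g + h = (a + a') + f * (z + z')" by (simp add: algebra_simps)
      moreover have "a + a' \<in> x" "z + z' \<in> S" using m submodD(2)[OF x(2)] subrngD(3)[OF S] by auto
      ultimately show "g + h \<in> y" unfolding y_def by blast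
    next
      fix s g assume s: "s \<in> S" and "g \<in> y"
      then obtain a z where "g = a + f * z" and m: "a \<in> x" "z \<in> S" unfolding y_def by blast
      then have "s * g = s * a + f * (s * z)" by (simp add: algebra_simps)
      moreover have "s * a \<in> x" "s * z \<in> S" using m s submodD(3)[OF x(2)] subrngD(5)[OF S] by auto
      ultimately show "s * g \<in> y" unfolding y_def by blast
    qed
    moreover have "y \<subseteq> S" unfolding y_def using x(1) f subrngD[OF S] by auto
    moreover have "x \<subseteq> y"
    proof
      fix a assume a: "a \<in> x"
      have "a = a + f * 0" by simp
      then show "a \<in> y" unfolding y_def using a subrngD(2)[OF S] by blast
    qed
    moreover have "f \<in> y"
    proof -
      have "f = 0 + f * 1" by simp
      then show ?thesis unfolding y_def using submodD(1)[OF x(2)] subrngD(1)[OF S] by blast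
    qed
    ultimately have "1 \<in> y" using mx[of y] f(2) by blast
    then obtain a z where "1 = a + f * z" "a \<in> x" "z \<in> S" unfolding y_def by blast
    then have "f * z - 1 = - a" by (metis add_diff_cancel_left' diff_minus_eq_add minus_diff_eq uminus_add_conv_diff)
    then show ?thesis using submod_uminus[OF S x(2)] \<open>a \<in> x\<close> \<open>z \<in> S\<close> by metis
  qed
  then have "maxid S x" using x by (auto simp: maxid_def)
  then show ?thesis using that x by blast
qed

text \<open>Seminorms vanish outside \<open>S\<close>, so that they are determined by their values on \<open>S\<close>.\<close>

definition seminorms :: "'r::comm_ring_1 set \<Rightarrow> ('r \<Rightarrow> real) set" where
  "seminorms S = {p. (\<forall>f. f \<notin> S \<longrightarrow> p f = 0) \<and> (\<forall>f\<in>S. 0 \<le> p f) \<and> p 0 = 0 \<and> p 1 = 1 \<and>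
     (\<forall>f\<in>S. \<forall>g\<in>S. p (f * g) \<le> p f * p g \<and> p (f - g) \<le> max (p f) (p g))}"

definition mult_seminorms :: "'r::comm_ring_1 set \<Rightarrow> ('r \<Rightarrow> real) set" where
  "mult_seminorms S = {p \<in> seminorms S. \<forall>f\<in>S. \<forall>g\<in>S. p (f * g) = p f * p g}"

lemma seminormsD:
  assumes "p \<in> seminorms S"
  shows "f \<in> S \<Longrightarrow> 0 \<le> p f" "p 0 = 0" "p 1 = 1"
    "f \<in> S \<Longrightarrow> g \<in> S \<Longrightarrow> p (f * g) \<le> p f * p g" "f \<in> S \<Longrightarrow> g \<in> S \<Longrightarrow> p (f - g) \<le> max (p f) (p g)"
    "f \<notin> S \<Longrightarrow> p f = 0"
  using assms by (auto simp: seminorms_def)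

lemma seminorm_power: "subrng S \<Longrightarrow> p \<in> seminorms S \<Longrightarrow> f \<in> S \<Longrightarrow> p (f ^ n) \<le> p f ^ n"
proof (induction n)
  case (Suc n)
  then have "p (f * f ^ n) \<le> p f * p (f ^ n)" by (simp add: seminormsD subrng_power)
  also have "\<dots> \<le> p f * p f ^ n" using Suc by (simp add: mult_left_mono seminormsD)
  finally show ?case by simp
qed (simp add: seminormsD)

lemma seminorm_uminus: "subrng S \<Longrightarrow> p \<in> seminorms S \<Longrightarrow> f \<in> S \<Longrightarrow> p (- f) = p f"
proof -
  assume a: "subrng S" "p \<in> seminorms S" "f \<in> S"
  have "p (0 - f) \<le> max (p 0) (p f)" "p (0 - (- f)) \<le> max (p 0) (p (- f))"
    using a by (intro seminormsD(5)[OF a(2)] subrngD[OF a(1)]; simp add: subrngD)+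
  then show ?thesis using a seminormsD(1,2)[OF a(2)] subrngD(6)[OF a(1)] by (simp add: max_def split: if_splits)
qed

lemma seminorm_add: "subrng S \<Longrightarrow> p \<in> seminorms S \<Longrightarrow> f \<in> S \<Longrightarrow> g \<in> S \<Longrightarrow> p (f + g) \<le> max (p f) (p g)"
  using seminormsD(5)[of p S f "- g"] seminorm_uminus[of S p g] subrngD(6)[of S g] by simp

lemma seminorm_sum:
  "subrng S \<Longrightarrow> p \<in> seminorms S \<Longrightarrow> 0 \<le> r \<Longrightarrow> (\<And>a. a \<in> A \<Longrightarrow> f a \<in> S \<and> p (f a) \<le> r) \<Longrightarrow> sum f A \<in> S \<and> p (sum f A) \<le> r"
proof (induction A rule: infinite_finite_induct)
  case (insert x F)
  then show ?case using seminorm_add[of S p "f x" "sum f F"] subrngD(3)[of S] by force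
qed (auto simp: seminormsD subrngD)

section \<open>Seminorms constructed as infima of admissible bounds\<close>

lemma mult_le_of_upper:
  fixes x :: real
  assumes "0 \<le> a" "0 \<le> b" "\<And>a' b'. a < a' \<Longrightarrow> b < b' \<Longrightarrow> x \<le> a' * b'"
  shows "x \<le> a * b"
proof (rule tendsto_lowerbound)
  show "((\<lambda>e. (a + e) * (b + e)) \<longlongrightarrow> a * b) (at_right 0)"
    by (auto intro!: tendsto_eq_intros)
  show "\<forall>\<^sub>F e in at_right 0. x \<le> (a + e) * (b + e)"
    using eventually_at_right_less by (rule eventually_mono) (intro assms; simp)
qed simp

text \<open>\<open>A f r\<close> stands for an upper bound \<open>r\<close> for the seminorm to be constructed at \<open>f\<close>.\<close>

definition bounds_relation :: "'r::comm_ring_1 set \<Rightarrow> ('r \<Rightarrow> real \<Rightarrow> bool) \<Rightarrow> bool" where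
  "bounds_relation S A \<longleftrightarrow>
     (\<forall>f\<in>S. \<exists>r>0. A f r) \<and>
     (\<forall>f\<in>S. \<forall>r s. 0 < r \<longrightarrow> A f r \<longrightarrow> r \<le> s \<longrightarrow> A f s) \<and>
     (\<forall>f\<in>S. \<forall>g\<in>S. \<forall>r s. 0 < r \<longrightarrow> 0 < s \<longrightarrow> A f r \<longrightarrow> A g s \<longrightarrow> A (f * g) (r * s)) \<and>
     (\<forall>f\<in>S. \<forall>g\<in>S. \<forall>r. 0 < r \<longrightarrow> A f r \<longrightarrow> A g r \<longrightarrow> A (f - g) r) \<and>
     (\<forall>r. 0 < r \<longrightarrow> (A 1 r \<longleftrightarrow> 1 \<le> r)) \<and> (\<forall>r>0. A 0 r)"

text \<open>The infimum of the admissible bounds need not be attained, so only a strict inequality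
  \<open>q f < r\<close> gives back \<open>A f r\<close>.\<close>

lemma seminorm_of_bounds:
  fixes A :: "'r::comm_ring_1 \<Rightarrow> real \<Rightarrow> bool"
  assumes S: "subrng S" and A: "bounds_relation S A"
    and q_def: "q = (\<lambda>f. if f \<in> S then Inf {r. 0 < r \<and> A f r} else 0)"
  shows "q \<in> seminorms S" "\<And>f r. f \<in> S \<Longrightarrow> q f < r \<Longrightarrow> A f r" "\<And>f r. f \<in> S \<Longrightarrow> 0 < r \<Longrightarrow> A f r \<Longrightarrow> q f \<le> r"
proof -
  obtain ex: "\<forall>f\<in>S. \<exists>r>0. A f r"
    and mono': "\<forall>f\<in>S. \<forall>r s. 0 < r \<longrightarrow> A f r \<longrightarrow> r \<le> s \<longrightarrow> A f s"
    and mult': "\<forall>f\<in>S. \<forall>g\<in>S. \<forall>r s. 0 < r \<longrightarrow> 0 < s \<longrightarrow> A f r \<longrightarrow> A g s \<longrightarrow> A (f * g) (r * s)"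
    and diff': "\<forall>f\<in>S. \<forall>g\<in>S. \<forall>r. 0 < r \<longrightarrow> A f r \<longrightarrow> A g r \<longrightarrow> A (f - g) r"
    and one: "\<forall>r. 0 < r \<longrightarrow> (A 1 r \<longleftrightarrow> 1 \<le> r)" and zero: "\<forall>r>0. A 0 r"
    using A unfolding bounds_relation_def by (elim conjE)
  note mono = mono'[rule_format] and mult = mult'[rule_format] and diff = diff'[rule_format]
    and one = one[rule_format] and zero = zero[rule_format] and ex = ex[rule_format]
  have bb: "bdd_below {r. 0 < r \<and> A f r}" for f by (auto intro!: bdd_belowI[of _ 0])
  show le: "q f \<le> r" if "f \<in> S" "0 < r" "A f r" for f r
    unfolding q_def using that by (auto intro!: cInf_lower bb)
  have ne: "{r. 0 < r \<and> A f r} \<noteq> {}" if "f \<in> S" for f using ex[OF that] by blast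
  have q0: "0 \<le> q f" for f
    unfolding q_def using ne by (auto intro!: cInf_greatest)
  show lt: "A f r" if f: "f \<in> S" "q f < r" for f r
  proof -
    have "Inf {r. 0 < r \<and> A f r} < r" using f by (simp add: q_def)
    then obtain s where "0 < s" "A f s" "s < r" using cInf_lessD[OF ne[OF f(1)]] by blast
    then show ?thesis using mono[OF f(1), of s r] by simp
  qed
  have 1: "1 \<in> S" and 0: "0 \<in> S" by (rule subrngD[OF S])+
  have "q 0 \<le> e" if "0 < e" for e using le[OF 0 that zero[OF that]] .
  then have z: "q 0 = 0" using q0[of 0] by (meson field_le_epsilon dual_order.antisym add_0_left order_refl le_add_same_cancel1 order_trans dense_ge)
  have "q 1 \<le> 1" using le[OF 1] one by simp
  moreover have "1 \<le> q 1"
  proof (rule dense_ge)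
    fix r assume r: "q 1 < r"
    then show "1 \<le> r" using lt[OF 1 r] one[of r] q0[of 1] by simp
  qed
  ultimately have o: "q 1 = 1" by simp
  have m: "q (f * g) \<le> q f * q g" if fg: "f \<in> S" "g \<in> S" for f g
  proof (rule mult_le_of_upper[OF q0 q0])
    fix r s assume rs: "q f < r" "q g < s"
    then have p: "0 < r" "0 < s" using q0[of f] q0[of g] by linarith+
    then show "q (f * g) \<le> r * s"
      using le[OF subrngD(5)[OF S fg], of "r * s"] mult[OF fg p] lt[OF fg(1) rs(1)] lt[OF fg(2) rs(2)] by simp
  qed
  have d: "q (f - g) \<le> max (q f) (q g)" if fg: "f \<in> S" "g \<in> S" for f g
  proof (rule dense_ge)
    fix r assume r: "max (q f) (q g) < r"
    then have p: "0 < r" using q0[of f] by simp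
    show "q (f - g) \<le> r"
      using r by (intro le[OF subrngD(4)[OF S fg] p] diff[OF fg p] lt fg) auto
  qed
  have "q f = 0" if "f \<notin> S" for f using that by (simp add: q_def)
  then show "q \<in> seminorms S"
    unfolding seminorms_def using q0 z o m d by auto
qed

text \<open>Zorn's lemma downwards. The pointwise infimum of a chain is a seminorm because two
  bounds are always realised by a single member of the chain, and the value 1 at the unit prevents
  collapse to zero.\<close>

lemma minimal_seminorm:
  assumes S: "subrng S" and N: "N \<in> seminorms S"
  obtains p where "p \<in> seminorms S" "p \<le> N" "\<And>q. q \<in> seminorms S \<Longrightarrow> q \<le> p \<Longrightarrow> q = p"
proof -
  let ?B = "{p \<in> seminorms S. p \<le> N}"
  have "\<exists>m\<in>?B. \<forall>a\<in>?B. a \<le> m \<longrightarrow> a = m"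
  proof (rule predicate_Zorn)
    show "partial_order_on ?B (relation_of (\<lambda>x y. y \<le> x) ?B)"
      by (rule partial_order_on_relation_ofI) auto
    fix C assume C: "C \<in> Chains (relation_of (\<lambda>x y. y \<le> x) ?B)"
    then have CB: "C \<subseteq> ?B" by (auto simp: Chains_def relation_of_def)
    have ch: "\<And>a b. a \<in> C \<Longrightarrow> b \<in> C \<Longrightarrow> a \<le> b \<or> b \<le> a" using C by (auto simp: Chains_def relation_of_def)
    show "\<exists>u\<in>?B. \<forall>a\<in>C. u \<le> a"
    proof (cases "C = {}")
      case True then show ?thesis using N by blast
    next
      case False
      then obtain c where c: "c \<in> C" by blast
      define A where "A f r \<longleftrightarrow> (\<exists>a\<in>C. a f \<le> r)" for f and r :: real
      define q where "q = (\<lambda>f. if f \<in> S then Inf {r. 0 < r \<and> A f r} else 0)"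
      have sn: "\<And>a. a \<in> C \<Longrightarrow> a \<in> seminorms S" using CB by blast
      have two: "\<exists>a\<in>C. a f \<le> r \<and> a g \<le> s" if "A f r" "A g s" for f g r s
      proof -
        obtain a b where ab: "a \<in> C" "a f \<le> r" "b \<in> C" "b g \<le> s" using \<open>A f r\<close> \<open>A g s\<close> unfolding A_def by blast
        show ?thesis
        proof (cases "a \<le> b")
          case True then show ?thesis using ab by (meson le_funD order_trans)
        next
          case False then have "b \<le> a" using ch ab by blast
          then show ?thesis using ab by (meson le_funD order_trans)
        qed
      qed
      have A_ex: "\<exists>r>0. A f r" for f
        unfolding A_def using c by (intro exI[of _ "max 1 (c f)"] conjI bexI[of _ c]) auto
      have A_mono: "A f s" if "A f r" "r \<le> s" for f r s using that unfolding A_def by (meson order_trans)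
      have A_mult: "A (f * g) (r * s)" if "f \<in> S" "g \<in> S" "0 < r" "0 < s" "A f r" "A g s" for f g r s
      proof -
        obtain a where a: "a \<in> C" "a f \<le> r" "a g \<le> s" using two[OF \<open>A f r\<close> \<open>A g s\<close>] by blast
        have "a (f * g) \<le> a f * a g" using seminormsD(4)[OF sn[OF a(1)] that(1,2)] .
        also have "\<dots> \<le> r * s"
          using a that seminormsD(1)[OF sn[OF a(1)]] by (intro mult_mono) auto
        finally show ?thesis unfolding A_def using a(1) by blast
      qed
      have A_diff: "A (f - g) r" if "f \<in> S" "g \<in> S" "0 < r" "A f r" "A g r" for f g r
      proof -
        obtain a where a: "a \<in> C" "a f \<le> r" "a g \<le> r" using two[OF \<open>A f r\<close> \<open>A g r\<close>] by blast
        have "a (f - g) \<le> max (a f) (a g)" using seminormsD(5)[OF sn[OF a(1)] that(1,2)] .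
        then show ?thesis unfolding A_def using a by (intro bexI[of _ a]) auto
      qed
      have "(a 1 \<le> r) = (1 \<le> r)" if "a \<in> C" for a r using seminormsD(3)[OF sn[OF that]] by simp
      then have A_one: "A 1 r \<longleftrightarrow> 1 \<le> r" for r unfolding A_def using c by blast
      have A_zero: "A 0 r" if "0 < r" for r unfolding A_def using seminormsD(2)[OF sn[OF c]] that c by (intro bexI[of _ c]) auto
      have relA: "bounds_relation S A"
        unfolding bounds_relation_def
        by (intro conjI) (use A_ex A_mono A_mult A_diff A_one A_zero in blast)+
      note q = seminorm_of_bounds[OF S relA q_def]
      have "q f \<le> a f" if a: "a \<in> C" for a f
      proof (cases "f \<in> S")
        case True
        show ?thesis
        proof (rule dense_ge)
          fix r assume r: "a f < r"
          then have "0 < r" using seminormsD(1)[OF sn[OF a] True] by simp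
          then show "q f \<le> r" using r a by (intro q(3) True) (auto simp: A_def intro!: bexI[of _ a])
        qed
      next
        case False then show ?thesis using seminormsD(6)[OF sn[OF a]] seminormsD(6)[OF q(1)] by simp
      qed
      then have "\<forall>a\<in>C. q \<le> a" by (auto simp: le_fun_def)
      moreover have "q \<le> N" 
      proof -
        have "q \<le> c" "c \<le> N" using calculation c CB by auto
        then show ?thesis by (rule order_trans)
      qed
      ultimately show ?thesis using q(1) by blast
    qed
  qed
  then obtain p where p: "p \<in> seminorms S" "p \<le> N" "\<And>a. a \<in> seminorms S \<Longrightarrow> a \<le> N \<Longrightarrow> a \<le> p \<Longrightarrow> a = p" by blast
  then show ?thesis using that[of p] by (meson order_trans)
qed

text \<open>A minimal seminorm is equal to its own spectral seminorm, hence power-multiplicative, and then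
  also to the seminorms \<open>f \<mapsto> lim p(f c^n) / p(c)^n\<close>, for which \<open>c\<close> is multiplicative.\<close>

lemma exists_mult_seminorm:
  assumes S: "subrng S" and N: "N \<in> seminorms S"
  obtains p where "p \<in> mult_seminorms S" "p \<le> N"
proof -
  obtain p where p: "p \<in> seminorms S" "p \<le> N" and mn: "\<And>q. q \<in> seminorms S \<Longrightarrow> q \<le> p \<Longrightarrow> q = p"
    using minimal_seminorm[OF S N] by blast
  note pD = seminormsD[OF p(1)] and SD = subrngD[OF S]
  \<comment> \<open>Allowing a constant factor \<open>C\<close> makes the infimum of these
    \<open>r\<close> the limit of the i-th roots of \<open>p (f ^ i)\<close>, which is the spectral
    seminorm.\<close>
  define A where "A f r \<longleftrightarrow> (\<exists>C>0. \<forall>i. p (f ^ i) \<le> C * r ^ i)" for f and r :: real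
  define q where "q = (\<lambda>f. if f \<in> S then Inf {r. 0 < r \<and> A f r} else 0)"
  have Ap: "A f r" if "f \<in> S" "p f \<le> r" for f r
  proof -
    have "p (f ^ i) \<le> 1 * r ^ i" for i
      using seminorm_power[OF S p(1) that(1), of i] power_mono[OF that(2) pD(1)[OF that(1)], of i] by simp
    then show ?thesis unfolding A_def using zero_less_one by blast
  qed
  have A_ex: "\<exists>r>0. A f r" if "f \<in> S" for f
    using Ap[OF that, of "max 1 (p f)"] by (intro exI[of _ "max 1 (p f)"]) auto
  have A_mono: "A f s" if "0 < r" "A f r" "r \<le> s" for f r s
  proof -
    obtain C where C: "C > 0" "\<And>i. p (f ^ i) \<le> C * r ^ i" using \<open>A f r\<close> unfolding A_def by blast
    have "C * r ^ i \<le> C * s ^ i" for i using C(1) that by (intro mult_left_mono power_mono) auto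
    then show ?thesis unfolding A_def using C by (meson order_trans)
  qed
  have A_mult: "A (f * g) (r * s)" if "f \<in> S" "g \<in> S" "0 < r" "0 < s" "A f r" "A g s" for f g r s
  proof -
    obtain C where C: "C > 0" "\<And>i. p (f ^ i) \<le> C * r ^ i" using \<open>A f r\<close> unfolding A_def by blast
    obtain D where D: "D > 0" "\<And>i. p (g ^ i) \<le> D * s ^ i" using \<open>A g s\<close> unfolding A_def by blast
    have "p ((f * g) ^ i) \<le> C * D * (r * s) ^ i" for i
    proof -
      have "p ((f * g) ^ i) \<le> p (f ^ i) * p (g ^ i)"
        unfolding power_mult_distrib using that by (intro pD(4) subrng_power[OF S])
      also have "\<dots> \<le> (C * r ^ i) * (D * s ^ i)"
        using C D that pD(1) subrng_power[OF S] by (intro mult_mono) auto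
      finally show ?thesis by (simp add: power_mult_distrib algebra_simps)
    qed
    then show ?thesis unfolding A_def using C(1) D(1) by (intro exI[of _ "C * D"]) auto
  qed
  have A_diff: "A (f - g) r" if "f \<in> S" "g \<in> S" "0 < r" "A f r" "A g r" for f g r
  proof -
    obtain C where C: "C > 0" "\<And>i. p (f ^ i) \<le> C * r ^ i" using \<open>A f r\<close> unfolding A_def by blast
    obtain D where D: "D > 0" "\<And>i. p (g ^ i) \<le> D * r ^ i" using \<open>A g r\<close> unfolding A_def by blast
    \<comment> \<open>Carrying the factor \<open>f ^ i * g ^ j\<close> along replaces the binomial
      theorem: one factor \<open>f - g\<close> is split at a time and the ultrametric inequality
      treats the two halves.\<close>
    have "p ((f - g) ^ n * (f ^ i * g ^ j)) \<le> C * D * r ^ (n + i + j)" for n i j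
    proof (induction n arbitrary: i j)
      case 0
      have "p (f ^ i * g ^ j) \<le> p (f ^ i) * p (g ^ j)" using that by (intro pD(4) subrng_power[OF S])
      also have "\<dots> \<le> (C * r ^ i) * (D * r ^ j)"
        using C D that pD(1) subrng_power[OF S] by (intro mult_mono) auto
      finally show ?case by (simp add: power_add algebra_simps)
    next
      case (Suc n)
      have "(f - g) ^ Suc n * (f ^ i * g ^ j) = (f - g) ^ n * (f ^ Suc i * g ^ j) - (f - g) ^ n * (f ^ i * g ^ Suc j)"
        by (simp add: algebra_simps)
      moreover have "p \<dots> \<le> max (p ((f - g) ^ n * (f ^ Suc i * g ^ j))) (p ((f - g) ^ n * (f ^ i * g ^ Suc j)))"
        using that by (intro pD(5) SD subrng_power[OF S])
      ultimately show ?case using Suc.IH[of "Suc i" j] Suc.IH[of i "Suc j"] by simp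
    qed
    from this[of _ 0 0] have "p ((f - g) ^ n) \<le> C * D * r ^ n" for n by simp
    then show ?thesis unfolding A_def using C(1) D(1) by (intro exI[of _ "C * D"]) auto
  qed
  have A_one: "A 1 r \<longleftrightarrow> 1 \<le> r" if "0 < r" for r
  proof
    assume "A 1 r"
    then obtain C where C: "C > 0" "\<And>i. 1 \<le> C * r ^ i" using pD(3) unfolding A_def by auto
    show "1 \<le> r"
    proof (rule ccontr)
      assume "\<not> 1 \<le> r"
      then obtain i where "r ^ i < 1 / C" using real_arch_pow_inv[of "1 / C" r] C(1) by auto
      then show False using C(1) C(2)[of i] by (simp add: field_simps)
    qed
  qed (use Ap[OF SD(1)] pD(3) in auto)
  have A_zero: "A 0 r" if "0 < r" for r using Ap[OF SD(2)] pD(2) that by simp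
  have relA: "bounds_relation S A"
    unfolding bounds_relation_def
    by (intro conjI) (use A_ex A_mono A_mult A_diff A_one A_zero in blast)+
  note Q = seminorm_of_bounds[OF S relA q_def]
  have "q \<le> p"
  proof (rule le_funI)
    fix f show "q f \<le> p f"
    proof (cases "f \<in> S")
      case True
      show ?thesis
      proof (rule dense_ge)
        fix r assume "p f < r"
        then show "q f \<le> r" using pD(1)[OF True] Ap[OF True, of r] by (intro Q(3) True) auto
      qed
    qed (simp add: pD(6) q_def)
  qed
  then have qp: "q = p" using mn Q(1) by blast
  \<comment> \<open>If the value at the square were too small, the powers of \<open>c\<close> would
    grow at a rate \<open>s\<close> below \<open>p c\<close>, although \<open>p\<close> is its own
    spectral seminorm.\<close>
  have sq: "p (c ^ 2) = p c ^ 2" if c: "c \<in> S" for c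
  proof (rule antisym[OF seminorm_power[OF S p(1) c]], rule ccontr)
    assume "\<not> p c ^ 2 \<le> p (c ^ 2)"
    then have lt: "p (c ^ 2) < p c ^ 2" by simp
    have c2: "c ^ 2 \<in> S" by (rule subrng_power[OF S c])
    then obtain r where r: "p (c ^ 2) < r" "r < p c ^ 2" using lt dense by blast
    have r0: "0 < r" using r(1) pD(1)[OF c2] by simp
    define s where "s = sqrt r"
    have s: "0 < s" "s ^ 2 = r" using r0 by (auto simp: s_def)
    have "A (c ^ 2) (s ^ 2)" using Q(2)[of "c ^ 2" r] r(1) s c2 qp by simp
    then obtain C where C: "C > 0" "\<And>i. p ((c ^ 2) ^ i) \<le> C * (s ^ 2) ^ i" unfolding A_def by blast
    \<comment> \<open>One constant for both parities: an odd power contributes an extra factor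
      \<open>p c\<close>, which has to be traded for \<open>s\<close>.\<close>
    define D where "D = max C (C * p c / s)"
    have D: "D > 0" "C \<le> D" "C * p c \<le> D * s"
      using C(1) s by (auto simp: D_def less_max_iff_disj field_simps le_max_iff_disj max_def)
    have "p (c ^ i) \<le> D * s ^ i" for i
    proof (cases "even i")
      case True
      then obtain k where k: "i = 2 * k" by blast
      have "C * s ^ i \<le> D * s ^ i" using D s by (intro mult_right_mono) auto
      then show ?thesis using C(2)[of k] by (simp add: k power_mult)
    next
      case False
      then obtain k where k: "i = Suc (2 * k)" using oddE by (metis Suc_eq_plus1)
      have "p (c * c ^ (2 * k)) \<le> p c * p (c ^ (2 * k))" by (intro pD(4) c subrng_power[OF S])
      also have "\<dots> \<le> p c * (C * s ^ (2 * k))"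
        using C(2)[of k] pD(1)[OF c] by (intro mult_left_mono) (auto simp: power_mult)
      also have "\<dots> = (C * p c) * s ^ (2 * k)" by simp
      also have "\<dots> \<le> (D * s) * s ^ (2 * k)" using D(3) s by (intro mult_right_mono) auto
      finally show ?thesis by (simp add: k mult.assoc)
    qed
    then have "A c s" unfolding A_def using D(1) by blast
    then have "p c \<le> s" using Q(3)[OF c s(1)] qp by simp
    then have "p c ^ 2 \<le> s ^ 2" using pD(1)[OF c] by (intro power_mono)
    then show False using s r by simp
  qed
  have pw: "p (c ^ n) = p c ^ n" if c: "c \<in> S" "0 < p c" for c n
  proof -
    have two: "p (c ^ (2 ^ k)) = p c ^ (2 ^ k)" for k
    proof (induction k)
      case (Suc k)
      have "c ^ (2 ^ Suc k) = (c ^ (2 ^ k)) ^ 2" by (simp add: power_mult[symmetric] mult.commute)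
      then show ?case using sq[OF subrng_power[OF S c(1), of "2 ^ k"]] Suc by (simp add: power_mult[symmetric] mult.commute)
    qed simp
    \<comment> \<open>Equality at the exponent \<open>2 ^ n\<close> leaves no room for a strict
      inequality at the smaller exponent \<open>n\<close>, by submultiplicativity and
      \<open>0 < p c\<close>.\<close>
    have "n < 2 ^ n" by (rule less_exp)
    then obtain m where m: "2 ^ n = n + m" using less_imp_add_positive by metis
    have "p c ^ n * p c ^ m = p (c ^ n * c ^ m)" using two[of n] by (simp add: m power_add)
    also have "\<dots> \<le> p (c ^ n) * p (c ^ m)" by (intro pD(4) subrng_power[OF S] c)
    also have "\<dots> \<le> p (c ^ n) * p c ^ m"
      using seminorm_power[OF S p(1) c(1), of m] pD(1) subrng_power[OF S c(1)] by (intro mult_left_mono) auto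
    finally have "p c ^ n \<le> p (c ^ n)" using c(2) by simp
    then show ?thesis using seminorm_power[OF S p(1) c(1), of n] by simp
  qed
  have ml: "p (f * c) = p f * p c" if f: "f \<in> S" and c: "c \<in> S" for f c
  proof (cases "p c = 0")
    case True
    then show ?thesis using pD(1)[OF SD(5)[OF f c]] pD(4)[OF f c] by simp
  next
    case False
    then have c0: "0 < p c" using pD(1)[OF c] by simp
    \<comment> \<open>The quotients of \<open>p (f * c ^ n)\<close> by \<open>p c ^ n\<close> do not
      increase with \<open>n\<close> (\<open>step\<close> below), so a bound that holds once
      persists, and two bounds can be brought to a common \<open>n\<close>.\<close>
    define B where "B f r \<longleftrightarrow> (\<exists>n. p (f * c ^ n) \<le> r * p c ^ n)" for f and r :: real
    define qc where "qc = (\<lambda>f. if f \<in> S then Inf {r. 0 < r \<and> B f r} else 0)"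
    have cS: "c ^ n \<in> S" for n by (rule subrng_power[OF S c])
    have step: "p (f * c ^ m) \<le> r * p c ^ m" if "f \<in> S" "p (f * c ^ n) \<le> r * p c ^ n" "n \<le> m" for f r n m
    proof -
      obtain k where k: "m = n + k" using \<open>n \<le> m\<close> le_Suc_ex by blast
      have "p (f * c ^ n * c ^ k) \<le> p (f * c ^ n) * p (c ^ k)" using that by (intro pD(4) SD cS)
      also have "\<dots> \<le> (r * p c ^ n) * p c ^ k"
        using that pw[OF c c0] c0 by (simp add: mult_right_mono)
      finally show ?thesis by (simp add: k power_add mult.assoc)
    qed
    have Bp: "B f r" if "p f \<le> r" for f r unfolding B_def using that by (intro exI[of _ 0]) simp
    have B_ex: "\<exists>r>0. B f r" if "f \<in> S" for f
      using Bp[of f "max 1 (p f)"] by (intro exI[of _ "max 1 (p f)"]) auto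
    have B_mono: "B f s" if "B f r" "r \<le> s" for f r s
    proof -
      obtain n where n: "p (f * c ^ n) \<le> r * p c ^ n" using \<open>B f r\<close> unfolding B_def by blast
      have "r * p c ^ n \<le> s * p c ^ n" using that c0 by (intro mult_right_mono) auto
      then show ?thesis unfolding B_def using n by (meson order_trans)
    qed
    have two: "\<exists>n. p (f * c ^ n) \<le> r * p c ^ n \<and> p (g * c ^ n) \<le> s * p c ^ n"
      if "f \<in> S" "g \<in> S" "B f r" "B g s" for f g r s
    proof -
      obtain n m where nm: "p (f * c ^ n) \<le> r * p c ^ n" "p (g * c ^ m) \<le> s * p c ^ m" using \<open>B f r\<close> \<open>B g s\<close> unfolding B_def by blast
      show ?thesis using step[OF that(1) nm(1), of "max n m"] step[OF that(2) nm(2), of "max n m"] by auto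
    qed
    have B_mult: "B (f * g) (r * s)" if "f \<in> S" "g \<in> S" "0 < r" "0 < s" "B f r" "B g s" for f g r s
    proof -
      obtain n where n: "p (f * c ^ n) \<le> r * p c ^ n" "p (g * c ^ n) \<le> s * p c ^ n" using two[OF \<open>f \<in> S\<close> \<open>g \<in> S\<close> \<open>B f r\<close> \<open>B g s\<close>] by blast
      have "p ((f * c ^ n) * (g * c ^ n)) \<le> p (f * c ^ n) * p (g * c ^ n)" using that by (intro pD(4) SD cS)
      also have "\<dots> \<le> (r * p c ^ n) * (s * p c ^ n)"
        using n that c0 pD(1) SD(5) cS by (intro mult_mono) auto
      finally have "p (f * g * c ^ (n + n)) \<le> r * s * p c ^ (n + n)" by (simp add: power_add algebra_simps)
      then show ?thesis unfolding B_def by blast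
    qed
    have B_diff: "B (f - g) r" if "f \<in> S" "g \<in> S" "0 < r" "B f r" "B g r" for f g r
    proof -
      obtain n where n: "p (f * c ^ n) \<le> r * p c ^ n" "p (g * c ^ n) \<le> r * p c ^ n" using two[OF \<open>f \<in> S\<close> \<open>g \<in> S\<close> \<open>B f r\<close> \<open>B g r\<close>] by blast
      have "p (f * c ^ n - g * c ^ n) \<le> max (p (f * c ^ n)) (p (g * c ^ n))" using that by (intro pD(5) SD cS)
      then have "p ((f - g) * c ^ n) \<le> r * p c ^ n" using n by (simp add: algebra_simps)
      then show ?thesis unfolding B_def by blast
    qed
    have B_one: "B 1 r \<longleftrightarrow> 1 \<le> r" for r
    proof -
      have "(p (1 * c ^ n) \<le> r * p c ^ n) \<longleftrightarrow> 1 \<le> r" for n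
        using c0 pw[OF c c0, of n] zero_less_power[OF c0, of n] mult_le_cancel_right[of 1 "p c ^ n" r] by simp
      then show ?thesis unfolding B_def by simp
    qed
    have B_zero: "B 0 r" if "0 < r" for r using Bp pD(2) that by simp
    have relB: "bounds_relation S B"
      unfolding bounds_relation_def
      by (intro conjI) (use B_ex B_mono B_mult B_diff B_one B_zero in blast)+
    note Qc = seminorm_of_bounds[OF S relB qc_def]
    have "qc \<le> p"
    proof (rule le_funI)
      fix f show "qc f \<le> p f"
      proof (cases "f \<in> S")
        case True
        show ?thesis
        proof (rule dense_ge)
          fix r assume "p f < r"
          then show "qc f \<le> r" using pD(1)[OF True] Bp[of f r] by (intro Qc(3) True) auto
        qed
      qed (simp add: pD(6) qc_def)
    qed
    then have qp: "qc = p" using mn Qc(1) by blast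
    \<comment> \<open>Replacing \<open>f\<close> by \<open>f * c\<close> only shifts the index of
      the sequence by one, so the limit seminorm, which is \<open>p\<close> by minimality, turns the
      factor \<open>c\<close> into \<open>p c\<close>.\<close>
    have "p f * p c \<le> p (f * c)"
    proof (rule dense_ge)
      fix r assume r: "p (f * c) < r"
      then have r0: "0 < r" using pD(1)[OF SD(5)[OF f c]] by simp
      have "B (f * c) r" using Qc(2)[OF SD(5)[OF f c]] r qp by simp
      then obtain n where "p (f * c * c ^ n) \<le> r * p c ^ n" unfolding B_def by blast
      then have "p (f * c ^ Suc n) \<le> r / p c * p c ^ Suc n" using c0 by (simp add: algebra_simps)
      then have "B f (r / p c)" unfolding B_def by blast
      then have "p f \<le> r / p c" using Qc(3)[OF f, of "r / p c"] r0 c0 qp by simp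
      then show "p f * p c \<le> r" using c0 by (simp add: field_simps)
    qed
    then show ?thesis using pD(4)[OF f c] by simp
  qed
  then have "p \<in> mult_seminorms S" using p(1) by (auto simp: mult_seminorms_def)
  then show ?thesis using that p(2) by blast
qed

section \<open>The Nullstellensatz for Tate algebras\<close>

definition Sp :: "'r::comm_ring_1 set \<Rightarrow> 'r set \<Rightarrow> 'r set" where
  "Sp S U = {\<Sum>u\<in>U. r u * u |r. \<forall>u\<in>U. r u \<in> S}"

lemma Sp_I: "\<forall>u\<in>U. r u \<in> S \<Longrightarrow> (\<Sum>u\<in>U. r u * u) \<in> Sp S U"
  unfolding Sp_def by (intro CollectI exI[of _ r]) simp

lemma Sp_submod: assumes S: "subrng S" shows "submod S (Sp S U)"
  unfolding submod_def
proof (intro conjI ballI)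
  show "0 \<in> Sp S U" unfolding Sp_def using subrngD(2)[OF S] by (intro CollectI exI[of _ "\<lambda>_. 0"]) simp
  fix f g assume "f \<in> Sp S U" "g \<in> Sp S U"
  then obtain r s where rs: "f = (\<Sum>u\<in>U. r u * u)" "g = (\<Sum>u\<in>U. s u * u)" "\<forall>u\<in>U. r u \<in> S" "\<forall>u\<in>U. s u \<in> S"
    unfolding Sp_def by blast
  then have "f + g = (\<Sum>u\<in>U. (r u + s u) * u)" by (simp add: sum.distrib algebra_simps)
  moreover have "\<forall>u\<in>U. r u + s u \<in> S" using rs subrngD(3)[OF S] by blast
  ultimately show "f + g \<in> Sp S U" using Sp_I[of U "\<lambda>u. r u + s u"] by simp
next
  fix a f assume a: "a \<in> S" and "f \<in> Sp S U"
  then obtain r where r: "f = (\<Sum>u\<in>U. r u * u)" "\<forall>u\<in>U. r u \<in> S" unfolding Sp_def by blast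
  then have "a * f = (\<Sum>u\<in>U. (a * r u) * u)" by (simp add: sum_distrib_left algebra_simps)
  moreover have "\<forall>u\<in>U. a * r u \<in> S" using r a subrngD(5)[OF S] by blast
  ultimately show "a * f \<in> Sp S U" using Sp_I[of U "\<lambda>u. a * r u"] by simp
qed

lemma Sp_gen: assumes S: "subrng S" and U: "finite U" "u \<in> U" shows "u \<in> Sp S U"
proof -
  have "(\<Sum>w\<in>U. (if w = u then 1 else 0) * w) = (\<Sum>w\<in>U. if w = u then w else 0)"
    by (rule sum.cong) auto
  also have "\<dots> = u" using U by simp
  finally have "u = (\<Sum>w\<in>U. (if w = u then 1 else 0) * w)" by simp
  moreover have "\<forall>w\<in>U. (if w = u then 1 else 0) \<in> S" using subrngD(1,2)[OF S] by auto
  ultimately show ?thesis unfolding Sp_def by (intro CollectI exI[of _ "\<lambda>w. if w = u then 1 else 0"] conjI)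
qed

lemma Sp_least: "submod S E \<Longrightarrow> U \<subseteq> E \<Longrightarrow> Sp S U \<subseteq> E"
  unfolding Sp_def by (auto intro!: submod_sum[of S E] submodD(3))

text \<open>Uniqueness of digits in base \<open>b\<close>; it separates the weights of the monomials
  in the Noether normalisation.\<close>

lemma base_expansion_inj:
  fixes a c :: "nat \<Rightarrow> nat"
  shows "\<forall>i<n. a i < b \<and> c i < b \<Longrightarrow> (\<Sum>i<n. b ^ i * a i) = (\<Sum>i<n. b ^ i * c i) \<Longrightarrow> \<forall>i<n. a i = c i"
proof (induction n arbitrary: a c)
  case (Suc n)
  have e: "(\<Sum>i<Suc n. b ^ i * f i) = f 0 + b * (\<Sum>i<n. b ^ i * f (Suc i))" for f :: "nat \<Rightarrow> nat"
    by (subst sum.lessThan_Suc_shift) (simp add: sum_distrib_left mult.assoc)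
  have b: "a 0 < b" "c 0 < b" using Suc.prems(1) by auto
  have eq: "a 0 + b * (\<Sum>i<n. b ^ i * a (Suc i)) = c 0 + b * (\<Sum>i<n. b ^ i * c (Suc i))"
    using Suc.prems(2) unfolding e .
  have "(a 0 + b * (\<Sum>i<n. b ^ i * a (Suc i))) mod b = a 0" "(c 0 + b * (\<Sum>i<n. b ^ i * c (Suc i))) mod b = c 0"
    using b by simp_all
  then have 0: "a 0 = c 0" using eq by simp
  then have s: "(\<Sum>i<n. b ^ i * a (Suc i)) = (\<Sum>i<n. b ^ i * c (Suc i))" using eq b by simp
  have "\<forall>i<n. a (Suc i) < b \<and> c (Suc i) < b" using Suc.prems(1) by auto
  then have "\<forall>i<n. a (Suc i) = c (Suc i)" by (rule Suc.IH[OF _ s])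
  then show ?case using 0 by (metis less_Suc_eq_0_disj)
qed simp

context complete_nonarch_field
begin

lemma subrng_T: "subrng (T n)"
  unfolding subrng_def by (intro conjI ballI T_1 T_add T_diff T_mult)

lemma max_v:
  assumes "finite D" "D \<noteq> {}"
  obtains d where "d \<in> D" "\<And>e. e \<in> D \<Longrightarrow> v e \<le> v d"
proof -
  have "Max (v ` D) \<in> v ` D" using assms by (intro Max_in) auto
  then obtain d where d: "d \<in> D" "Max (v ` D) = v d" by blast
  have "v e \<le> Max (v ` D)" if "e \<in> D" for e using assms(1) that by (intro Max_ge) auto
  then show ?thesis using that[of d] d by simp
qed

subsection \<open>Polynomial expressions with integral coefficients\<close>

definition R :: "nat \<Rightarrow> (nat \<Rightarrow> 'k mser) \<Rightarrow> 'k mser set" where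
  "R n t = {\<Sum>a\<in>A. const (c a) * mon n t a |A c. finite A \<and> A \<subseteq> Exp n \<and> (\<forall>a\<in>A. v (c a) \<le> 1)}"

lemma R_I: "finite A \<Longrightarrow> A \<subseteq> Exp n \<Longrightarrow> \<forall>a\<in>A. v (c a) \<le> 1 \<Longrightarrow> (\<Sum>a\<in>A. const (c a) * mon n t a) \<in> R n t"
  unfolding R_def by blast

lemma R_term: "a \<in> Exp n \<Longrightarrow> v c \<le> 1 \<Longrightarrow> const c * mon n t a \<in> R n t"
  using R_I[of "{a}" n "\<lambda>_. c" t] by simp

lemma R_add: assumes "p \<in> R n t" "q \<in> R n t" shows "p + q \<in> R n t"
proof -
  obtain A c where A: "p = (\<Sum>a\<in>A. const (c a) * mon n t a)" "finite A" "A \<subseteq> Exp n" "\<forall>a\<in>A. v (c a) \<le> 1"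
    using assms(1) unfolding R_def by blast
  obtain B d where B: "q = (\<Sum>a\<in>B. const (d a) * mon n t a)" "finite B" "B \<subseteq> Exp n" "\<forall>a\<in>B. v (d a) \<le> 1"
    using assms(2) unfolding R_def by blast
  define c' where "c' a = (c a when a \<in> A)" for a
  define d' where "d' a = (d a when a \<in> B)" for a
  have p: "p = (\<Sum>a\<in>A \<union> B. const (c' a) * mon n t a)"
    unfolding A(1) using A B by (intro sum.mono_neutral_cong_left) (auto simp: c'_def)
  have q: "q = (\<Sum>a\<in>A \<union> B. const (d' a) * mon n t a)"
    unfolding B(1) using A B by (intro sum.mono_neutral_cong_left) (auto simp: d'_def)
  have "v (c' a) \<le> 1" "v (d' a) \<le> 1" for a using A(4) B(4) by (auto simp: c'_def d'_def when_def)
  then have "v (c' a + d' a) \<le> 1" for a using ultrametric[of "c' a" "d' a"] by (meson max.bounded_iff order_trans)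
  then have "(\<Sum>a\<in>A \<union> B. const (c' a + d' a) * mon n t a) \<in> R n t" using A B by (intro R_I) auto
  then show ?thesis unfolding p q by (simp add: sum.distrib algebra_simps)
qed

lemma R_0: "0 \<in> R n t" using R_I[of "{}"] by simp

lemma R_sum: "(\<And>a. a \<in> A \<Longrightarrow> f a \<in> R n t) \<Longrightarrow> sum f A \<in> R n t"
  by (induction A rule: infinite_finite_induct) (auto simp: R_0 R_add)

lemma R_term_mult: assumes "p \<in> R n t" "b \<in> Exp n" "v d \<le> 1" shows "const d * mon n t b * p \<in> R n t"
proof -
  obtain A c where A: "p = (\<Sum>a\<in>A. const (c a) * mon n t a)" "finite A" "A \<subseteq> Exp n" "\<forall>a\<in>A. v (c a) \<le> 1"
    using assms(1) unfolding R_def by blast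
  have "const d * mon n t b * (const (c a) * mon n t a) \<in> R n t" if a: "a \<in> A" for a
  proof -
    have "v (d * c a) \<le> 1" using assms(3) A(4) a nonneg by (simp add: mult mult_le_one)
    then have "const (d * c a) * mon n t (b + a) \<in> R n t" using a A(3) assms(2) by (intro R_term Exp_add) auto
    then show ?thesis by (simp add: const_mult mon_add algebra_simps)
  qed
  then show ?thesis unfolding A(1) sum_distrib_left by (intro R_sum)
qed

lemma R_mult: assumes "p \<in> R n t" "q \<in> R n t" shows "p * q \<in> R n t"
proof -
  obtain A c where A: "p = (\<Sum>a\<in>A. const (c a) * mon n t a)" "finite A" "A \<subseteq> Exp n" "\<forall>a\<in>A. v (c a) \<le> 1"
    using assms(1) unfolding R_def by blast
  show ?thesis unfolding A(1) sum_distrib_right using A assms(2) by (intro R_sum R_term_mult) auto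
qed

lemma R_const: "v c \<le> 1 \<Longrightarrow> const c \<in> R n t" using R_term[of 0 n c t] by simp

lemma subrng_R: "subrng (R n t)"
proof -
  have "p - q \<in> R n t" if "p \<in> R n t" "q \<in> R n t" for p q
  proof -
    have "const (- 1) * q \<in> R n t" by (intro R_mult R_const that) simp
    then show ?thesis using R_add[OF that(1)] by fastforce
  qed
  then show ?thesis unfolding subrng_def using R_const[of 1] R_add R_mult by auto
qed

lemma R_var: "i < n \<Longrightarrow> t i \<in> R n t"
  using R_term[of "Poly_Mapping.single i 1" n 1 t] by (simp add: mon_single Exp_single)

end

section \<open>The residue norm modulo a maximal ideal\<close>

locale max_ideal = complete_nonarch_field v for v :: "'k::field \<Rightarrow> real" +
  fixes N :: nat and x :: "'k mser set"
  assumes max: "maxid (T N) x"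
begin

lemma x_T: "x \<subseteq> T N" and x_sub: "submod (T N) x" and x_1: "1 \<notin> x"
  and x_max: "f \<in> T N \<Longrightarrow> f \<notin> x \<Longrightarrow> \<exists>z\<in>T N. f * z - 1 \<in> x"
  using maxidD[OF max] by blast+

text \<open>The closed ball of radius \<open>r\<close> for the residue norm, except that the infimum defining the
  residue norm must be attained.\<close>

definition B :: "real \<Rightarrow> 'k mser set" where
  "B r = {f \<in> T N. \<exists>h\<in>x. bd r (f - h)}"

lemma B_I: "f \<in> T N \<Longrightarrow> h \<in> x \<Longrightarrow> bd r (f - h) \<Longrightarrow> f \<in> B r" unfolding B_def by blast

lemma B_T: "B r \<subseteq> T N" unfolding B_def by blast

lemma B_bd: "f \<in> T N \<Longrightarrow> bd r f \<Longrightarrow> f \<in> B r"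
  using B_I[of f 0 r] submodD(1)[OF x_sub] by simp

lemma B_x: "0 \<le> r \<Longrightarrow> h \<in> x \<Longrightarrow> h \<in> B r"
  using B_I[of h h r] x_T bd_0 by auto

lemma B_mono: "r \<le> s \<Longrightarrow> B r \<subseteq> B s" unfolding B_def using bd_mono by blast

lemma B_add: assumes "f \<in> B r" "g \<in> B r" shows "f + g \<in> B r"
proof -
  obtain h h' where h: "h \<in> x" "bd r (f - h)" "h' \<in> x" "bd r (g - h')" using assms unfolding B_def by blast
  have "bd r ((f + g) - (h + h'))" using bd_add[OF h(2,4)] by (simp add: algebra_simps)
  then show ?thesis using B_I[of "f + g" "h + h'" r] h submodD(2)[OF x_sub] T_add assms B_T by blast
qed

lemma B_mult: assumes "f \<in> B r" "g \<in> B s" shows "f * g \<in> B (r * s)"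
proof -
  obtain h h' where h: "h \<in> x" "bd r (f - h)" "h' \<in> x" "bd s (g - h')" using assms unfolding B_def by blast
  have fg: "f \<in> T N" "g \<in> T N" using assms B_T by auto
  have "bd (r * s) (f * g - (h * g + (f - h) * h'))" using bd_mult[OF h(2,4)] by (simp add: algebra_simps)
  moreover have "f - h \<in> T N" using T_diff fg(1) h(1) x_T by blast
  then have "h * g \<in> x" "(f - h) * h' \<in> x"
    using submodD(4)[OF x_sub fg(2) h(1)] submodD(3)[OF x_sub _ h(3)] by auto
  ultimately show ?thesis using B_I[of "f * g" "h * g + (f - h) * h'"] submodD(2)[OF x_sub] T_mult[OF fg] by blast
qed

lemma B_mult1: "f \<in> B r \<Longrightarrow> g \<in> B 1 \<Longrightarrow> f * g \<in> B r" "g \<in> B 1 \<Longrightarrow> f \<in> B r \<Longrightarrow> g * f \<in> B r"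
  using B_mult[of f r g 1] B_mult[of g 1 f r] by simp_all

lemma B_const_mult: "f \<in> B r \<Longrightarrow> const c * f \<in> B (v c * r)"
  using B_mult[OF B_bd[OF T_const bd_const]] .

lemma B_const: "v c \<le> r \<Longrightarrow> const c \<in> B r"
  using B_bd[OF T_const bd_mono[OF bd_const]] .

lemma B_uminus: "f \<in> B r \<Longrightarrow> - f \<in> B r"
  using B_const_mult[of f r "- 1"] by simp

lemma B_diff: "f \<in> B r \<Longrightarrow> g \<in> B r \<Longrightarrow> f - g \<in> B r"
  using B_add[of f r "- g"] B_uminus by simp

lemma B_divide: assumes "c \<noteq> 0" "const c * f \<in> B (v c * r)" shows "f \<in> B r"
proof -
  have "const (inverse c) * (const c * f) \<in> B (v (inverse c) * (v c * r))"
    by (rule B_const_mult[OF assms(2)])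
  moreover have "const (inverse c) * (const c * f) = f"
    using const_inverse(2)[OF assms(1)] by (simp add: mult.assoc[symmetric])
  moreover have "v (inverse c) * (v c * r) = r" using v_pos[OF assms(1)] by (simp add: v_inverse)
  ultimately show ?thesis by simp
qed

lemma B_0: "0 \<le> r \<Longrightarrow> 0 \<in> B r" using B_x submodD(1)[OF x_sub] by blast

lemma B_1: "1 \<in> B 1" using B_const[of 1 1] by simp

lemma B_power: "f \<in> B 1 \<Longrightarrow> f ^ k \<in> B 1"
  by (induction k) (auto simp: B_1 B_mult1)

lemma B_prod: "(\<And>a. a \<in> A \<Longrightarrow> f a \<in> B 1) \<Longrightarrow> prod f A \<in> B 1"
  by (induction A rule: infinite_finite_induct) (auto simp: B_1 B_mult1)

lemma B_sum: "0 \<le> r \<Longrightarrow> (\<And>a. a \<in> A \<Longrightarrow> f a \<in> B r) \<Longrightarrow> sum f A \<in> B r"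
  by (induction A rule: infinite_finite_induct) (auto simp: B_0 B_add)

text \<open>An element of \<open>x\<close> at distance less than 1 from 1 would be a unit by the
  geometric series. Hence the residue norm does not degenerate.\<close>

lemma one_notin_B: assumes "r < 1" shows "1 \<notin> B r"
proof
  assume "1 \<in> B r"
  then obtain h where h: "h \<in> x" "bd r (1 - h)" unfolding B_def by blast
  have "1 - h \<in> T N" using h x_T T_1 T_diff by blast
  then obtain g where g: "g \<in> T N" "(1 - (1 - h)) * g = 1" using T_unit[OF _ h(2) assms] by blast
  then have "1 \<in> x" using submodD(4)[OF x_sub g(1) h(1)] by simp
  then show False using x_1 by simp
qed

lemma absorb: assumes "f \<in> T N" obtains d where "d \<noteq> 0" "v d \<le> 1" "const d * f \<in> B 1"
proof -
  obtain r where r: "0 < r" "bd r f" using T_bd[OF assms] .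
  obtain d where d: "d \<noteq> 0" "v d < min 1 (1 / r)" using tiny_const[of "min 1 (1 / r)"] r by auto
  have "v d * r \<le> 1" using d r by (simp add: field_simps)
  then have "const d * f \<in> B 1"
    using bd_mono[OF bd_const_mult[OF r(2)]] T_mult[OF T_const assms] by (intro B_bd)
  then show ?thesis using that d by simp
qed

text \<open>This is closedness of \<open>x\<close>, obtained from maximality: an element outside
  \<open>x\<close> has an inverse modulo \<open>x\<close>, and if its residue norm were arbitrarily
  small, so would be that of 1.\<close>

lemma B_inter:
  assumes y: "y \<in> T N" and c: "c \<noteq> 0" "v c < 1" and B: "\<And>k. y \<in> B (v c ^ k)"
  shows "y \<in> x"
proof (rule ccontr)
  assume "y \<notin> x"
  then obtain z where z: "z \<in> T N" "y * z - 1 \<in> x" using x_max y by blast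
  obtain d where d: "d \<noteq> 0" "const d * z \<in> B 1" using absorb[OF z(1)] by metis
  obtain k where k: "v c ^ k < v d" using real_arch_pow_inv[OF v_pos[OF d(1)] c(2)] by blast
  have p: "0 \<le> v c ^ k" using nonneg by simp
  have "y * (const d * z) \<in> B (v c ^ k)" using B_mult1(1)[OF B d(2)] .
  moreover have "const d * (y * z - 1) \<in> B (v c ^ k)"
    by (rule B_x[OF p submodD(3)[OF x_sub T_const z(2)]])
  ultimately have "y * (const d * z) - const d * (y * z - 1) \<in> B (v c ^ k)" by (rule B_diff)
  then have "const d * 1 \<in> B (v d * (v c ^ k / v d))"
    using v_pos[OF d(1)] by (simp add: algebra_simps)
  then have "1 \<in> B (v c ^ k / v d)" by (rule B_divide[OF d(1)])
  moreover have "v c ^ k / v d < 1" using k v_pos[OF d(1)] by simp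
  ultimately show False using one_notin_B by blast
qed

lemma mon_B: "(\<And>i. i < n \<Longrightarrow> t i \<in> B 1) \<Longrightarrow> mon n t a \<in> B 1"
  unfolding mon_def by (intro B_prod B_power) auto

lemma R_B: assumes t: "\<And>i. i < n \<Longrightarrow> t i \<in> B 1" shows "R n t \<subseteq> B 1"
proof
  fix p assume "p \<in> R n t"
  then obtain A c where A: "p = (\<Sum>a\<in>A. const (c a) * mon n t a)" "\<forall>a\<in>A. v (c a) \<le> 1" unfolding R_def by blast
  show "p \<in> B 1" unfolding A(1) using A(2) mon_B[OF t] by (intro B_sum B_mult1 B_const) auto
qed

lemma B_submod_R: "(\<And>i. i < n \<Longrightarrow> t i \<in> B 1) \<Longrightarrow> 0 \<le> r \<Longrightarrow> submod (R n t) (B r)"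
  unfolding submod_def using B_0 B_add B_mult1(2) R_B by blast

text \<open>Modulo \<open>c\<close>, the integral elements are a finite module over the polynomials in \<open>t\<close>.\<close>

definition Fin :: "nat \<Rightarrow> (nat \<Rightarrow> 'k mser) \<Rightarrow> 'k mser set \<Rightarrow> 'k \<Rightarrow> bool" where
  "Fin n t U c \<longleftrightarrow> finite U \<and> U \<subseteq> B 1 \<and> (\<forall>i<n. t i \<in> B 1) \<and> c \<noteq> 0 \<and> v c < 1 \<and>
     (\<forall>y\<in>B 1. \<exists>s\<in>Sp (R n t) U. y - s \<in> B (v c))"

text \<open>Algebraic dependence of the reductions of the \<open>t i\<close> over the residue field
  of \<open>K\<close>, expressed without forming the reduction.\<close>

definition Rel :: "nat \<Rightarrow> (nat \<Rightarrow> 'k mser) \<Rightarrow> bool" where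
  "Rel n t \<longleftrightarrow> (\<exists>A c d. finite A \<and> A \<subseteq> Exp n \<and> (\<forall>a\<in>A. v (c a) \<le> 1) \<and> (\<exists>a\<in>A. v (c a) = 1) \<and>
     v d < 1 \<and> (\<Sum>a\<in>A. const (c a) * mon n t a) \<in> B (v d))"

lemma Fin_step:
  assumes F: "Fin n t U c" and y: "y \<in> B (v c ^ k)"
  obtains s where "s \<in> Sp (R n t) U" "y - const (c ^ k) * s \<in> B (v c ^ Suc k)"
proof -
  have c: "c \<noteq> 0" "c ^ k \<noteq> 0" using F by (auto simp: Fin_def)
  define y' where "y' = const (inverse (c ^ k)) * y"
  have y': "y = const (c ^ k) * y'"
    using const_inverse(1)[OF c(2)] by (simp add: y'_def mult.assoc[symmetric])
  have "y' \<in> B 1" using y B_divide[OF c(2), of y' 1] by (simp add: y' v_power)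
  then obtain s where s: "s \<in> Sp (R n t) U" "y' - s \<in> B (v c)" using F unfolding Fin_def by blast
  have "const (c ^ k) * (y' - s) \<in> B (v (c ^ k) * v c)" by (rule B_const_mult[OF s(2)])
  then have "y - const (c ^ k) * s \<in> B (v c ^ Suc k)" by (simp add: y' v_power algebra_simps)
  then show ?thesis using that s(1) by blast
qed

text \<open>The defect of an approximation modulo \<open>c ^ k\<close> is \<open>c ^ k\<close> times
  an integral element, which can be approximated in turn. Finiteness modulo \<open>c\<close> thus
  propagates to all powers of \<open>c\<close>.\<close>

lemma Fin_boost:
  assumes F: "Fin n t U c" and y: "y \<in> B 1"
  shows "\<exists>s\<in>Sp (R n t) U. y - s \<in> B (v c ^ k)"
proof (induction k)
  case 0
  have "0 \<in> Sp (R n t) U" using submodD(1)[OF Sp_submod[OF subrng_R]] .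
  then show ?case using y by force
next
  case (Suc k)
  then obtain s where s: "s \<in> Sp (R n t) U" "y - s \<in> B (v c ^ k)" by blast
  obtain s' where s': "s' \<in> Sp (R n t) U" "(y - s) - const (c ^ k) * s' \<in> B (v c ^ Suc k)"
    using Fin_step[OF F s(2)] .
  have "v (c ^ k) \<le> 1" using F nonneg by (simp add: v_power Fin_def power_le_one)
  then have "s + const (c ^ k) * s' \<in> Sp (R n t) U"
    using s(1) s'(1) by (intro submodD(2,3)[OF Sp_submod[OF subrng_R]] R_const)
  then show ?case using s'(2) by (metis diff_diff_eq)
qed

text \<open>The inverse of the last \<open>t k\<close> is integral over the polynomials; clearing denominators in an
  integral equation gives a small polynomial whose constant coefficient is a power of \<open>d\<close>.\<close>

lemma Fin_imp_Rel:
  assumes F: "Fin (Suc k) t U c"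
  shows "Rel (Suc k) t"
proof (rule ccontr)
  assume nr: "\<not> Rel (Suc k) t"
  define \<tau> where "\<tau> = t k"
  let ?R = "R (Suc k) t"
  have c: "c \<noteq> 0" "v c < 1" and tB: "\<And>i. i < Suc k \<Longrightarrow> t i \<in> B 1" and U: "finite U" "U \<subseteq> B 1"
    using F by (auto simp: Fin_def)
  have \<tau>B: "\<tau> \<in> B 1" and \<tau>R: "\<tau> \<in> ?R" by (simp_all add: \<tau>_def tB R_var)
  have "\<tau> \<notin> x"
  proof
    assume "\<tau> \<in> x"
    then have "\<tau> \<in> B (v c)" by (intro B_x nonneg)
    then have "Rel (Suc k) t" unfolding Rel_def
      using c by (intro exI[of _ "{Poly_Mapping.single k 1}"] exI[of _ "\<lambda>_. 1"] exI[of _ c])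
        (simp add: Exp_single mon_single \<tau>_def)
    then show False using nr by simp
  qed
  then obtain z where z: "z \<in> T N" "\<tau> * z - 1 \<in> x" using x_max \<tau>B B_T by blast
  obtain d where d: "d \<noteq> 0" "v d \<le> 1" "const d * z \<in> B 1" using absorb[OF z(1)] .
  \<comment> \<open>\<open>M\<close> is the exponent produced by the elimination over
    \<open>U - {1}\<close>. \<open>K\<close> is then chosen so that the error \<open>v c ^ K\<close>
    stays below the constant coefficient \<open>d ^ M\<close> of the resulting polynomial.\<close>
  define M :: nat where "M = 2 ^ card (U - {1})"
  have "0 < v d ^ M" using v_pos[OF d(1)] by simp
  then obtain K where K: "v c ^ K < v d ^ M" using real_arch_pow_inv[OF _ c(2)] by blast
  \<comment> \<open>With 1 among the generators, the elimination can end at this generator and shows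
    that \<open>p\<close> itself is small.\<close>
  let ?W = "insert 1 U" and ?E = "B (v c ^ K)"
  have W: "finite ?W" "?W \<subseteq> B 1" using U B_1 by auto
  have SpUW: "Sp ?R U \<subseteq> Sp ?R ?W"
    using W by (intro Sp_least Sp_submod subrng_R) (auto intro: Sp_gen[OF subrng_R])
  have "\<exists>r. (\<forall>u\<in>?W. r u \<in> ?R) \<and> const d * z * w - (\<Sum>u\<in>?W. r u * u) \<in> ?E" if w: "w \<in> ?W" for w
  proof -
    have "const d * z * w \<in> B 1" using B_mult1(1)[OF d(3)] w W by blast
    then obtain s where s: "s \<in> Sp ?R U" "const d * z * w - s \<in> ?E" using Fin_boost[OF F] by blast
    then have "s \<in> Sp ?R ?W" using SpUW by blast
    then obtain r where "s = (\<Sum>u\<in>?W. r u * u)" "\<forall>u\<in>?W. r u \<in> ?R" unfolding Sp_def by blast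
    then show ?thesis using s(2) by blast
  qed
  then have "\<forall>w\<in>?W. \<exists>r. (\<forall>u\<in>?W. r u \<in> ?R) \<and> const d * z * w - (\<Sum>u\<in>?W. r u * u) \<in> ?E" by blast
  from bchoice[OF this] obtain r
    where rr: "\<forall>w\<in>?W. (\<forall>u\<in>?W. r w u \<in> ?R) \<and> const d * z * w - (\<Sum>u\<in>?W. r w u * u) \<in> ?E" ..
  have r: "r w u \<in> ?R" if "w \<in> ?W" "u \<in> ?W" for w u using rr that by blast
  have r2: "const d * z * w - (\<Sum>u\<in>?W. r w u * u) \<in> ?E" if "w \<in> ?W" for w using rr that by blast
  define I where "I = (\<lambda>p. \<tau> * p) ` ?R"
  have I: "submod ?R I"
    unfolding submod_def
  proof (intro conjI ballI)
    have "0 = \<tau> * 0" by simp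
    then show "0 \<in> I" unfolding I_def using R_0 by blast
    fix f g assume "f \<in> I" "g \<in> I"
    then obtain p q where "f = \<tau> * p" "g = \<tau> * q" "p \<in> ?R" "q \<in> ?R" unfolding I_def by blast
    then have "f + g = \<tau> * (p + q)" "p + q \<in> ?R" by (auto simp: algebra_simps R_add)
    then show "f + g \<in> I" unfolding I_def by blast
  next
    fix s f assume s: "s \<in> ?R" and "f \<in> I"
    then obtain p where "f = \<tau> * p" "p \<in> ?R" unfolding I_def by blast
    then have "s * f = \<tau> * (s * p)" "s * p \<in> ?R" using s by (auto simp: algebra_simps R_mult)
    then show "s * f \<in> I" unfolding I_def by blast
  qed
  \<comment> \<open>Multiplying the expansion of \<open>const d * z * w\<close> by
    \<open>\<tau>\<close> and using that \<open>\<tau> * z\<close> is 1 modulo \<open>x\<close>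
    gives a linear system for the generators. Its matrix is congruent to \<open>const d\<close>
    times the identity modulo \<open>\<tau>\<close>.\<close>
  define q where "q w u = (if w = u then const d else 0) - \<tau> * r w u" for w u
  have E: "submod ?R ?E" by (rule B_submod_R[OF tB]) (auto simp: nonneg)
  have "\<exists>p\<in>?R. p - const d ^ (2 ^ card (U - {1})) \<in> I \<and> p * 1 \<in> ?E"
  proof (rule elimination[OF subrng_R I E, where u = "\<lambda>u. u" and q = q and J = "U - {1}" and j = 1])
    show "finite (U - {1})" using U by simp
    show "1 \<notin> U - {1}" by simp
    show "const d \<in> ?R" by (rule R_const[OF d(2)])
    have W': "insert 1 (U - {1}) = ?W" by auto
    have rI: "- (\<tau> * r i j) \<in> I" if "i \<in> ?W" "j \<in> ?W" for i j
      by (rule submod_uminus[OF subrng_R I]) (use r[OF that] in \<open>simp add: I_def\<close>)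
    fix i assume "i \<in> insert 1 (U - {1})"
    then have i: "i \<in> ?W" using W' by blast
    show "q i j \<in> ?R" if "j \<in> insert 1 (U - {1})" for j
    proof -
      have "j \<in> ?W" using that W' by blast
      then have "\<tau> * r i j \<in> ?R" by (intro R_mult \<tau>R r i)
      moreover have "(if i = j then const d else 0) \<in> ?R" using R_const[OF d(2)] R_0 by simp
      ultimately show ?thesis unfolding q_def by (rule subrngD(4)[OF subrng_R, rotated])
    qed
    show "q i i - const d \<in> I" using rI[OF i i] by (simp add: q_def)
    show "q i j \<in> I" if "j \<in> insert 1 (U - {1})" "i \<noteq> j" for j
      using rI[OF i, of j] that by (auto simp: q_def)
    have "(\<Sum>j\<in>?W. q i j * j) = (\<Sum>j\<in>?W. (if i = j then const d * j else 0)) - \<tau> * (\<Sum>j\<in>?W. r i j * j)"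
      unfolding q_def sum_distrib_left sum_subtractf[symmetric] by (rule sum.cong) (auto simp: algebra_simps)
    also have "\<dots> = const d * i - \<tau> * (\<Sum>j\<in>?W. r i j * j)" using W i by simp
    also have "\<dots> = \<tau> * (const d * z * i - (\<Sum>j\<in>?W. r i j * j)) - (const d * i) * (\<tau> * z - 1)"
      by (simp add: algebra_simps)
    also have "\<dots> \<in> ?E"
    proof (rule B_diff)
      show "\<tau> * (const d * z * i - (\<Sum>j\<in>?W. r i j * j)) \<in> ?E" using B_mult1(2)[OF \<tau>B r2[OF i]] .
      have "const d * i \<in> T N" using i W B_T by (intro T_mult T_const) blast
      then show "(const d * i) * (\<tau> * z - 1) \<in> ?E" using z(2) nonneg by (intro B_x submodD(3)[OF x_sub]) auto
    qed
    finally show "(\<Sum>j\<in>insert 1 (U - {1}). q i j * j) \<in> ?E" unfolding W' .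
  qed
  then obtain p where p: "p - const (d ^ M) \<in> I" "p \<in> ?E" unfolding M_def const_power by auto
  then obtain g where g: "g \<in> ?R" "p - const (d ^ M) = \<tau> * g" unfolding I_def by blast
  then obtain A e where A: "g = (\<Sum>a\<in>A. const (e a) * mon (Suc k) t a)" "finite A" "A \<subseteq> Exp (Suc k)" unfolding R_def by blast
  define \<iota> where "\<iota> = Poly_Mapping.single k (1::nat)"
  \<comment> \<open>Multiplication by \<open>\<tau>\<close> shifts every exponent of
    \<open>g\<close> by \<open>\<iota>\<close>, so none of its terms can cancel the constant term
    \<open>d ^ M\<close>.\<close>
  define A' where "A' = insert 0 ((\<lambda>a. a + \<iota>) ` A)"
  define e' where "e' a = (if a = 0 then d ^ M else e (a - \<iota>))" for a
  have \<iota>0: "a + \<iota> \<noteq> 0" for a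
  proof
    assume "a + \<iota> = 0"
    then have "Poly_Mapping.lookup (a + \<iota>) k = 0" by simp
    then show False by (simp add: lookup_add \<iota>_def)
  qed
  have A': "finite A'" "A' \<subseteq> Exp (Suc k)" using A(2,3) by (auto simp: A'_def \<iota>_def intro!: Exp_add Exp_single)
  have m\<iota>: "mon (Suc k) t \<iota> = \<tau>" by (simp add: \<iota>_def mon_single \<tau>_def)
  have "(\<Sum>a\<in>A'. const (e' a) * mon (Suc k) t a) = const (d ^ M) + (\<Sum>a\<in>A. const (e a) * mon (Suc k) t (a + \<iota>))"
    unfolding A'_def using A(2) \<iota>0
    by (subst sum.insert) (auto simp: e'_def sum.reindex inj_on_def)
  also have "\<dots> = const (d ^ M) + \<tau> * g"
    unfolding A(1) by (simp add: sum_distrib_left mon_add m\<iota> algebra_simps)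
  also have "\<dots> = p" using g(2) by (simp add: algebra_simps)
  finally have p': "(\<Sum>a\<in>A'. const (e' a) * mon (Suc k) t a) = p" .
  \<comment> \<open>Dividing by a coefficient of greatest absolute value makes some coefficient have
    absolute value 1. As \<open>v b\<close> is at least \<open>v d ^ M\<close>, the value of the
    polynomial remains in a ball of radius less than 1.\<close>
  obtain b where b: "b \<in> e' ` A'" "\<And>f. f \<in> e' ` A' \<Longrightarrow> v f \<le> v b"
    using max_v[of "e' ` A'"] A'(1) by (auto simp: A'_def)
  have "d ^ M \<in> e' ` A'" by (auto simp: A'_def e'_def image_iff)
  then have db: "v d ^ M \<le> v b" using b(2) by (metis v_power)
  then have b0: "0 < v b" using \<open>0 < v d ^ M\<close> by linarith
  then have bn: "b \<noteq> 0" by auto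
  have "Rel (Suc k) t" unfolding Rel_def
  proof (intro exI conjI)
    show "finite A'" "A' \<subseteq> Exp (Suc k)" by (rule A')+
    show "\<forall>a\<in>A'. v (e' a / b) \<le> 1" using b(2) b0 by (auto simp: v_divide)
    obtain a where "a \<in> A'" "b = e' a" using b(1) by blast
    then show "\<exists>a\<in>A'. v (e' a / b) = 1" using bn by (intro bexI[of _ a]) auto
    show "v (c ^ K / b) < 1" using K db b0 by (simp add: v_divide v_power)
    have "(\<Sum>a\<in>A'. const (e' a / b) * mon (Suc k) t a) = const (inverse b) * p"
      unfolding p'[symmetric] sum_distrib_left
      by (rule sum.cong) (auto simp: divide_inverse const_mult algebra_simps)
    moreover have "const (inverse b) * p \<in> B (v (inverse b) * v c ^ K)" by (rule B_const_mult[OF p(2)])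
    moreover have "v (inverse b) * v c ^ K = v (c ^ K / b)"
      by (simp add: mult v_power divide_inverse)
    ultimately show "(\<Sum>a\<in>A'. const (e' a / b) * mon (Suc k) t a) \<in> B (v (c ^ K / b))" by simp
  qed
  then show False using nr by simp
qed

end

context max_ideal
begin

text \<open>Noether normalisation: for \<open>b\<close> larger than all exponents, replacing \<open>t i\<close> by
  \<open>t i - t k ^ (b ^ Suc i)\<close> gives the monomials of the relation distinct degrees in \<open>t k\<close>, so that the
  relation becomes a monic equation for \<open>t k\<close>.\<close>

lemma Fin_Rel_reduce:
  assumes F: "Fin (Suc k) t U c" and Rl: "Rel (Suc k) t"
  shows "\<exists>t' U' c'. Fin k t' U' c'"
proof -
  define \<tau> where "\<tau> = t k"
  have c: "c \<noteq> 0" "v c < 1" and tB: "\<And>i. i < Suc k \<Longrightarrow> t i \<in> B 1" and U: "finite U" "U \<subseteq> B 1"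
    and FU: "\<And>y. y \<in> B 1 \<Longrightarrow> \<exists>s\<in>Sp (R (Suc k) t) U. y - s \<in> B (v c)"
    using F by (auto simp: Fin_def)
  obtain A e d where A: "finite A" "A \<subseteq> Exp (Suc k)" "\<forall>a\<in>A. v (e a) \<le> 1" "\<exists>a\<in>A. v (e a) = 1"
    and d: "v d < 1" "(\<Sum>a\<in>A. const (e a) * mon (Suc k) t a) \<in> B (v d)" using Rl unfolding Rel_def by blast
  define A1 where "A1 = {a\<in>A. v (e a) = 1}"
  have A1: "finite A1" "A1 \<noteq> {}" "A1 \<subseteq> A" using A by (auto simp: A1_def)
  \<comment> \<open>One constant absorbs the old \<open>c\<close>, the size of the relation, and all
    coefficients of absolute value less than 1; modulo \<open>d'\<close> only the coefficients of
    absolute value 1 survive.\<close>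
  obtain d' where d': "d' \<in> insert d (insert c (e ` (A - A1)))" "\<And>f. f \<in> insert d (insert c (e ` (A - A1))) \<Longrightarrow> v f \<le> v d'"
    using max_v[of "insert d (insert c (e ` (A - A1)))"] A(1) by blast
  have "v f < 1" if "f \<in> insert d (insert c (e ` (A - A1)))" for f
    using that c(2) d(1) A(3) by (force simp: A1_def order.strict_iff_order)
  then have d'1: "v d' < 1" using d'(1) by blast
  have cd': "v c \<le> v d'" and dd': "v d \<le> v d'" using d'(2) by blast+
  have d'0: "d' \<noteq> 0" using v_pos[OF c(1)] cd' by auto
  let ?E = "B (v d')"
  have E0: "0 \<le> v d'" by (rule nonneg)

  define b where "b = Suc (\<Sum>a\<in>A. \<Sum>i\<le>k. Poly_Mapping.lookup a i)"
  have lb: "Poly_Mapping.lookup a i < b" if "a \<in> A" "i \<le> k" for a i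
  proof -
    have "Poly_Mapping.lookup a i \<le> (\<Sum>i\<le>k. Poly_Mapping.lookup a i)" using that by (intro member_le_sum) auto
    also have "\<dots> \<le> (\<Sum>a\<in>A. \<Sum>i\<le>k. Poly_Mapping.lookup a i)" using that A(1) by (intro member_le_sum[of a A "\<lambda>a. \<Sum>i\<le>k. Poly_Mapping.lookup a i"]) auto
    finally show ?thesis by (simp add: b_def)
  qed
  define t' where "t' i = t i - \<tau> ^ (b ^ Suc i)" for i
  \<comment> \<open>The degree in \<open>\<tau>\<close> of the monomial \<open>a\<close> after each
    \<open>t i\<close> is written as \<open>t' i + \<tau> ^ (b ^ Suc i)\<close>.\<close>
  define wt where "wt a = (\<Sum>i<k. b ^ Suc i * Poly_Mapping.lookup a i) + Poly_Mapping.lookup a k" for a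
  have \<tau>B: "\<tau> \<in> B 1" using tB by (simp add: \<tau>_def)
  have t'B: "\<And>i. i < k \<Longrightarrow> t' i \<in> B 1" using tB by (auto simp: t'_def intro!: B_diff B_power \<tau>B)
  let ?R = "R k t'"
  note RR = subrngD[OF subrng_R]
  have E: "submod ?R ?E" by (rule B_submod_R[OF t'B E0])

  have wt_inj: "inj_on wt A"
  proof (rule inj_onI)
    fix a a' assume a: "a \<in> A" "a' \<in> A" "wt a = wt a'"
    \<comment> \<open>Read in base \<open>b\<close>, the weight has the exponent of
      \<open>t k\<close> as digit 0 and the exponent of \<open>t i\<close> as digit
      \<open>Suc i\<close>.\<close>
    define f where "f a i = Poly_Mapping.lookup a (case i of 0 \<Rightarrow> k | Suc j \<Rightarrow> j)" for a :: "nat \<Rightarrow>\<^sub>0 nat" and i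
    have w: "wt a = (\<Sum>i<Suc k. b ^ i * f a i)" for a
      by (subst sum.lessThan_Suc_shift) (simp add: wt_def f_def)
    have "\<forall>i<Suc k. f a i < b \<and> f a' i < b" using lb a by (auto simp: f_def split: nat.split)
    then have *: "\<forall>i<Suc k. f a i = f a' i" by (rule base_expansion_inj) (use a(3) w in simp)
    show "a = a'"
    proof (rule poly_mapping_eqI)
      fix i
      show "Poly_Mapping.lookup a i = Poly_Mapping.lookup a' i"
      proof (cases "i < Suc k")
        case True
        then consider "i = k" | "i < k" by linarith
        then show ?thesis
        proof cases
          case 1 then show ?thesis using *[rule_format, of 0] by (simp add: f_def)
        next
          case 2 then show ?thesis using *[rule_format, of "Suc i"] by (simp add: f_def)
        qed
      next
        case False
        then have "Poly_Mapping.lookup a'' i = 0" if "a'' \<in> A" for a''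
          using that A(2) by (force simp: Exp_def in_keys_iff)
        then show ?thesis using a(1,2) by simp
      qed
    qed
  qed

  \<comment> \<open>The polynomial expressions in \<open>\<tau>\<close> of degree less than
    \<open>D\<close> with coefficients in the ring generated by \<open>t'\<close>.\<close>
  define W where "W D = Sp ?R ((\<lambda>j. \<tau> ^ j) ` {..<D})" for D
  have Wm: "submod ?R (W D)" for D unfolding W_def by (rule Sp_submod[OF subrng_R])
  have Wg: "\<tau> ^ j \<in> W D" if "j < D" for j D unfolding W_def using that by (intro Sp_gen[OF subrng_R]) auto
  have Wl: "W D \<subseteq> E'" if "submod ?R E'" "\<And>j. j < D \<Longrightarrow> \<tau> ^ j \<in> E'" for D E'
    unfolding W_def using that by (intro Sp_least) auto
  have Wmono: "W D \<subseteq> W D'" if "D \<le> D'" for D D'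
  proof (rule Wl[OF Wm])
    show "\<tau> ^ j \<in> W D'" if "j < D" for j using that \<open>D \<le> D'\<close> by (intro Wg) simp
  qed
  have pull: "submod ?R {w. w * f \<in> E'}" if "submod ?R E'" for f E'
    unfolding submod_def using submodD[OF that] by (auto simp: algebra_simps)
  have Wshift: "w * \<tau> ^ j \<in> W (D + j)" if "w \<in> W D" for w D j
  proof -
    have "W D \<subseteq> {w. w * \<tau> ^ j \<in> W (D + j)}"
    proof (rule Wl[OF pull[OF Wm]])
      show "\<tau> ^ i \<in> {w. w * \<tau> ^ j \<in> W (D + j)}" if "i < D" for i
        using Wg[of "i + j" "D + j"] that by (simp add: power_add)
    qed
    then show ?thesis using that by blast
  qed
  have Wmult: "w * w' \<in> W (D + D')" if "w \<in> W D" "w' \<in> W D'" for w w' D D'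
  proof -
    have "W D \<subseteq> {w. w * w' \<in> W (D + D')}"
    proof (rule Wl[OF pull[OF Wm]])
      show "\<tau> ^ i \<in> {w. w * w' \<in> W (D + D')}" if "i < D" for i
        using Wshift[OF \<open>w' \<in> W D'\<close>, of i] Wmono[of "D' + i" "D + D'"] that by (auto simp: mult.commute)
    qed
    then show ?thesis using that by blast
  qed
  \<comment> \<open>Monic of degree \<open>D\<close> in \<open>\<tau>\<close>. Degrees add under
    multiplication, so every monomial in \<open>t\<close> is monic of degree
    \<open>wt a\<close>.\<close>
  define mc where "mc D f \<longleftrightarrow> f - \<tau> ^ D \<in> W D" for D f
  have mc_mult: "mc (D + D') (f * g)" if "mc D f" "mc D' g" for D D' f g
  proof -
    have "(f - \<tau> ^ D) * (g - \<tau> ^ D') \<in> W (D + D')" using that unfolding mc_def by (intro Wmult)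
    moreover have "(f - \<tau> ^ D) * \<tau> ^ D' \<in> W (D + D')" using that unfolding mc_def by (intro Wshift)
    moreover have "(g - \<tau> ^ D') * \<tau> ^ D \<in> W (D + D')" using that Wshift[of "g - \<tau> ^ D'" D' D] unfolding mc_def by (simp add: add.commute)
    ultimately have "(f - \<tau> ^ D) * (g - \<tau> ^ D') + (f - \<tau> ^ D) * \<tau> ^ D' + (g - \<tau> ^ D') * \<tau> ^ D \<in> W (D + D')"
      by (intro submodD(2)[OF Wm])
    then show ?thesis unfolding mc_def by (simp add: algebra_simps power_add)
  qed
  have mc_1: "mc 0 1" unfolding mc_def using submodD(1)[OF Wm] by simp
  have mc_power: "mc (D * n) (f ^ n)" if "mc D f" for D f n
    by (induction n) (use mc_1 mc_mult[OF that] in auto)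
  have mc_t: "mc (b ^ Suc i) (t i)" if "i < k" for i
  proof -
    have "0 < b ^ Suc i" by (simp add: b_def)
    then have "t' i * \<tau> ^ 0 \<in> W (b ^ Suc i)" by (intro submodD(3)[OF Wm] Wg R_var that)
    then show ?thesis by (simp add: mc_def t'_def)
  qed
  have mc_\<tau>: "mc n (\<tau> ^ n)" for n unfolding mc_def using submodD(1)[OF Wm] by simp
  have mc_mon: "mc (wt a) (mon (Suc k) t a)" for a
  proof -
    have "mc (\<Sum>i<l. b ^ Suc i * Poly_Mapping.lookup a i) (\<Prod>i<l. t i ^ Poly_Mapping.lookup a i)" if "l \<le> k" for l
      using that
    proof (induction l)
      case (Suc l)
      then show ?case using mc_mult[OF _ mc_power[OF mc_t[of l]]] by simp
    qed (simp add: mc_1)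
    from mc_mult[OF this[OF order_refl] mc_\<tau>[of "Poly_Mapping.lookup a k"]]
    show ?thesis by (simp add: wt_def mon_def \<tau>_def)
  qed

  have "Max (wt ` A1) \<in> wt ` A1" using A1 by (intro Max_in) auto
  then obtain a0 where a0: "a0 \<in> A1" "Max (wt ` A1) = wt a0" by blast
  define D where "D = wt a0"
  have wtD: "wt a < D" if "a \<in> A1 - {a0}" for a
  proof -
    have "wt a \<le> D" using that A1(1) unfolding D_def a0(2)[symmetric] by (intro Max_ge) auto
    moreover have "wt a \<noteq> D" using inj_onD[OF wt_inj, of a a0] that a0(1) A1(3) by (auto simp: D_def)
    ultimately show ?thesis by simp
  qed
  have low: "mon (Suc k) t a \<in> W D" if "a \<in> A1 - {a0}" for a
  proof -
    have "(mon (Suc k) t a - \<tau> ^ wt a) + \<tau> ^ wt a \<in> W D"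
      using mc_mon[of a] Wmono[of "wt a" D] wtD[OF that] unfolding mc_def by (intro submodD(2)[OF Wm] Wg) auto
    then show ?thesis by simp
  qed
  define V where "V = {y. \<exists>w\<in>W D. y - w \<in> ?E}"
  have ext: "submod ?R {y. \<exists>s\<in>M. y - s \<in> ?E}" if M: "submod ?R M" for M
    unfolding submod_def
  proof (intro conjI ballI)
    show "0 \<in> {y. \<exists>s\<in>M. y - s \<in> ?E}" using submodD(1)[OF M] B_0[OF E0] by force
    fix f g assume "f \<in> {y. \<exists>s\<in>M. y - s \<in> ?E}" "g \<in> {y. \<exists>s\<in>M. y - s \<in> ?E}"
    then obtain s s' where s: "s \<in> M" "f - s \<in> ?E" "s' \<in> M" "g - s' \<in> ?E" by blast
    then have "(f + g) - (s + s') \<in> ?E" using B_add[OF s(2,4)] by (simp add: algebra_simps)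
    then show "f + g \<in> {y. \<exists>s\<in>M. y - s \<in> ?E}" using submodD(2)[OF M s(1,3)] by blast
  next
    fix p f assume p: "p \<in> ?R" and "f \<in> {y. \<exists>s\<in>M. y - s \<in> ?E}"
    then obtain s where s: "s \<in> M" "f - s \<in> ?E" by blast
    then have "p * f - p * s \<in> ?E" using submodD(3)[OF E p s(2)] by (simp add: algebra_simps)
    then show "p * f \<in> {y. \<exists>s\<in>M. y - s \<in> ?E}" using submodD(3)[OF M p s(1)] by blast
  qed
  have V: "submod ?R V" unfolding V_def by (rule ext[OF Wm])
  have WV: "W D \<subseteq> V" unfolding V_def using B_0[OF E0] by force
  have EV: "?E \<subseteq> V" unfolding V_def using submodD(1)[OF Wm] by force

  \<comment> \<open>Among the monomials with coefficient of absolute value 1 only \<open>a0\<close>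
    reaches the weight \<open>D\<close>. Dividing the relation by its coefficient expresses
    \<open>\<tau> ^ D\<close> through lower powers of \<open>\<tau>\<close>, modulo the
    ball.\<close>
  have "\<tau> ^ D \<in> V"
  proof -
    have u: "v (e a0) = 1" using a0(1) by (simp add: A1_def)
    then have e0: "e a0 \<noteq> 0" by auto
    have "(\<Sum>a\<in>A - A1. const (e a) * mon (Suc k) t a) \<in> ?E"
      using d'(2) mon_B[OF tB] by (intro B_sum E0 B_mult1 B_const) auto
    then have "(\<Sum>a\<in>A. const (e a) * mon (Suc k) t a) - (\<Sum>a\<in>A - A1. const (e a) * mon (Suc k) t a) \<in> ?E"
      using d(2) B_mono[OF dd'] by (intro B_diff) auto
    moreover have "(\<Sum>a\<in>A. const (e a) * mon (Suc k) t a) =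
        (\<Sum>a\<in>A - A1. const (e a) * mon (Suc k) t a) + (\<Sum>a\<in>A1. const (e a) * mon (Suc k) t a)"
      by (rule sum.subset_diff[OF A1(3) A(1)])
    ultimately have "(\<Sum>a\<in>A1. const (e a) * mon (Suc k) t a) \<in> ?E" by simp
    moreover have "(\<Sum>a\<in>A1. const (e a) * mon (Suc k) t a) =
        const (e a0) * mon (Suc k) t a0 + (\<Sum>a\<in>A1 - {a0}. const (e a) * mon (Suc k) t a)"
      by (rule sum.remove[OF A1(1) a0(1)])
    moreover define w where "w = const (e a0) * (mon (Suc k) t a0 - \<tau> ^ D) + (\<Sum>a\<in>A1 - {a0}. const (e a) * mon (Suc k) t a)"
    ultimately have "const (e a0) * \<tau> ^ D + w \<in> ?E" by (simp add: algebra_simps)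
    moreover have wW: "w \<in> W D"
      unfolding w_def
    proof (intro submodD(2)[OF Wm] submodD(3)[OF Wm] submod_sum[OF Wm] R_const)
      show "mon (Suc k) t a0 - \<tau> ^ D \<in> W D" using mc_mon[of a0] by (simp add: mc_def D_def)
    qed (use A(3) A1(3) u low in auto)
    ultimately have "const (e a0) * \<tau> ^ D + w \<in> V" "w \<in> V" using EV WV by blast+
    then have "(const (e a0) * \<tau> ^ D + w) - w \<in> V" by (rule submod_diff[OF subrng_R V])
    then have "const (e a0) * \<tau> ^ D \<in> V" by simp
    moreover have cR: "const (inverse (e a0)) \<in> ?R" using u by (intro R_const) (simp add: v_inverse)
    ultimately have "const (inverse (e a0)) * (const (e a0) * \<tau> ^ D) \<in> V" using submodD(3)[OF V cR] by blast
    then show ?thesis using const_inverse(2)[OF e0] by (simp add: mult.assoc[symmetric])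
  qed
  then have WSucV: "W (Suc D) \<subseteq> V"
    using WV Wg by (intro Wl[OF V]) (auto simp: less_Suc_eq)
  \<comment> \<open>The monic equation makes \<open>V\<close> stable under \<open>\<tau>\<close>,
    hence under every \<open>t i\<close>. As \<open>V\<close> contains 1, it contains all polynomial
    expressions in the old variables.\<close>
  have \<tau>V: "\<tau> * y \<in> V" if y: "y \<in> V" for y
  proof -
    obtain w where w: "w \<in> W D" "y - w \<in> ?E" using y unfolding V_def by blast
    have "\<tau> * (y - w) \<in> ?E" using B_mult1(2)[OF \<tau>B w(2)] .
    moreover have "w * \<tau> ^ 1 \<in> W (Suc D)" using Wshift[OF w(1), of 1] by simp
    ultimately have "\<tau> * (y - w) + w * \<tau> ^ 1 \<in> V" using WSucV EV by (intro submodD(2)[OF V]) auto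
    then show ?thesis by (simp add: algebra_simps)
  qed
  have \<tau>nV: "\<tau> ^ n * y \<in> V" if y: "y \<in> V" for n y
    by (induction n) (use y \<tau>V in \<open>auto simp: mult.assoc\<close>)
  have tV: "t i * y \<in> V" if y: "y \<in> V" "i < Suc k" for i y
  proof (cases "i = k")
    case True then show ?thesis using \<tau>V[OF y(1)] by (simp add: \<tau>_def)
  next
    case False
    then have "t' i \<in> ?R" using y(2) by (intro R_var) simp
    then have "t' i * y + \<tau> ^ (b ^ Suc i) * y \<in> V" by (intro submodD(2,3)[OF V] y \<tau>nV)
    then show ?thesis by (simp add: t'_def algebra_simps)
  qed
  have tnV: "t i ^ n * y \<in> V" if y: "y \<in> V" "i < Suc k" for i n y
    by (induction n) (use y tV in \<open>auto simp: mult.assoc\<close>)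
  have one: "1 \<in> V" using Wg[of 0 "Suc D"] WSucV by auto
  have "(\<Prod>i<l. t i ^ Poly_Mapping.lookup a i) \<in> V" if "l \<le> Suc k" for a l
    using that
  proof (induction l)
    case (Suc l)
    then show ?case using tnV[of "\<Prod>i<l. t i ^ Poly_Mapping.lookup a i" l "Poly_Mapping.lookup a l"] by (simp add: mult.commute)
  qed (simp add: one)
  from this[of "Suc k"] have monV: "mon (Suc k) t a \<in> V" for a unfolding mon_def by blast
  have RV: "R (Suc k) t \<subseteq> V"
  proof
    fix p assume "p \<in> R (Suc k) t"
    then obtain A c where p: "p = (\<Sum>a\<in>A. const (c a) * mon (Suc k) t a)" "\<forall>a\<in>A. v (c a) \<le> 1" unfolding R_def by blast
    show "p \<in> V" unfolding p(1) using p(2) by (intro submod_sum[OF V] submodD(3)[OF V] R_const monV) auto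
  qed

  \<comment> \<open>Transitivity of finiteness: the powers of \<open>\<tau>\<close> below
    \<open>D\<close> generate the old coefficient ring over the new one modulo the ball, and are
    multiplied by the old generators.\<close>
  define U' where "U' = (\<lambda>(j, u). \<tau> ^ j * u) ` ({..<D} \<times> U)"
  define V' where "V' = {y. \<exists>s\<in>Sp ?R U'. y - s \<in> ?E}"
  have fU': "finite U'" using U by (simp add: U'_def)
  have V': "submod ?R V'" unfolding V'_def by (rule ext[OF Sp_submod[OF subrng_R]])
  have EV': "?E \<subseteq> V'" unfolding V'_def using submodD(1)[OF Sp_submod[OF subrng_R]] by force
  have prodV': "r * u \<in> V'" if r: "r \<in> V" and u: "u \<in> U" for r u
  proof -
    obtain w where w: "w \<in> W D" "r - w \<in> ?E" using r unfolding V_def by blast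
    have "W D \<subseteq> {w. w * u \<in> Sp ?R U'}"
    proof (rule Wl[OF pull[OF Sp_submod[OF subrng_R]]])
      fix j assume "j < D"
      then have "\<tau> ^ j * u \<in> U'" using u by (auto simp: U'_def)
      then show "\<tau> ^ j \<in> {w. w * u \<in> Sp ?R U'}" using Sp_gen[OF subrng_R fU'] by simp
    qed
    then have "w * u \<in> Sp ?R U'" using w(1) by blast
    moreover have "r * u - w * u \<in> ?E" using B_mult1(1)[OF w(2), of u] u U by (auto simp: algebra_simps)
    ultimately show ?thesis unfolding V'_def by blast
  qed
  have "Fin k t' U' d'"
    unfolding Fin_def
  proof (intro conjI ballI)
    show "finite U'" by (rule fU')
    show "U' \<subseteq> B 1" using U by (auto simp: U'_def intro!: B_mult1 B_power \<tau>B)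
    show "\<forall>i<k. t' i \<in> B 1" using t'B by blast
    show "d' \<noteq> 0" "v d' < 1" by (rule d'0, rule d'1)
    fix y assume "y \<in> B 1"
    then obtain s where s: "s \<in> Sp (R (Suc k) t) U" "y - s \<in> B (v c)" using FU by blast
    then obtain r where r: "s = (\<Sum>u\<in>U. r u * u)" "\<forall>u\<in>U. r u \<in> R (Suc k) t" unfolding Sp_def by blast
    have "s \<in> V'" unfolding r(1) using r(2) RV by (intro submod_sum[OF V'] prodV') auto
    then have "(y - s) + s \<in> V'" using s(2) B_mono[OF cd'] EV' by (intro submodD(2)[OF V']) auto
    then show "\<exists>s\<in>Sp ?R U'. y - s \<in> ?E" by (simp add: V'_def)
  qed
  then show ?thesis by blast
qed

section \<open>Finite dimension of the residue field over \<open>K\<close>\<close>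

definition spans :: "'k mser set \<Rightarrow> bool" where
  "spans U \<longleftrightarrow> finite U \<and> U \<subseteq> T N \<and> (\<forall>y\<in>T N. \<exists>s. y - (\<Sum>u\<in>U. const (s u) * u) \<in> x)"

text \<open>Without variables the coefficients are constants of \<open>K\<close>. The successive
  approximations therefore have convergent coefficients, and the limit is exact because
  \<open>x\<close> is closed (\<open>B_inter\<close>).\<close>

lemma Fin_0_spans: assumes F: "Fin 0 t U c" shows "spans U"
proof -
  have c: "c \<noteq> 0" "v c < 1" and U: "finite U" "U \<subseteq> B 1" using F by (auto simp: Fin_def)
  have R0: "\<exists>e. v e \<le> 1 \<and> p = const e" if p0: "p \<in> R 0 t" for p
  proof -
    obtain A e where p: "p = (\<Sum>a\<in>A. const (e a) * mon 0 t a)" "\<forall>a\<in>A. v (e a) \<le> 1" using p0 unfolding R_def by blast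
    have "p = const (\<Sum>a\<in>A. e a)" unfolding p(1) const_sum by (simp add: mon_def)
    moreover have "v (\<Sum>a\<in>A. e a) \<le> 1" using p(2) by (intro v_sum_le) auto
    ultimately show ?thesis by blast
  qed
  have B1: "\<exists>s. y - (\<Sum>u\<in>U. const (s u) * u) \<in> x" if y: "y \<in> B 1" for y
  proof -
    define P where "P k s \<longleftrightarrow> y - (\<Sum>u\<in>U. const (s u) * u) \<in> B (v c ^ k)" for k s
    have "\<exists>f. \<forall>k. P k (f k) \<and> (\<forall>u\<in>U. v (f (Suc k) u - f k u) \<le> v c ^ k)"
    proof (rule dependent_nat_choice)
      show "\<exists>s. P 0 s" unfolding P_def using y by (intro exI[of _ "\<lambda>_. 0"]) simp
      fix s k assume s: "P k s"
      then have "y - (\<Sum>u\<in>U. const (s u) * u) \<in> B (v c ^ k)" by (simp add: P_def)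
      then obtain s' where s': "s' \<in> Sp (R 0 t) U"
          "(y - (\<Sum>u\<in>U. const (s u) * u)) - const (c ^ k) * s' \<in> B (v c ^ Suc k)" by (rule Fin_step[OF F])
      then obtain r where r: "s' = (\<Sum>u\<in>U. r u * u)" "\<forall>u\<in>U. r u \<in> R 0 t" unfolding Sp_def by blast
      then have "\<forall>u\<in>U. \<exists>e. v e \<le> 1 \<and> r u = const e" using R0 by blast
      from bchoice[OF this] obtain e where e: "\<forall>u\<in>U. v (e u) \<le> 1 \<and> r u = const (e u)" ..
      have "s' = (\<Sum>u\<in>U. const (e u) * u)" unfolding r(1) using e by (intro sum.cong) auto
      then have "(\<Sum>u\<in>U. const (s u) * u) + const (c ^ k) * s' = (\<Sum>u\<in>U. const (s u + c ^ k * e u) * u)"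
        by (simp add: sum_distrib_left sum.distrib const_mult algebra_simps)
      then have "P (Suc k) (\<lambda>u. s u + c ^ k * e u)" unfolding P_def using s'(2) by (simp add: diff_diff_eq)
      moreover have "\<forall>u\<in>U. v ((s u + c ^ k * e u) - s u) \<le> v c ^ k"
        using e by (auto simp: mult v_power nonneg intro!: mult_left_le)
      ultimately show "\<exists>s'. P (Suc k) s' \<and> (\<forall>u\<in>U. v (s' u - s u) \<le> v c ^ k)" by blast
    qed
    then obtain f where f: "\<And>k. P k (f k)" "\<And>k u. u \<in> U \<Longrightarrow> v (f (Suc k) u - f k u) \<le> v c ^ k" by blast
    have "\<exists>l. \<forall>k. v (f k u - l) \<le> v c ^ k" if "u \<in> U" for u
      using v_geometric_limit[OF nonneg c(2), of "\<lambda>k. f k u"] f(2)[OF that] by metis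
    then have "\<forall>u\<in>U. \<exists>l. \<forall>k. v (f k u - l) \<le> v c ^ k" by blast
    from bchoice[OF this] obtain l where l: "\<forall>u\<in>U. \<forall>k. v (f k u - l u) \<le> v c ^ k" ..
    have "y - (\<Sum>u\<in>U. const (l u) * u) \<in> B (v c ^ k)" for k
    proof -
      have "(\<Sum>u\<in>U. const (f k u - l u) * u) \<in> B (v c ^ k)"
        using l U nonneg by (intro B_sum B_mult1 B_const) auto
      moreover have "y - (\<Sum>u\<in>U. const (f k u) * u) \<in> B (v c ^ k)" using f(1) by (simp add: P_def)
      ultimately have "(y - (\<Sum>u\<in>U. const (f k u) * u)) + (\<Sum>u\<in>U. const (f k u - l u) * u) \<in> B (v c ^ k)" by (intro B_add)
      then show ?thesis by (simp add: algebra_simps sum_subtractf)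
    qed
    moreover have "y - (\<Sum>u\<in>U. const (l u) * u) \<in> T N"
      using y U B_T by (intro T_diff T_sum T_mult T_const) auto
    ultimately have "y - (\<Sum>u\<in>U. const (l u) * u) \<in> x" using B_inter c by blast
    then show ?thesis by (rule exI[of _ l])
  qed
  have "\<exists>s. y - (\<Sum>u\<in>U. const (s u) * u) \<in> x" if y: "y \<in> T N" for y
  proof -
    obtain d where d: "d \<noteq> 0" "const d * y \<in> B 1" using absorb[OF y] by metis
    obtain s where "const d * y - (\<Sum>u\<in>U. const (s u) * u) \<in> x" using B1[OF d(2)] by blast
    then have "const (inverse d) * (const d * y - (\<Sum>u\<in>U. const (s u) * u)) \<in> x"
      by (rule submodD(3)[OF x_sub T_const])
    moreover have "const (inverse d) * (const d * y - (\<Sum>u\<in>U. const (s u) * u)) = y - (\<Sum>u\<in>U. const (inverse d * s u) * u)"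
      using const_inverse(2)[OF d(1)] by (simp add: right_diff_distrib mult.assoc[symmetric] const_mult sum_distrib_left)
    ultimately have "y - (\<Sum>u\<in>U. const (inverse d * s u) * u) \<in> x" by simp
    then show ?thesis by (rule exI[of _ "\<lambda>u. inverse d * s u"])
  qed
  then show ?thesis unfolding spans_def using U B_T by blast
qed

text \<open>A positive number of variables always produces a relation, and a relation removes one
  variable, so the descent only stops when no variable is left.\<close>

lemma Fin_spans: "Fin n t U c \<Longrightarrow> \<exists>U. spans U"
proof (induction n arbitrary: t U c)
  case 0
  then show ?case using Fin_0_spans by blast
next
  case (Suc n)
  then show ?case using Fin_Rel_reduce[OF Suc.prems Fin_imp_Rel[OF Suc.prems]] by blast
qed

theorem nullstellensatz: "\<exists>U. spans U"
proof -
  obtain c where c: "c \<noteq> 0" "v c < 1" using small_const by blast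
  \<comment> \<open>At the start the single generator 1 suffices, since a series is a polynomial in
    the variables up to a small remainder.\<close>
  have "Fin N var {1} c"
    unfolding Fin_def
  proof (intro conjI ballI)
    show "\<forall>i<N. var i \<in> B 1" by (auto intro: B_bd T_var bd_var)
    show "{1} \<subseteq> B 1" using B_1 by simp
    show "c \<noteq> 0" "v c < 1" by fact+
    fix y assume "y \<in> B 1"
    then obtain h where y: "y \<in> T N" "h \<in> x" "bd 1 (y - h)" unfolding B_def by blast
    define g where "g = y - h"
    have g: "g \<in> T N" using y x_T T_diff unfolding g_def by blast
    obtain A where A: "finite A" "A \<subseteq> Exp N" "bd (v c) (g - (\<Sum>a\<in>A. const (cf g a) * mnm a))"
      using T_truncate[OF g v_pos[OF c(1)]] .
    define s where "s = (\<Sum>a\<in>A. const (cf g a) * mnm a)"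
    have s: "s = (\<Sum>a\<in>A. const (cf g a) * mon N var a)"
      unfolding s_def using A(2) by (intro sum.cong) (auto simp: mnm_eq_mon subset_iff)
    have "s \<in> R N var" unfolding s using A y(3) by (intro R_I) (auto simp: bd_def g_def)
    then have "s * 1 \<in> Sp (R N var) {1}"
      by (intro submodD(3)[OF Sp_submod[OF subrng_R]] Sp_gen[OF subrng_R]) auto
    moreover have "y - s * 1 \<in> B (v c)"
    proof (rule B_I[OF _ y(2)])
      have "s \<in> T N" unfolding s_def using A(2) by (intro T_sum T_mult T_const T_mnm) auto
      then show "y - s * 1 \<in> T N" using y T_diff by simp
      have "y - s * 1 - h = g - s" by (simp add: g_def)
      then show "bd (v c) (y - s * 1 - h)" using A(3) unfolding s_def[symmetric] by metis
    qed
    ultimately show "\<exists>s\<in>Sp (R N var) {1}. y - s \<in> B (v c)" by blast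
  qed simp
  then show ?thesis by (rule Fin_spans)
qed

end

section \<open>Absolute values of residue fields\<close>

lemma mult_seminormsD:
  assumes "w \<in> mult_seminorms S"
  shows "w \<in> seminorms S" "f \<in> S \<Longrightarrow> g \<in> S \<Longrightarrow> w (f * g) = w f * w g"
  using assms by (auto simp: mult_seminorms_def)

lemma mult_seminorm_power: "subrng S \<Longrightarrow> w \<in> mult_seminorms S \<Longrightarrow> f \<in> S \<Longrightarrow> w (f ^ n) = w f ^ n"
  by (induction n) (auto simp: mult_seminormsD(2) subrng_power seminormsD(3)[OF mult_seminormsD(1)])

lemma seminorm_cong:
  assumes S: "subrng S" and w: "w \<in> seminorms S" and f: "f \<in> S" "g \<in> S" and 0: "w (f - g) = 0"
  shows "w f = w g"
proof -
  have d: "f - g \<in> S" using f by (rule subrngD(4)[OF S])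
  have "w ((f - g) + g) \<le> max (w (f - g)) (w g)" by (rule seminorm_add[OF S w d f(2)])
  moreover have "w (f - (f - g)) \<le> max (w f) (w (f - g))" by (rule seminormsD(5)[OF w f(1) d])
  ultimately show ?thesis using 0 seminormsD(1)[OF w f(1)] seminormsD(1)[OF w f(2)] by simp
qed

text \<open>A constant factor disappears when n-th roots are taken. In this way comparisons up to a
  constant become exact for multiplicative seminorms.\<close>

lemma le_of_power_le:
  fixes a b C :: real
  assumes a: "0 \<le> a" "0 \<le> b" "0 < C" and le: "\<And>n. b ^ n \<le> C * a ^ n"
  shows "b \<le> a"
proof (rule ccontr)
  assume "\<not> b \<le> a"
  then have ab: "a < b" "0 < b" using a by auto
  then have "a / b < 1" by simp
  then obtain n where "(a / b) ^ n < 1 / C" using real_arch_pow_inv[of "1 / C" "a / b"] a(3) by auto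
  then have "C * a ^ n < b ^ n" using ab a(3) by (simp add: power_divide field_simps)
  then show False using le[of n] by simp
qed

context complete_nonarch_field
begin

text \<open>An absolute value of the residue field extending \<open>v\<close>, pulled back to
  \<open>T n\<close>.\<close>

definition abs_on :: "nat \<Rightarrow> 'k mser set \<Rightarrow> ('k mser \<Rightarrow> real) \<Rightarrow> bool" where
  "abs_on n x w \<longleftrightarrow> w \<in> mult_seminorms (T n) \<and> (\<forall>f\<in>T n. w f = 0 \<longleftrightarrow> f \<in> x) \<and> (\<forall>c. w (const c) = v c)"

definition gauss_bounded :: "nat \<Rightarrow> ('k mser \<Rightarrow> real) \<Rightarrow> bool" where
  "gauss_bounded n w \<longleftrightarrow> (\<forall>f\<in>T n. \<forall>r. bd r f \<longrightarrow> w f \<le> r)"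

text \<open>The upper bound applied to \<open>c\<close> and to its inverse leaves only
  equality.\<close>

lemma gauss_bounded_const:
  assumes w: "w \<in> mult_seminorms (T n)" "gauss_bounded n w"
  shows "w (const c) = v c"
proof (cases "c = 0")
  case True then show ?thesis using seminormsD(2)[OF mult_seminormsD(1)[OF w(1)]] by simp
next
  case False
  have le: "w (const e) \<le> v e" for e using w(2) T_const bd_const unfolding gauss_bounded_def by blast
  have "w (const c) * w (const (inverse c)) = 1"
    using mult_seminormsD(2)[OF w(1) T_const T_const, of c "inverse c"] const_inverse(1)[OF False]
      seminormsD(3)[OF mult_seminormsD(1)[OF w(1)]] by simp
  moreover have "w (const c) * w (const (inverse c)) \<le> w (const c) * inverse (v c)"
    using le[of "inverse c"] seminormsD(1)[OF mult_seminormsD(1)[OF w(1)] T_const, of c]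
    by (intro mult_left_mono) (auto simp: v_inverse)
  ultimately have "v c \<le> w (const c)" using v_pos[OF False] by (simp add: field_simps)
  then show ?thesis using le[of c] by simp
qed

end

context max_ideal
begin

text \<open>A multiplicative seminorm below the residue norm \<open>q\<close> vanishes on
  \<open>x\<close>, whose elements lie in every ball of positive radius. Its kernel is no larger,
  because an element outside \<open>x\<close> is invertible modulo \<open>x\<close>.\<close>

lemma exists_abs: "\<exists>w. abs_on N x w \<and> gauss_bounded N w"
proof -
  define q where "q = (\<lambda>f. if f \<in> T N then Inf {r. 0 < r \<and> f \<in> B r} else 0)"
  have rel: "bounds_relation (T N) (\<lambda>f r. f \<in> B r)"
    unfolding bounds_relation_def
  proof (intro conjI ballI allI impI)
    show "\<exists>r>0. f \<in> B r" if "f \<in> T N" for f using T_bd[OF that] B_bd[OF that] by metis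
    show "f \<in> B s" if "f \<in> B r" "r \<le> s" for f r s using that B_mono by blast
    show "(1 \<in> B r) = (1 \<le> r)" for r using one_notin_B[of r] B_1 B_mono[of 1 r] by fastforce
  qed (auto intro: B_mult B_diff B_0)
  note Q = seminorm_of_bounds[OF subrng_T rel q_def]
  obtain w where w: "w \<in> mult_seminorms (T N)" "w \<le> q" using exists_mult_seminorm[OF subrng_T Q(1)] .
  note sw = mult_seminormsD(1)[OF w(1)]
  have wB: "w f \<le> r" if "0 < r" "f \<in> B r" for f r
    using le_funD[OF w(2), of f] Q(3)[OF _ that] that(2) B_T by force
  have gb: "gauss_bounded N w"
    unfolding gauss_bounded_def
  proof (intro ballI allI impI)
    fix f r assume f: "f \<in> T N" "bd r f"
    show "w f \<le> r"
    proof (rule dense_ge)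
      fix s assume s: "r < s"
      then have "0 < s" using bd_nonneg[OF f(2)] by simp
      then show "w f \<le> s" using B_bd[OF f(1) bd_mono[OF f(2)]] s by (intro wB) auto
    qed
  qed
  have "w f = 0 \<longleftrightarrow> f \<in> x" if f: "f \<in> T N" for f
  proof
    assume fx: "f \<in> x"
    have "w f \<le> e" if "0 < e" for e using fx that by (intro wB B_x) auto
    then have "w f \<le> 0" by (rule dense_ge)
    then show "w f = 0" using seminormsD(1)[OF sw f] by simp
  next
    assume 0: "w f = 0"
    show "f \<in> x"
    proof (rule ccontr)
      assume "f \<notin> x"
      then obtain z where z: "z \<in> T N" "f * z - 1 \<in> x" using x_max f by blast
      have "w (f * z - 1) \<le> 1 / 2" using z(2) by (intro wB B_x) auto
      moreover have fz: "w (f * z) = 0" "f * z \<in> T N" using mult_seminormsD(2)[OF w(1) f z(1)] 0 T_mult[OF f z(1)] by auto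
      moreover have "w (f * z - (f * z - 1)) \<le> max (w (f * z)) (w (f * z - 1))"
        using fz(2) T_1 T_diff by (intro seminormsD(5)[OF sw]) auto
      ultimately show False using seminormsD(3)[OF sw] by simp
    qed
  qed
  then show ?thesis unfolding abs_on_def using w(1) gb gauss_bounded_const[OF w(1) gb] by blast
qed

text \<open>Completeness enters through the distance of \<open>u0\<close> from the span of \<open>F\<close>: if it vanished,
  \<open>u0\<close> would lie in the span, contradicting minimality of \<open>U\<close>.\<close>

lemma coordinates_bounded:
  assumes w: "abs_on N x w" and U: "spans U" and min: "\<And>U'. spans U' \<Longrightarrow> card U \<le> card U'"
  shows "finite F \<Longrightarrow> F \<subseteq> U \<Longrightarrow> \<exists>K>0. \<forall>s. \<forall>u\<in>F. v (s u) \<le> K * w (\<Sum>u\<in>F. const (s u) * u)"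
proof (induction F rule: finite_induct)
  case empty
  then show ?case by (intro exI[of _ 1]) simp
next
  case (insert u0 F)
  then obtain K where K: "0 < K" "\<And>s u. u \<in> F \<Longrightarrow> v (s u) \<le> K * w (\<Sum>u\<in>F. const (s u) * u)" by auto
  note mw = w[unfolded abs_on_def, THEN conjunct1]
  note sw = mult_seminormsD(1)[OF mw]
  have wc: "w (const c) = v c" for c using w by (simp add: abs_on_def)
  have UT: "u \<in> T N" if "u \<in> U" for u using U that by (auto simp: spans_def)
  have FT: "u \<in> T N" if "u \<in> F" for u using UT insert.prems that by blast
  have u0: "u0 \<in> U" "u0 \<in> T N" using UT insert.prems by auto
  have sT: "(\<Sum>u\<in>F. const (s u) * u) \<in> T N" for s by (intro T_sum T_mult T_const FT)
  have wcu: "w (const c * u) = v c * w u" if "u \<in> T N" for c u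
    using mult_seminormsD(2)[OF mw T_const that] wc by simp
  define y where "y s = u0 + (\<Sum>u\<in>F. const (s u) * u)" for s
  have yT: "y s \<in> T N" for s unfolding y_def by (intro T_add u0 sT)
  have "\<exists>\<delta>>0. \<forall>s. \<delta> \<le> w (y s)"
  proof (rule ccontr)
    assume "\<not> (\<exists>\<delta>>0. \<forall>s. \<delta> \<le> w (y s))"
    then have ex: "\<And>\<delta>. 0 < \<delta> \<Longrightarrow> \<exists>s. w (y s) < \<delta>" by (meson not_le)
    \<comment> \<open>The division by \<open>K\<close> compensates the constant of the induction
      hypothesis, so that the coordinates of successive differences are bounded by a geometric
      sequence.\<close>
    have "\<forall>k. \<exists>s. w (y s) < (1 / 2) ^ k / K" using K(1) by (intro allI ex) simp
    from choice[OF this] obtain s where s: "\<And>k::nat. w (y (s k)) < (1 / 2) ^ k / K" by blast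
    have "v (s (Suc k) u - s k u) \<le> (1 / 2) ^ k" if u: "u \<in> F" for k u
    proof -
      have "w (\<Sum>u\<in>F. const (s (Suc k) u - s k u) * u) = w (y (s (Suc k)) - y (s k))"
        by (simp add: y_def algebra_simps sum_subtractf)
      also have "\<dots> \<le> max (w (y (s (Suc k)))) (w (y (s k)))" by (rule seminormsD(5)[OF sw yT yT])
      also have "\<dots> \<le> (1 / 2) ^ k / K"
        using s[of "Suc k"] s[of k] K(1) power_decreasing[of k "Suc k" "1 / 2 :: real"] divide_right_mono[of "(1 / 2) ^ Suc k" "(1 / 2 :: real) ^ k" K]
        by simp
      finally have "K * w (\<Sum>u\<in>F. const (s (Suc k) u - s k u) * u) \<le> (1 / 2) ^ k"
        using K(1) by (simp add: field_simps)
      then show ?thesis using K(2)[OF u, of "\<lambda>u. s (Suc k) u - s k u"] by simp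
    qed
    then have sd: "\<And>u k. u \<in> F \<Longrightarrow> v (s (Suc k) u - s k u) \<le> (1 / 2) ^ k" .
    have "\<exists>l. \<forall>k. v (s k u - l) \<le> (1 / 2) ^ k" if u: "u \<in> F" for u
    proof -
      obtain l where "\<And>k. v (s k u - l) \<le> (1 / 2) ^ k"
        by (rule v_geometric_limit[of "1 / 2" "\<lambda>k. s k u"]) (use sd[OF u] in auto)
      then show ?thesis by blast
    qed
    then have "\<forall>u\<in>F. \<exists>l. \<forall>k. v (s k u - l) \<le> (1 / 2) ^ k" by blast
    from bchoice[OF this] obtain l where l: "\<forall>u\<in>F. \<forall>k. v (s k u - l u) \<le> (1 / 2) ^ k" ..
    \<comment> \<open>\<open>1 / K\<close> takes care of the values \<open>w (y (s k))\<close>, the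
      maximum over \<open>F\<close> of the correction from \<open>s k\<close> to its limit
      \<open>l\<close>.\<close>
    define M where "M = max (1 / K) (Max (insert 0 (w ` F)))"
    have M: "1 / K \<le> M" "\<And>u. u \<in> F \<Longrightarrow> w u \<le> M"
      using insert.hyps(1) by (auto simp: M_def le_max_iff_disj intro!: disjI2 Max_ge)
    have M0: "0 < M" using M(1) K(1) by (meson divide_pos_pos less_le_trans zero_less_one)
    have "w (y l) \<le> M * (1 / 2) ^ k" for k
    proof -
      have "(\<Sum>u\<in>F. const (s k u - l u) * u) \<in> T N \<and> w (\<Sum>u\<in>F. const (s k u - l u) * u) \<le> M * (1 / 2) ^ k"
      proof (rule seminorm_sum[OF subrng_T sw])
        show "0 \<le> M * (1 / 2) ^ k" using M0 by simp
        fix u assume u: "u \<in> F"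
        have "v (s k u - l u) * w u \<le> (1 / 2) ^ k * M"
          using l u M M0 seminormsD(1)[OF sw FT[OF u]] by (intro mult_mono) auto
        then show "const (s k u - l u) * u \<in> T N \<and> w (const (s k u - l u) * u) \<le> M * (1 / 2) ^ k"
          unfolding wcu[OF FT[OF u]] using T_mult[OF T_const FT[OF u]] by (simp add: mult.commute del: const_simps)
      qed
      then have a: "w (\<Sum>u\<in>F. const (s k u - l u) * u) \<le> M * (1 / 2) ^ k" ..
      have b: "w (y (s k)) \<le> M * (1 / 2) ^ k"
        using s[of k] mult_right_mono[OF M(1), of "(1 / 2) ^ k"] by simp
      have c: "w (y (s k) - (\<Sum>u\<in>F. const (s k u - l u) * u)) \<le> max (w (y (s k))) (w (\<Sum>u\<in>F. const (s k u - l u) * u))"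
        by (rule seminormsD(5)[OF sw yT sT])
      have d: "y (s k) - (\<Sum>u\<in>F. const (s k u - l u) * u) = y l"
        by (simp add: y_def algebra_simps sum_subtractf)
      show ?thesis using c unfolding d by (rule order_trans) (rule max.boundedI[OF b a])
    qed
    have "w (y l) \<le> 0"
    proof (rule dense_ge)
      fix e :: real assume "0 < e"
      then obtain k where "(1 / 2) ^ k < e / M" using real_arch_pow_inv[of "e / M" "1 / 2"] M0 by auto
      then have "M * (1 / 2) ^ k \<le> e" using M0 by (simp add: field_simps)
      then show "w (y l) \<le> e" using \<open>w (y l) \<le> M * (1 / 2) ^ k\<close> by linarith
    qed
    then have "w (y l) = 0" using seminormsD(1)[OF sw yT] by (meson antisym)
    then have yx: "y l \<in> x" using w yT by (simp add: abs_on_def)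
    have "spans (U - {u0})"
      unfolding spans_def
    proof (intro conjI ballI)
      show "finite (U - {u0})" "U - {u0} \<subseteq> T N" using U by (auto simp: spans_def)
      fix f assume "f \<in> T N"
      then obtain s where s: "f - (\<Sum>u\<in>U. const (s u) * u) \<in> x" using U unfolding spans_def by blast
      define l' where "l' u = (if u \<in> F then l u else 0)" for u
      have fU: "finite U" using U by (simp add: spans_def)
      have "(\<Sum>u\<in>F. const (l u) * u) = (\<Sum>u\<in>U - {u0}. const (l' u) * u)"
        using insert.prems insert.hyps fU by (intro sum.mono_neutral_cong_left) (auto simp: l'_def)
      then have eq: "(f - (\<Sum>u\<in>U. const (s u) * u)) + const (s u0) * y l = f - (\<Sum>u\<in>U - {u0}. const (s u - s u0 * l' u) * u)"
        unfolding sum.remove[OF fU u0(1)]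
        by (simp add: y_def algebra_simps sum_subtractf sum_distrib_left const_mult)
      have "(f - (\<Sum>u\<in>U. const (s u) * u)) + const (s u0) * y l \<in> x"
        by (intro submodD(2,3)[OF x_sub] s yx T_const)
      then show "\<exists>s. f - (\<Sum>u\<in>U - {u0}. const (s u) * u) \<in> x"
        unfolding eq by (rule exI[of _ "\<lambda>u. s u - s u0 * l' u"])
    qed
    then have "card U \<le> card (U - {u0})" by (rule min)
    then show False using u0(1) U by (metis card_Diff1_less not_le spans_def)
  qed
  then obtain \<delta> where \<delta>: "0 < \<delta>" "\<And>s. \<delta> \<le> w (y s)" by blast
  \<comment> \<open>The coefficient of \<open>u0\<close> costs the factor
    \<open>1 / \<delta>\<close>. For the other coefficients the term of \<open>u0\<close> is
    subtracted first, at the cost of \<open>max 1 (w u0 / \<delta>)\<close>, and then the old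
    constant \<open>K\<close> applies.\<close>
  define L where "L = max (1 / \<delta>) (K * max 1 (w u0 / \<delta>))"
  have "v (s u) \<le> L * w (\<Sum>u\<in>insert u0 F. const (s u) * u)" if u: "u \<in> insert u0 F" for s u
  proof -
    define g where "g = (\<Sum>u\<in>insert u0 F. const (s u) * u)"
    have g: "g = const (s u0) * u0 + (\<Sum>u\<in>F. const (s u) * u)" using insert.hyps by (simp add: g_def)
    have gT: "g \<in> T N" unfolding g by (intro T_add T_mult T_const u0 sT)
    have g0: "0 \<le> w g" by (rule seminormsD(1)[OF sw gT])
    have s0: "v (s u0) * \<delta> \<le> w g"
    proof (cases "s u0 = 0")
      case False
      have "g = const (s u0) * y (\<lambda>u. inverse (s u0) * s u)"
      proof -
        have "const (s u0) * (\<Sum>u\<in>F. const (inverse (s u0) * s u) * u) = (\<Sum>u\<in>F. const (s u) * u)"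
          unfolding sum_distrib_left using False
          by (intro sum.cong) (auto simp: const_mult[symmetric] mult.assoc[symmetric])
        then show ?thesis unfolding g y_def by (simp add: algebra_simps)
      qed
      then have "w g = v (s u0) * w (y (\<lambda>u. inverse (s u0) * s u))" using wcu[OF yT] by simp
      then show ?thesis using \<delta>(2) nonneg by (simp add: mult_left_mono)
    qed (use g0 in simp)
    then have s0': "v (s u0) \<le> (1 / \<delta>) * w g" using \<delta>(1) by (simp add: field_simps)
    show ?thesis
    proof (cases "u = u0")
      case True
      have "(1 / \<delta>) * w g \<le> L * w g" using g0 by (intro mult_right_mono) (auto simp: L_def)
      then show ?thesis using s0' True unfolding g_def by simp
    next
      case False
      then have uF: "u \<in> F" using u by simp
      have "w (\<Sum>u\<in>F. const (s u) * u) = w (g - const (s u0) * u0)" by (simp add: g)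
      also have "\<dots> \<le> max (w g) (w (const (s u0) * u0))"
        by (intro seminormsD(5)[OF sw] gT T_mult T_const u0)
      also have "\<dots> \<le> max 1 (w u0 / \<delta>) * w g"
      proof -
        have "v (s u0) * w u0 \<le> (1 / \<delta>) * w g * w u0"
          using s0' seminormsD(1)[OF sw u0(2)] by (intro mult_right_mono)
        then have "w (const (s u0) * u0) \<le> (w u0 / \<delta>) * w g" unfolding wcu[OF u0(2)] by (simp add: mult.commute)
        moreover have "(w u0 / \<delta>) * w g \<le> max 1 (w u0 / \<delta>) * w g" "1 * w g \<le> max 1 (w u0 / \<delta>) * w g"
          using g0 by (intro mult_right_mono; simp)+
        ultimately show ?thesis by simp
      qed
      finally have "K * w (\<Sum>u\<in>F. const (s u) * u) \<le> (K * max 1 (w u0 / \<delta>)) * w g"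
        using K(1) by (simp add: mult.assoc mult_left_mono)
      also have "\<dots> \<le> L * w g" using g0 by (intro mult_right_mono) (auto simp: L_def)
      finally show ?thesis using K(2)[OF uF, of s] unfolding g_def by simp
    qed
  qed
  moreover have "0 < L" using \<delta>(1) by (simp add: L_def less_max_iff_disj)
  ultimately show ?case by blast
qed

text \<open>Bounded coordinates with respect to a minimal spanning set give
  \<open>w' \<le> K * M * w\<close> with a constant independent of the element. Applied to all
  powers of \<open>f\<close>, multiplicativity removes the constant.\<close>

lemma abs_le:
  assumes w: "abs_on N x w" and w': "abs_on N x w'" and f: "f \<in> T N"
  shows "w' f \<le> w f"
proof -
  obtain U0 where "spans U0" using nullstellensatz by blast
  then obtain U where U: "spans U" "\<And>U'. spans U' \<Longrightarrow> card U \<le> card U'"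
    using ex_has_least_nat[of spans U0 card] by blast
  have fU: "finite U" "U \<subseteq> T N" using U(1) by (auto simp: spans_def)
  obtain K where K: "0 < K" "\<And>s u. u \<in> U \<Longrightarrow> v (s u) \<le> K * w (\<Sum>u\<in>U. const (s u) * u)"
    using coordinates_bounded[OF w U fU(1)] by auto
  have mw: "w \<in> mult_seminorms (T N)" "w' \<in> mult_seminorms (T N)" using w w' by (auto simp: abs_on_def)
  note sw = mult_seminormsD(1)[OF mw(1)] and sw' = mult_seminormsD(1)[OF mw(2)]
  define M where "M = Max (insert 1 (w' ` U))"
  have M: "1 \<le> M" "\<And>u. u \<in> U \<Longrightarrow> w' u \<le> M" using fU by (auto simp: M_def)
  show ?thesis
  proof (rule le_of_power_le[of _ _ "K * M"])
    show "0 \<le> w f" "0 \<le> w' f" using seminormsD(1)[OF sw f] seminormsD(1)[OF sw' f] by auto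
    show "0 < K * M" using K(1) M(1) by simp
    fix n
    have fn: "f ^ n \<in> T N" by (rule T_power[OF f])
    then obtain s where s: "f ^ n - (\<Sum>u\<in>U. const (s u) * u) \<in> x" using U(1) unfolding spans_def by blast
    define g where "g = (\<Sum>u\<in>U. const (s u) * u)"
    have g: "g \<in> T N" unfolding g_def using fU by (intro T_sum T_mult T_const) auto
    have "f ^ n - g \<in> T N" by (rule T_diff[OF fn g])
    then have z: "w (f ^ n - g) = 0" "w' (f ^ n - g) = 0" using w w' s by (auto simp: abs_on_def g_def)
    have e: "w (f ^ n) = w g" "w' (f ^ n) = w' g"
      using seminorm_cong[OF subrng_T sw fn g z(1)] seminorm_cong[OF subrng_T sw' fn g z(2)] .
    have wg: "0 \<le> w g" by (rule seminormsD(1)[OF sw g])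
    have "g \<in> T N \<and> w' g \<le> K * w g * M"
      unfolding g_def
    proof (rule seminorm_sum[OF subrng_T sw'], fold g_def)
      show "0 \<le> K * w g * M" using K(1) M(1) wg by simp
      fix u assume u: "u \<in> U"
      then have uT: "u \<in> T N" using fU by blast
      have "w' (const (s u) * u) = v (s u) * w' u"
        using mult_seminormsD(2)[OF mw(2) T_const uT] w' by (simp add: abs_on_def)
      also have "\<dots> \<le> (K * w g) * M"
        using K M u wg seminormsD(1)[OF sw' uT] nonneg unfolding g_def by (intro mult_mono) auto
      finally show "const (s u) * u \<in> T N \<and> w' (const (s u) * u) \<le> K * w g * M" using T_mult[OF T_const uT] by simp
    qed
    then have "w' (f ^ n) \<le> K * M * w (f ^ n)" using e by (simp add: algebra_simps)
    then show "w' f ^ n \<le> K * M * w f ^ n"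
      using mult_seminorm_power[OF subrng_T mw(1) f] mult_seminorm_power[OF subrng_T mw(2) f] by simp
  qed
qed

theorem abs_unique: "abs_on N x w \<Longrightarrow> abs_on N x w' \<Longrightarrow> f \<in> T N \<Longrightarrow> w f = w' f"
  using abs_le by (meson antisym)

text \<open>\<open>T N\<close> is, modulo \<open>x\<close>, a finite module over the constants, hence integral over \<open>T n\<close>.\<close>

lemma maxid_restrict:
  assumes n: "n \<le> N"
  shows "maxid (T n) (x \<inter> T n)"
proof -
  have nN: "T n \<subseteq> T N" by (rule T_mono[OF n])
  have xn: "submod (T n) x" using x_sub nN unfolding submod_def by blast
  have ideal: "submod (T n) (x \<inter> T n)"
    unfolding submod_def by (auto intro: submodD[OF xn] T_add T_mult)
  obtain U where U: "spans U" using nullstellensatz by blast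
  then have fU: "finite U" "U \<subseteq> T N" by (auto simp: spans_def)
  have "\<exists>z\<in>T n. b * z - 1 \<in> x \<inter> T n" if b: "b \<in> T n" "b \<notin> x \<inter> T n" for b
  proof -
    have bN: "b \<in> T N" using b(1) nN by blast
    obtain z where z: "z \<in> T N" "b * z - 1 \<in> x" using x_max[OF bN] b by blast
    let ?W = "insert 1 U"
    have W: "finite ?W" "?W \<subseteq> T N" using fU T_1 by auto
    have "\<exists>s. z * w - (\<Sum>u\<in>?W. const (s u) * u) \<in> x" if w: "w \<in> ?W" for w
    proof -
      have "z * w \<in> T N" using z(1) w W by (intro T_mult) auto
      then obtain s where s: "z * w - (\<Sum>u\<in>U. const (s u) * u) \<in> x" using U unfolding spans_def by blast
      have "(\<Sum>u\<in>U. const (s u) * u) = (\<Sum>u\<in>?W. const (if u \<in> U then s u else 0) * u)"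
        using fU by (intro sum.mono_neutral_cong_left) auto
      then show ?thesis using s by (intro exI[of _ "\<lambda>u. if u \<in> U then s u else 0"]) simp
    qed
    then have "\<forall>w\<in>?W. \<exists>s. z * w - (\<Sum>u\<in>?W. const (s u) * u) \<in> x" by blast
    from bchoice[OF this] obtain s where s: "\<forall>w\<in>?W. z * w - (\<Sum>u\<in>?W. const (s w u) * u) \<in> x" ..
    define I where "I = (\<lambda>p. b * p) ` T n"
    have I: "submod (T n) I"
      unfolding submod_def
    proof (intro conjI ballI)
      have "0 = b * 0" by simp
      then show "0 \<in> I" unfolding I_def using T_0 by blast
      fix f g assume "f \<in> I" "g \<in> I"
      then obtain p q where "f = b * p" "g = b * q" "p \<in> T n" "q \<in> T n" unfolding I_def by blast
      then have "f + g = b * (p + q)" "p + q \<in> T n" by (auto simp: algebra_simps T_add)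
      then show "f + g \<in> I" unfolding I_def by blast
    next
      fix s f assume s: "s \<in> T n" and "f \<in> I"
      then obtain p where "f = b * p" "p \<in> T n" unfolding I_def by blast
      then have "s * f = b * (s * p)" "s * p \<in> T n" using s by (auto simp: algebra_simps T_mult)
      then show "s * f \<in> I" unfolding I_def by blast
    qed
    \<comment> \<open>The entries lie in \<open>T n\<close>, although \<open>z\<close> need not,
      because the \<open>s w u\<close> are constants; modulo \<open>b\<close> the matrix is the
      identity. The elimination gives \<open>p\<close> in \<open>x\<close> with
      \<open>p - 1 = b * g\<close>, and \<open>- g\<close> is the inverse of \<open>b\<close> modulo
      \<open>x\<close>.\<close>
    define q where "q w u = (if w = u then 1 else 0) - b * const (s w u)" for w u
    have W': "insert 1 (U - {1}) = ?W" by auto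
    have "\<exists>p\<in>T n. p - 1 ^ (2 ^ card (U - {1})) \<in> I \<and> p * 1 \<in> x"
    proof (rule elimination[OF subrng_T I xn, where u = "\<lambda>u. u" and q = q and J = "U - {1}" and j = 1])
      show "finite (U - {1})" using fU by simp
      show "1 \<notin> U - {1}" by simp
      show "1 \<in> T n" by (rule T_1)
      have bI: "- (b * const c) \<in> I" for c
        by (rule submod_uminus[OF subrng_T I]) (simp add: I_def T_const)
      fix i assume "i \<in> insert 1 (U - {1})"
      then have i: "i \<in> ?W" using W' by blast
      show "q i j \<in> T n" for j
        unfolding q_def using T_mult[OF b(1) T_const] T_1 T_0 by (intro T_diff) auto
      show "q i i - 1 \<in> I" using bI by (simp add: q_def)
      show "q i j \<in> I" if "i \<noteq> j" for j using bI that by (simp add: q_def)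
      have "(\<Sum>j\<in>?W. q i j * j) = (\<Sum>j\<in>?W. (if i = j then j else 0)) - b * (\<Sum>j\<in>?W. const (s i j) * j)"
        unfolding q_def sum_distrib_left sum_subtractf[symmetric] by (rule sum.cong) (auto simp: algebra_simps)
      also have "\<dots> = i - b * (\<Sum>j\<in>?W. const (s i j) * j)" using W i by simp
      also have "\<dots> = b * (z * i - (\<Sum>j\<in>?W. const (s i j) * j)) - i * (b * z - 1)"
        by (simp add: algebra_simps)
      also have "\<dots> \<in> x"
      proof (rule submod_diff[OF subrng_T x_sub])
        show "b * (z * i - (\<Sum>j\<in>?W. const (s i j) * j)) \<in> x"
          by (rule submodD(3)[OF x_sub bN]) (use s i in blast)
        have "i \<in> T N" using i W by blast
        then show "i * (b * z - 1) \<in> x" by (rule submodD(3)[OF x_sub _ z(2)])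
      qed
      finally show "(\<Sum>j\<in>insert 1 (U - {1}). q i j * j) \<in> x" unfolding W' .
    qed
    then obtain p where p: "p \<in> T n" "p - 1 \<in> I" "p \<in> x" by auto
    then obtain g where g: "g \<in> T n" "p - 1 = b * g" unfolding I_def by blast
    have "b * (- g) - 1 = - p" using g(2) by (simp add: algebra_simps)
    moreover have "- p \<in> x \<inter> T n" using p submod_uminus[OF subrng_T ideal] by blast
    ultimately show ?thesis using T_uminus[OF g(1)] by metis
  qed
  then show ?thesis unfolding maxid_def using ideal x_1 by blast
qed

end

section \<open>Density of the maximal ideals\<close>

lemma finite_le_exponents: "finite {a :: nat \<Rightarrow>\<^sub>0 nat. \<exists>b. a + b = c}"
proof -
  have "{a. \<exists>b. a + b = c} = fst ` {(a, b). a + b = c}" by force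
  then show ?thesis using finite_exponent_splittings[of c] by simp
qed

definition deg :: "nat \<Rightarrow> (nat \<Rightarrow>\<^sub>0 nat) \<Rightarrow> nat" where
  "deg N a = (\<Sum>i<N. Poly_Mapping.lookup a i)"

lemma deg_0 [simp]: "deg N 0 = 0" by (simp add: deg_def)

lemma deg_add: "deg N (a + b) = deg N a + deg N b"
  by (simp add: deg_def lookup_add sum.distrib)

definition Exp_le :: "nat \<Rightarrow> nat \<Rightarrow> (nat \<Rightarrow>\<^sub>0 nat) set" where
  "Exp_le N M = {a\<in>Exp N. deg N a \<le> M}"

lemma finite_Exp_le: "finite (Exp_le N M)"
proof -
  define c where "c = (\<Sum>i<N. Poly_Mapping.single i M)"
  have lc: "Poly_Mapping.lookup c i = (if i < N then M else 0)" for i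
    unfolding c_def lookup_sum by (simp add: lookup_single when_def)
  have "Exp_le N M \<subseteq> {a. \<exists>b. a + b = c}"
  proof
    fix a assume a: "a \<in> Exp_le N M"
    have "Poly_Mapping.lookup a i \<le> Poly_Mapping.lookup c i" for i
    proof (cases "i < N")
      case True
      then have "Poly_Mapping.lookup a i \<le> deg N a" unfolding deg_def by (intro member_le_sum) auto
      then show ?thesis using a True by (simp add: lc Exp_le_def)
    next
      case False
      then have "i \<notin> Poly_Mapping.keys a" using a by (auto simp: Exp_le_def Exp_def)
      then show ?thesis by (simp add: in_keys_iff)
    qed
    then have le: "\<And>i. Poly_Mapping.lookup a i \<le> Poly_Mapping.lookup c i" .
    have "a + (c - a) = c"
    proof (rule poly_mapping_eqI)
      fix i show "Poly_Mapping.lookup (a + (c - a)) i = Poly_Mapping.lookup c i"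
        unfolding lookup_add lookup_minus by (rule le_add_diff_inverse[OF le])
    qed
    then show "a \<in> {a. \<exists>b. a + b = c}" by blast
  qed
  then show ?thesis using finite_le_exponents finite_subset by blast
qed

text \<open>The points of the rational domain \<open>|L i| \<le> |G|\<close> are described by evaluating series in \<open>N\<close>
  variables at \<open>L i / G\<close>. The polynomial \<open>E M h\<close> is \<open>G ^ M\<close> times the value of the truncation
  of \<open>h\<close> at degree \<open>M\<close>, which avoids localising at \<open>G\<close>.\<close>

locale rational_point = complete_nonarch_field v for v :: "'k::field \<Rightarrow> real" +
  fixes n m :: nat and q :: "'k mser \<Rightarrow> real" and G :: "'k mser" and H :: "nat \<Rightarrow> 'k mser"
  assumes q: "q \<in> mult_seminorms (T n)" "gauss_bounded n q"
    and G: "G \<in> T n" "0 < q G" and H: "\<And>i. i < m \<Longrightarrow> H i \<in> T n" "\<And>i. i < m \<Longrightarrow> q (H i) \<le> q G"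
begin

definition N :: nat where "N = n + m"
text \<open>Numerators over the common denominator \<open>G\<close>: division by \<open>G\<close>
  gives back the old variables for \<open>i < n\<close> and the quotients
  \<open>H (i - n) / G\<close> for the new ones.\<close>

definition L :: "nat \<Rightarrow> 'k mser" where "L i = (if i < n then var i * G else H (i - n))"
definition g :: real where "g = q G"

definition E :: "nat \<Rightarrow> 'k mser \<Rightarrow> 'k mser" where
  "E M h = (\<Sum>a\<in>Exp_le N M. const (cf h a) * G ^ (M - deg N a) * mon N L a)"

lemma sq: "q \<in> seminorms (T n)" by (rule mult_seminormsD(1)[OF q(1)])
lemma qm: "f \<in> T n \<Longrightarrow> f' \<in> T n \<Longrightarrow> q (f * f') = q f * q f'" by (rule mult_seminormsD(2)[OF q(1)])
lemma qb: "f \<in> T n \<Longrightarrow> bd r f \<Longrightarrow> q f \<le> r" using q(2) unfolding gauss_bounded_def by blast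
lemma q0: "f \<in> T n \<Longrightarrow> 0 \<le> q f" by (rule seminormsD(1)[OF sq])
lemma qpow: "f \<in> T n \<Longrightarrow> q (f ^ k) = q f ^ k" by (rule mult_seminorm_power[OF subrng_T q(1)])
lemma g0: "0 < g" using G by (simp add: g_def)

lemma L_T: "i < N \<Longrightarrow> L i \<in> T n"
  using G H(1) by (auto simp: L_def N_def intro!: T_mult T_var)

lemma q_L: "i < N \<Longrightarrow> q (L i) \<le> g"
proof (cases "i < n")
  case True
  have "q (var i * G) \<le> 1 * q G"
    unfolding qm[OF T_var[OF True] G(1)] using qb[OF T_var[OF True] bd_var] G(2) by (intro mult_right_mono) auto
  then show ?thesis using True by (simp add: L_def g_def)
qed (use H(2) in \<open>auto simp: L_def g_def N_def\<close>)

lemma mon_L: "mon N L a \<in> T n \<and> q (mon N L a) \<le> g ^ deg N a"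
proof -
  have "(\<Prod>i<k. L i ^ Poly_Mapping.lookup a i) \<in> T n \<and>
      q (\<Prod>i<k. L i ^ Poly_Mapping.lookup a i) \<le> g ^ (\<Sum>i<k. Poly_Mapping.lookup a i)" if "k \<le> N" for k
    using that
  proof (induction k)
    case 0 show ?case using T_1 seminormsD(3)[OF sq] by simp
  next
    case (Suc k)
    let ?p = "\<Prod>i<k. L i ^ Poly_Mapping.lookup a i"
    have k: "k < N" using Suc.prems by simp
    have Lk: "L k ^ Poly_Mapping.lookup a k \<in> T n" by (rule T_power[OF L_T[OF k]])
    have p: "?p \<in> T n" "q ?p \<le> g ^ (\<Sum>i<k. Poly_Mapping.lookup a i)" using Suc by auto
    have "q (L k ^ Poly_Mapping.lookup a k) \<le> g ^ Poly_Mapping.lookup a k"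
      unfolding qpow[OF L_T[OF k]] using q_L[OF k] q0[OF L_T[OF k]] by (rule power_mono)
    then have "q ?p * q (L k ^ Poly_Mapping.lookup a k) \<le> g ^ (\<Sum>i<k. Poly_Mapping.lookup a i) * g ^ Poly_Mapping.lookup a k"
      using p g0 q0[OF Lk] by (intro mult_mono) auto
    then show ?case using p Lk T_mult qm[OF p(1) Lk] by (simp add: power_add)
  qed
  from this[of N] show ?thesis by (simp add: mon_def deg_def)
qed

text \<open>Each term is homogeneous of degree \<open>M\<close> in \<open>G\<close> and the
  \<open>L i\<close>, on all of which \<open>q\<close> is at most \<open>g\<close>. This is why
  values of \<open>E M\<close> are always compared with \<open>g ^ M\<close>.\<close>

lemma E_term: assumes "deg N a \<le> M" "v c \<le> e"
  shows "const c * G ^ (M - deg N a) * mon N L a \<in> T n \<and> q (const c * G ^ (M - deg N a) * mon N L a) \<le> e * g ^ M"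
proof -
  have GT: "G ^ (M - deg N a) \<in> T n" by (rule T_power[OF G(1)])
  have cT: "const c * G ^ (M - deg N a) \<in> T n" by (rule T_mult[OF T_const GT])
  have e0: "0 \<le> e" using assms(2) nonneg order_trans by blast
  have "q (const c * G ^ (M - deg N a)) \<le> e * g ^ (M - deg N a)"
    unfolding qm[OF T_const GT] qpow[OF G(1)] g_def[symmetric]
    using order_trans[OF qb[OF T_const bd_const] assms(2)] g0 by (intro mult_right_mono) auto
  then have "q (const c * G ^ (M - deg N a)) * q (mon N L a) \<le> e * g ^ (M - deg N a) * g ^ deg N a"
    using mon_L[of a] g0 e0 q0 by (intro mult_mono) auto
  also have "\<dots> = e * g ^ M" using assms(1) by (simp add: mult.assoc power_add[symmetric])
  finally show ?thesis using qm[OF cT] mon_L[of a] T_mult[OF cT] by simp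
qed

lemma E_bound: assumes "0 \<le> e" "\<And>a. v (cf h a) \<le> e" shows "E M h \<in> T n \<and> q (E M h) \<le> e * g ^ M"
  unfolding E_def
proof (rule seminorm_sum[OF subrng_T sq])
  show "0 \<le> e * g ^ M" using assms(1) g0 by simp
  fix a assume "a \<in> Exp_le N M"
  then show "const (cf h a) * G ^ (M - deg N a) * mon N L a \<in> T n \<and> q (const (cf h a) * G ^ (M - deg N a) * mon N L a) \<le> e * g ^ M"
    using assms(2) by (intro E_term) (auto simp: Exp_le_def)
qed

lemma E_T: assumes h: "h \<in> T N" shows "E M h \<in> T n"
proof -
  obtain r where "0 < r" "bd r h" using T_bd[OF h] .
  then show ?thesis using E_bound[of r h M] by (simp add: bd_def)
qed

lemma E_diff: "E M (h - k) = E M h - E M k" "E M (h + k) = E M h + E M k"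
  unfolding E_def by (simp_all add: algebra_simps sum_subtractf sum.distrib)

lemma tail: assumes h: "h \<in> T N" and e: "0 < e"
  obtains M0 where "\<And>a. M0 < deg N a \<Longrightarrow> v (cf h a) \<le> e"
proof
  let ?A = "{a. e \<le> v (cf h a)}"
  have fin: "finite ?A" using h e by (simp add: T_def)
  fix a assume a: "Max (insert 0 (deg N ` ?A)) < deg N a"
  show "v (cf h a) \<le> e"
  proof (rule ccontr)
    assume "\<not> v (cf h a) \<le> e"
    then have "deg N a \<in> insert 0 (deg N ` ?A)" by auto
    then have "deg N a \<le> Max (insert 0 (deg N ` ?A))" using fin by (intro Max_ge) auto
    then show False using a by simp
  qed
qed

text \<open>Raising the degree from \<open>M\<close> to \<open>M'\<close> multiplies the old value
  by a power of \<open>G\<close> and otherwise adds only terms from the tail of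
  \<open>h\<close>.\<close>

lemma E_step:
  assumes h: "h \<in> T N" and M: "M \<le> M'" and e: "0 \<le> e" "\<And>a. M < deg N a \<Longrightarrow> v (cf h a) \<le> e"
  shows "q (E M' h) \<le> max (g ^ (M' - M) * q (E M h)) (e * g ^ M')"
proof -
  let ?t = "\<lambda>a. const (cf h a) * G ^ (M' - deg N a) * mon N L a"
  have sub: "Exp_le N M \<subseteq> Exp_le N M'" using M by (auto simp: Exp_le_def)
  have "E M' h = (\<Sum>a\<in>Exp_le N M' - Exp_le N M. ?t a) + (\<Sum>a\<in>Exp_le N M. ?t a)"
    unfolding E_def by (rule sum.subset_diff[OF sub finite_Exp_le])
  also have "(\<Sum>a\<in>Exp_le N M. ?t a) = G ^ (M' - M) * E M h"
    unfolding E_def sum_distrib_left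
  proof (rule sum.cong)
    fix a assume a: "a \<in> Exp_le N M"
    then have "M' - deg N a = (M' - M) + (M - deg N a)" using M by (simp add: Exp_le_def)
    then show "?t a = G ^ (M' - M) * (const (cf h a) * G ^ (M - deg N a) * mon N L a)"
      by (simp add: power_add algebra_simps)
  qed simp
  finally have eq: "E M' h = (\<Sum>a\<in>Exp_le N M' - Exp_le N M. ?t a) + G ^ (M' - M) * E M h" .
  have 1: "(\<Sum>a\<in>Exp_le N M' - Exp_le N M. ?t a) \<in> T n \<and> q (\<Sum>a\<in>Exp_le N M' - Exp_le N M. ?t a) \<le> e * g ^ M'"
  proof (rule seminorm_sum[OF subrng_T sq])
    show "0 \<le> e * g ^ M'" using e g0 by simp
    fix a assume "a \<in> Exp_le N M' - Exp_le N M"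
    then show "?t a \<in> T n \<and> q (?t a) \<le> e * g ^ M'" using e(2)[of a] by (intro E_term) (auto simp: Exp_le_def)
  qed
  have GM: "G ^ (M' - M) \<in> T n" by (rule T_power[OF G(1)])
  have 2: "G ^ (M' - M) * E M h \<in> T n" "q (G ^ (M' - M) * E M h) = g ^ (M' - M) * q (E M h)"
    using T_mult[OF GM E_T[OF h]] qm[OF GM E_T[OF h]] qpow[OF G(1)] by (auto simp: g_def)
  show ?thesis unfolding eq
    using seminorm_add[OF subrng_T sq conjunct1[OF 1] 2(1)] 1 2(2) by (simp add: max.commute le_max_iff_disj) linarith
qed

text \<open>The product of the truncations at \<open>M\<close> differs from the truncation of the
  product at \<open>M + M\<close> exactly by pairs of exponents of which one has degree above
  \<open>M\<close>; there one coefficient is at most \<open>e\<close> and the other at most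
  \<open>C\<close>.\<close>

lemma E_mult:
  assumes h: "h \<in> T N" "bd C h" and k: "k \<in> T N" "bd C k" and e: "0 \<le> e"
    and tl: "\<And>a. M < deg N a \<Longrightarrow> v (cf h a) \<le> e \<and> v (cf k a) \<le> e"
  shows "q (E (M + M) (h * k) - E M h * E M k) \<le> e * C * g ^ (M + M)"
proof -
  have C: "0 \<le> C" by (rule bd_nonneg[OF h(2)])
  define \<phi> where "\<phi> = (\<lambda>(a, b). const (cf h a * cf k b) * G ^ (M + M - deg N (a + b)) * mon N L (a + b))"
  define P where "P = {(a, b). a + b \<in> Exp_le N (M + M)}"
  have P: "finite P"
  proof -
    have "P = (\<Union>c\<in>Exp_le N (M + M). {(a, b). a + b = c})" by (auto simp: P_def)
    then show ?thesis using finite_Exp_le finite_exponent_splittings by simp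
  qed
  have "E (M + M) (h * k) = (\<Sum>c\<in>Exp_le N (M + M). \<Sum>p\<in>{(a, b). a + b = c}. \<phi> p)"
    unfolding E_def
  proof (rule sum.cong)
    fix c
    have "const (cf (h * k) c) * G ^ (M + M - deg N c) * mon N L c =
        (\<Sum>p\<in>{(a, b). a + b = c}. const (cf h (fst p) * cf k (snd p)) * G ^ (M + M - deg N c) * mon N L c)"
      unfolding cf_mult const_sum sum_distrib_right by (simp add: case_prod_unfold)
    also have "\<dots> = (\<Sum>p\<in>{(a, b). a + b = c}. \<phi> p)" by (rule sum.cong) (auto simp: \<phi>_def)
    finally show "const (cf (h * k) c) * G ^ (M + M - deg N c) * mon N L c = (\<Sum>p\<in>{(a, b). a + b = c}. \<phi> p)" .
  qed simp
  also have "\<dots> = (\<Sum>(c, p)\<in>(SIGMA c:Exp_le N (M + M). {(a, b). a + b = c}). \<phi> p)"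
    by (rule sum.Sigma) (auto simp: finite_Exp_le finite_exponent_splittings)
  also have "\<dots> = (\<Sum>p\<in>P. \<phi> p)"
    by (rule sum.reindex_bij_witness[where i = "\<lambda>p. (fst p + snd p, p)" and j = snd]) (auto simp: P_def)
  finally have 1: "E (M + M) (h * k) = (\<Sum>p\<in>P. \<phi> p)" .
  let ?Q = "Exp_le N M \<times> Exp_le N M"
  have QP: "?Q \<subseteq> P" by (auto simp: P_def Exp_le_def deg_add Exp_add)
  have 2: "E M h * E M k = (\<Sum>p\<in>?Q. \<phi> p)"
    unfolding E_def sum_product sum.cartesian_product
  proof (rule sum.cong)
    fix p assume "p \<in> ?Q"
    then obtain a b where p: "p = (a, b)" "deg N a \<le> M" "deg N b \<le> M" by (auto simp: Exp_le_def)
    then have "M + M - deg N (a + b) = (M - deg N a) + (M - deg N b)" by (simp add: deg_add)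
    then show "(case p of (a, b) \<Rightarrow> const (cf h a) * G ^ (M - deg N a) * mon N L a * (const (cf k b) * G ^ (M - deg N b) * mon N L b)) = \<phi> p"
      unfolding p(1) \<phi>_def by (simp add: power_add mon_add const_mult algebra_simps)
  qed simp
  have "(\<Sum>p\<in>P - ?Q. \<phi> p) \<in> T n \<and> q (\<Sum>p\<in>P - ?Q. \<phi> p) \<le> e * C * g ^ (M + M)"
  proof (rule seminorm_sum[OF subrng_T sq])
    show "0 \<le> e * C * g ^ (M + M)" using e C g0 by simp
    fix p assume "p \<in> P - ?Q"
    then obtain a b where p: "p = (a, b)" "a + b \<in> Exp_le N (M + M)" "(a, b) \<notin> ?Q" by (auto simp: P_def)
    then have "M < deg N a \<or> M < deg N b" using Exp_addD[of a b N] by (auto simp: Exp_le_def)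
    then have "v (cf h a) * v (cf k b) \<le> e * C"
    proof
      assume "M < deg N a"
      then show ?thesis using tl[of a] k(2) e nonneg by (intro mult_mono) (auto simp: bd_def)
    next
      assume "M < deg N b"
      then have "v (cf h a) * v (cf k b) \<le> C * e" using tl[of b] h(2) C nonneg by (intro mult_mono) (auto simp: bd_def)
      then show ?thesis by (simp add: mult.commute)
    qed
    then show "\<phi> p \<in> T n \<and> q (\<phi> p) \<le> e * C * g ^ (M + M)"
      using p(2) unfolding p(1) \<phi>_def prod.case by (intro E_term) (auto simp: Exp_le_def mult)
  qed
  moreover have "(\<Sum>p\<in>P. \<phi> p) = (\<Sum>p\<in>P - ?Q. \<phi> p) + (\<Sum>p\<in>?Q. \<phi> p)" by (rule sum.subset_diff[OF QP P])
  ultimately show ?thesis unfolding 1 2 by simp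
qed

text \<open>The kernel of evaluation at the quotients \<open>L i / G\<close>: the values of the
  truncations, divided by \<open>g ^ M\<close>, tend to zero.\<close>

definition nul :: "'k mser set" where
  "nul = {h\<in>T N. \<forall>e>0. \<exists>M0. \<forall>M\<ge>M0. q (E M h) \<le> e * g ^ M}"

text \<open>Smallness at arbitrarily large \<open>M\<close> suffices: by \<open>E_step\<close>, once
  the tail of \<open>h\<close> is small, a small value remains small for all larger degrees.\<close>

lemma nul_I:
  assumes h: "h \<in> T N" and ex: "\<And>e M1. 0 < e \<Longrightarrow> \<exists>M\<ge>M1. q (E M h) \<le> e * g ^ M"
  shows "h \<in> nul"
  unfolding nul_def
proof (intro CollectI conjI h allI impI)
  fix e :: real assume e: "0 < e"
  obtain M0 where M0: "\<And>a. M0 < deg N a \<Longrightarrow> v (cf h a) \<le> e" using tail[OF h e] by blast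
  obtain M where M: "M \<ge> M0" "q (E M h) \<le> e * g ^ M" using ex[OF e] by blast
  have "q (E M' h) \<le> e * g ^ M'" if M': "M' \<ge> M" for M'
  proof -
    have "g ^ (M' - M) * q (E M h) \<le> g ^ (M' - M) * (e * g ^ M)" using M(2) g0 by (intro mult_left_mono) auto
    also have "\<dots> = e * g ^ M'" using M' by (simp add: power_add[symmetric])
    finally show ?thesis using E_step[OF h M' less_imp_le[OF e]] M0 M(1) by fastforce
  qed
  then show "\<exists>M0. \<forall>M\<ge>M0. q (E M h) \<le> e * g ^ M" by blast
qed

lemma nulD: assumes "h \<in> nul" "0 < e" obtains M0 where "\<And>M. M0 \<le> M \<Longrightarrow> q (E M h) \<le> e * g ^ M"
  using assms unfolding nul_def by blast

lemma common_bound: assumes "h \<in> T N" "k \<in> T N" obtains C where "1 \<le> C" "bd C h" "bd C k"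
proof -
  obtain r s where "bd r h" "bd s k" using T_bd assms by metis
  then show ?thesis using that[of "max 1 (max r s)"] bd_mono by (meson max.cobounded1 max.coboundedI2 max.cobounded2)
qed

lemma nul_submod: "submod (T N) nul"
  unfolding submod_def
proof (intro conjI ballI)
  have "E M 0 = 0" for M unfolding E_def by simp
  then have "q (E M 0) \<le> e * g ^ M" if "0 < e" for M e using that g0 seminormsD(2)[OF sq] by simp
  then show "0 \<in> nul" by (intro nul_I) auto
  fix h k assume hk: "h \<in> nul" "k \<in> nul"
  then have T: "h \<in> T N" "k \<in> T N" by (auto simp: nul_def)
  show "h + k \<in> nul"
  proof (rule nul_I[OF T_add[OF T]])
    fix e :: real and M1 assume e: "0 < e"
    obtain A where A: "\<And>M. A \<le> M \<Longrightarrow> q (E M h) \<le> e * g ^ M" using nulD[OF hk(1) e] by blast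
    obtain B where B: "\<And>M. B \<le> M \<Longrightarrow> q (E M k) \<le> e * g ^ M" using nulD[OF hk(2) e] by blast
    define M where "M = max M1 (max A B)"
    have "q (E M (h + k)) \<le> max (q (E M h)) (q (E M k))"
      unfolding E_diff by (rule seminorm_add[OF subrng_T sq E_T[OF T(1)] E_T[OF T(2)]])
    moreover have "q (E M h) \<le> e * g ^ M" by (rule A) (simp add: M_def)
    moreover have "q (E M k) \<le> e * g ^ M" by (rule B) (simp add: M_def)
    ultimately have "q (E M (h + k)) \<le> e * g ^ M" by simp
    then show "\<exists>M\<ge>M1. q (E M (h + k)) \<le> e * g ^ M" by (intro exI[of _ M]) (simp add: M_def)
  qed
next
  fix k h assume kT: "k \<in> T N" and h: "h \<in> nul"
  then have hT: "h \<in> T N" by (auto simp: nul_def)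
  have "h * k \<in> nul"
  proof (rule nul_I[OF T_mult[OF hT kT]])
    fix e :: real and M1 assume e: "0 < e"
    obtain C where C: "1 \<le> C" "bd C h" "bd C k" using common_bound[OF hT kT] .
    \<comment> \<open>Scaled so that the error \<open>d * C\<close> of \<open>E_mult\<close> is
      exactly \<open>e\<close>.\<close>
    define d where "d = e / C"
    have d: "0 < d" "d * C = e" using e C by (auto simp: d_def)
    obtain A where A: "\<And>a. A < deg N a \<Longrightarrow> v (cf h a) \<le> d" using tail[OF hT d(1)] by blast
    obtain B where B: "\<And>a. B < deg N a \<Longrightarrow> v (cf k a) \<le> d" using tail[OF kT d(1)] by blast
    obtain D where D: "\<And>M. D \<le> M \<Longrightarrow> q (E M h) \<le> d * g ^ M" using nulD[OF h d(1)] by blast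
    define M where "M = max M1 (max A (max B D))"
    have M: "M1 \<le> M" "A \<le> M" "B \<le> M" "D \<le> M" by (auto simp: M_def)
    have hk: "E M h \<in> T n" "E M k \<in> T n" by (rule E_T[OF hT], rule E_T[OF kT])
    have "q (E (M + M) (h * k) - E M h * E M k) \<le> d * C * g ^ (M + M)"
      using A B M d(1) by (intro E_mult hT kT C) auto
    then have 1: "q (E (M + M) (h * k) - E M h * E M k) \<le> e * g ^ (M + M)" by (simp add: d(2))
    have "q (E M k) \<le> C * g ^ M" using E_bound[of C k M] C by (auto simp: bd_def)
    then have "q (E M h) * q (E M k) \<le> (d * g ^ M) * (C * g ^ M)"
      using D[OF M(4)] q0[OF hk(2)] d(1) g0 by (intro mult_mono) auto
    also have "\<dots> = e * g ^ (M + M)" using d(2) by (simp add: power_add algebra_simps flip: d(2))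
    finally have 2: "q (E M h * E M k) \<le> e * g ^ (M + M)" using qm[OF hk] by simp
    have "q ((E (M + M) (h * k) - E M h * E M k) + E M h * E M k) \<le> max (q (E (M + M) (h * k) - E M h * E M k)) (q (E M h * E M k))"
      by (intro seminorm_add[OF subrng_T sq] T_diff E_T T_mult hT kT)
    then have "q (E (M + M) (h * k)) \<le> e * g ^ (M + M)" using 1 2 by simp
    then show "\<exists>M\<ge>M1. q (E M (h * k)) \<le> e * g ^ M" using M(1) by (intro exI[of _ "M + M"]) simp
  qed
  then show "k * h \<in> nul" by (simp add: mult.commute)
qed

text \<open>\<open>E M 1\<close> is \<open>G ^ M\<close>, with value exactly \<open>g ^ M\<close>.
  Here positivity of \<open>q G\<close> makes the ideal proper.\<close>

lemma one_notin_nul: "1 \<notin> nul"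
proof
  assume "1 \<in> nul"
  then obtain M where M: "\<And>M'. M \<le> M' \<Longrightarrow> q (E M' 1) \<le> (1 / 2) * g ^ M'" using nulD[of 1 "1 / 2"] by auto
  have "E M 1 = (\<Sum>a\<in>{0}. const (cf 1 a) * G ^ (M - deg N a) * mon N L a)"
    unfolding E_def by (rule sum.mono_neutral_right) (simp add: finite_Exp_le, auto simp: Exp_le_def cf_1)
  also have "\<dots> = G ^ M" by (simp add: cf_1)
  finally have "q (E M 1) = g ^ M" using qpow[OF G(1)] by (simp add: g_def)
  then show False using M[of M] zero_less_power[OF g0, of M] by simp
qed

lemma T_n_N: "T n \<subseteq> T N" by (rule T_mono) (simp add: N_def)

text \<open>On a series in the old variables the powers of \<open>G\<close> in numerator and
  denominator cancel, so \<open>E M h\<close> is \<open>G ^ M\<close> times a truncation of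
  \<open>h\<close>.\<close>

lemma E_lift:
  assumes h: "h \<in> T n" and e: "0 < e"
  obtains M0 where "\<And>M. M0 \<le> M \<Longrightarrow> q (E M h - G ^ M * h) \<le> e * g ^ M"
proof -
  have hN: "h \<in> T N" using h T_n_N by blast
  obtain M0 where M0: "\<And>a. M0 < deg N a \<Longrightarrow> v (cf h a) \<le> e" using tail[OF hN e] by blast
  have "q (E M h - G ^ M * h) \<le> e * g ^ M" if M: "M0 \<le> M" for M
  proof -
    define s where "s = (\<Sum>a\<in>Exp_le N M. const (cf h a) * mnm a)"
    have "E M h = G ^ M * s"
      unfolding E_def s_def sum_distrib_left
    proof (rule sum.cong)
      fix a assume a: "a \<in> Exp_le N M"
      show "const (cf h a) * G ^ (M - deg N a) * mon N L a = G ^ M * (const (cf h a) * mnm a)"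
      proof (cases "cf h a = 0")
        case False
        then have an: "a \<in> Exp n" using h by (simp add: T_def)
        have z: "Poly_Mapping.lookup a i = 0" if "n \<le> i" for i
        proof -
          have "i \<notin> Poly_Mapping.keys a" using an that by (auto simp: Exp_def)
          then show ?thesis by (simp add: in_keys_iff)
        qed
        have "mon N L a = (\<Prod>i<n. L i ^ Poly_Mapping.lookup a i)"
          unfolding mon_def using z by (intro prod.mono_neutral_right) (auto simp: N_def)
        also have "\<dots> = (\<Prod>i<n. var i ^ Poly_Mapping.lookup a i) * (\<Prod>i<n. G ^ Poly_Mapping.lookup a i)"
          unfolding prod.distrib[symmetric] by (intro prod.cong) (auto simp: L_def power_mult_distrib)
        also have "(\<Prod>i<n. G ^ Poly_Mapping.lookup a i) = G ^ deg N a"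
          unfolding power_sum[symmetric] deg_def using z
          by (intro arg_cong[of _ _ "(^) G"] sum.mono_neutral_left) (auto simp: N_def)
        finally have ml: "mon N L a = (\<Prod>i<n. var i ^ Poly_Mapping.lookup a i) * G ^ deg N a" .
        have "mon N L a = mnm a * G ^ deg N a" unfolding ml by (simp add: mnm_eq_mon[OF an] mon_def)
        moreover have "G ^ M = G ^ (M - deg N a) * G ^ deg N a" using a by (simp add: Exp_le_def power_add[symmetric])
        ultimately show ?thesis by (simp add: algebra_simps)
      qed simp
    qed simp
    then have "E M h - G ^ M * h = G ^ M * (s - h)" by (simp add: algebra_simps)
    moreover have cs: "cf s a = (cf h a when a \<in> Exp_le N M)" for a
      unfolding s_def by (rule cf_poly[OF finite_Exp_le])
    have "bd e (s - h)"
      unfolding bd_def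
    proof
      fix a
      show "v (cf (s - h) a) \<le> e"
      proof (cases "cf h a = 0 \<or> a \<in> Exp_le N M")
        case True then show ?thesis using e by (auto simp: cs when_def)
      next
        case False
        then have "a \<in> Exp N" using hN by (simp add: T_def)
        then have "M < deg N a" using False by (simp add: Exp_le_def)
        then show ?thesis using M0[of a] M False by (simp add: cs)
      qed
    qed
    moreover have sT: "s \<in> T n"
    proof -
      have "s = (\<Sum>a\<in>Exp_le N M \<inter> Exp n. const (cf h a) * mnm a)"
        unfolding s_def
      proof (rule sum.mono_neutral_right[OF finite_Exp_le])
        have "cf h i = 0" if "i \<notin> Exp n" for i using h that by (auto simp: T_def)
        then show "\<forall>i\<in>Exp_le N M - Exp_le N M \<inter> Exp n. const (cf h i) * mnm i = 0" by simp
      qed simp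
      then show ?thesis by (auto intro!: T_sum T_mult T_const T_mnm)
    qed
    ultimately show ?thesis
      using qm[OF T_power[OF G(1)] T_diff[OF sT h], of M] qb[OF T_diff[OF sT h]] qpow[OF G(1)] g0
      by (simp add: g_def mult.commute)
  qed
  then show ?thesis using that by blast
qed

lemma kernel_nul: assumes h: "h \<in> T n" "q h = 0" shows "h \<in> nul"
proof (rule nul_I)
  show hN: "h \<in> T N" using h T_n_N by blast
  fix e :: real and M1 assume e: "0 < e"
  obtain M0 where M0: "\<And>M. M0 \<le> M \<Longrightarrow> q (E M h - G ^ M * h) \<le> e * g ^ M" using E_lift[OF h(1) e] by blast
  define M where "M = max M0 M1"
  have GM: "G ^ M \<in> T n" by (rule T_power[OF G(1)])
  have "q (G ^ M * h) = 0" using qm[OF GM h(1)] h(2) by simp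
  moreover have "q ((E M h - G ^ M * h) + G ^ M * h) \<le> max (q (E M h - G ^ M * h)) (q (G ^ M * h))"
    by (intro seminorm_add[OF subrng_T sq] T_diff E_T[OF hN] T_mult GM h)
  moreover have "q (E M h - G ^ M * h) \<le> e * g ^ M" by (rule M0) (simp add: M_def)
  moreover have "0 \<le> e * g ^ M" using e g0 by simp
  ultimately have "q (E M h) \<le> e * g ^ M" by simp
  then show "\<exists>M\<ge>M1. q (E M h) \<le> e * g ^ M" by (intro exI[of _ M]) (simp add: M_def)
qed

text \<open>The defining relation of the new variable. For a single variable \<open>E M\<close> is
  exactly \<open>G ^ (M - 1) * H i\<close>, so only the approximations for \<open>G\<close>, for
  \<open>H i\<close> and for the product contribute errors.\<close>

lemma quotient_nul: assumes i: "i < m" shows "G * var (n + i) - H i \<in> nul"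
proof (rule nul_I)
  have iN: "n + i < N" using i by (simp add: N_def)
  have GN: "G \<in> T N" and HN: "H i \<in> T N" and XN: "var (n + i) \<in> T N"
    using G(1) H(1)[OF i] T_n_N T_var[OF iN] by auto
  show "G * var (n + i) - H i \<in> T N" by (intro T_diff T_mult GN HN XN)
  fix e :: real and M1 assume e: "0 < e"
  obtain C where C: "1 \<le> C" "bd C G" "bd C (var (n + i) :: 'k mser)" using common_bound[OF GN XN] .
  define d where "d = e / C"
  have d: "0 < d" "d * C = e" "d \<le> e" using e C by (auto simp: d_def field_simps)
  obtain A where A: "\<And>a. A < deg N a \<Longrightarrow> v (cf G a) \<le> d" using tail[OF GN d(1)] by blast
  obtain B where B: "\<And>a. B < deg N a \<Longrightarrow> v (cf (var (n + i) :: 'k mser) a) \<le> d" using tail[OF XN d(1)] by blast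
  obtain D where D: "\<And>M. D \<le> M \<Longrightarrow> q (E M G - G ^ M * G) \<le> e * g ^ M" using E_lift[OF G(1) e] by blast
  obtain F where F: "\<And>M. F \<le> M \<Longrightarrow> q (E M (H i) - G ^ M * H i) \<le> e * g ^ M" using E_lift[OF H(1)[OF i] e] by blast
  \<comment> \<open>The successor guarantees \<open>1 \<le> M\<close>, so that the variable, of
    degree 1, survives the truncation.\<close>
  define M where "M = Suc (max M1 (max A (max B (max D F))))"
  have M: "M1 \<le> M" "A \<le> M" "B \<le> M" "D \<le> M" "F \<le> M" "1 \<le> M" by (auto simp: M_def)
  let ?X = "var (n + i) :: 'k mser"
  let ?s = "Poly_Mapping.single (n + i) (1::nat)"
  have ds: "deg N ?s = 1"
  proof -
    have "deg N ?s = (\<Sum>j<N. if j = n + i then 1 else 0)"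
      unfolding deg_def by (rule sum.cong) (auto simp: lookup_single when_def)
    then show ?thesis using iN by simp
  qed
  have "E M ?X = (\<Sum>a\<in>{?s}. const (cf ?X a) * G ^ (M - deg N a) * mon N L a)"
    unfolding E_def
  proof (rule sum.mono_neutral_right[OF finite_Exp_le])
    show "{?s} \<subseteq> Exp_le N M" using M(6) ds Exp_single[OF iN, of 1] by (simp add: Exp_le_def)
  qed (auto simp: var_def cf_mnm when_def)
  also have "\<dots> = G ^ (M - 1) * H i"
    by (simp add: var_def cf_mnm ds[unfolded One_nat_def] mon_single[OF iN, of L 1, simplified]) (simp add: L_def)
  finally have EX: "E M ?X = G ^ (M - 1) * H i" .
  have T': "G ^ (M - 1) \<in> T n" "H i \<in> T n" "E M G \<in> T n" "G ^ M * G \<in> T n" "E M ?X \<in> T n"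
    "E (M + M) (G * ?X) \<in> T n" "E (M + M) (H i) \<in> T n" "G ^ (M + M) * H i \<in> T n"
    by (intro T_mult T_power G(1) H(1)[OF i] E_T GN HN XN)+
  have 1: "q (E (M + M) (G * ?X) - E M G * E M ?X) \<le> e * g ^ (M + M)"
  proof -
    have "q (E (M + M) (G * ?X) - E M G * E M ?X) \<le> d * C * g ^ (M + M)"
      using A B M d(1) by (intro E_mult GN XN C) auto
    then show ?thesis by (simp add: d(2))
  qed
  have "G ^ M * G * E M ?X = G ^ (M + M) * H i"
    unfolding EX using M(6) by (simp add: power_add[symmetric] algebra_simps flip: power_Suc)
  then have 2: "E M G * E M ?X - G ^ (M + M) * H i = (E M G - G ^ M * G) * E M ?X" by (simp add: algebra_simps)
  have "q (E M ?X) \<le> g ^ (M - 1) * g"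
    unfolding EX using qm[OF T'(1,2)] qpow[OF G(1)] H(2)[OF i] g0 by (simp add: g_def)
  then have EXg: "q (E M ?X) \<le> g ^ M" using M(6) by (metis Suc_diff_1 less_eq_Suc_le One_nat_def power_Suc2)
  have "q (E M G - G ^ M * G) * q (E M ?X) \<le> (e * g ^ M) * g ^ M"
    using D[OF M(4)] EXg q0[OF T'(5)] e g0 by (intro mult_mono) auto
  then have 3: "q (E M G * E M ?X - G ^ (M + M) * H i) \<le> e * g ^ (M + M)"
    unfolding 2 qm[OF T_diff[OF T'(3,4)] T'(5)] by (simp add: power_add algebra_simps)
  have 4: "q (E (M + M) (H i) - G ^ (M + M) * H i) \<le> e * g ^ (M + M)" using F[of "M + M"] M(5) by simp
  \<comment> \<open>The value in question is \<open>?a + ?b - ?c\<close>: \<open>?a\<close> is the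
    error of multiplicativity, \<open>?b\<close> and \<open>?c\<close> are the errors of replacing
    \<open>G\<close> and \<open>H i\<close> by their lifts.\<close>
  let ?a = "E (M + M) (G * ?X) - E M G * E M ?X" and ?b = "E M G * E M ?X - G ^ (M + M) * H i"
    and ?c = "E (M + M) (H i) - G ^ (M + M) * H i"
  have abc: "?a \<in> T n" "?b \<in> T n" "?c \<in> T n" using T' by (auto intro!: T_diff T_mult)
  have "q (?a + ?b) \<le> max (q ?a) (q ?b)" by (rule seminorm_add[OF subrng_T sq abc(1,2)])
  then have 5: "q (?a + ?b) \<le> e * g ^ (M + M)" by (rule order_trans) (rule max.boundedI[OF 1 3])
  have "q ((?a + ?b) - ?c) \<le> max (q (?a + ?b)) (q ?c)" by (rule seminormsD(5)[OF sq T_add[OF abc(1,2)] abc(3)])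
  then have 6: "q ((?a + ?b) - ?c) \<le> e * g ^ (M + M)" by (rule order_trans) (rule max.boundedI[OF 5 4])
  have "(?a + ?b) - ?c = E (M + M) (G * ?X - H i)" unfolding E_diff by simp
  then have "q (E (M + M) (G * ?X - H i)) \<le> e * g ^ (M + M)" using 6 by metis
  then show "\<exists>M\<ge>M1. q (E M (G * ?X - H i)) \<le> e * g ^ M" using M(1) by (intro exI[of _ "M + M"]) simp
qed

text \<open>At a maximal ideal above \<open>nul\<close> the function \<open>H i\<close> equals
  \<open>G\<close> times a variable, and Gauss boundedness makes the variable at most 1. Restricted
  to \<open>T n\<close>, the absolute value belongs to the contracted maximal ideal, which contains
  the kernel of \<open>q\<close>.\<close>

theorem rational_point_exists:
  "\<exists>y w. maxid (T n) y \<and> (\<forall>h\<in>T n. q h = 0 \<longrightarrow> h \<in> y) \<and> abs_on n y w \<and> gauss_bounded n w \<and>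
     (\<forall>i<m. w (H i) \<le> w G)"
proof -
  have "nul \<subseteq> T N" by (auto simp: nul_def)
  then obtain x where x: "maxid (T N) x" "nul \<subseteq> x" using exists_maxid[OF subrng_T _ nul_submod one_notin_nul] by blast
  interpret M: max_ideal v N x by unfold_locales (rule x(1))
  obtain w where w: "abs_on N x w" "gauss_bounded N w" using M.exists_abs by blast
  have mw: "w \<in> mult_seminorms (T N)" using w(1) by (simp add: abs_on_def)
  note sw = mult_seminormsD(1)[OF mw]
  have nN: "n \<le> N" by (simp add: N_def)
  define w' where "w' f = (if f \<in> T n then w f else 0)" for f
  have w'T: "w' f = w f" if "f \<in> T n" for f using that by (simp add: w'_def)
  have "w' \<in> mult_seminorms (T n)"
    unfolding mult_seminorms_def seminorms_def
    using mult_seminormsD(2)[OF mw] seminormsD[OF sw] T_n_N T_1 T_mult T_diff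
    by (auto simp: w'_def subset_iff)
  then have "abs_on n (x \<inter> T n) w'"
    using w(1) T_n_N T_const by (auto simp: abs_on_def w'T subset_iff)
  moreover have "gauss_bounded n w'" using w(2) T_n_N by (auto simp: gauss_bounded_def w'T subset_iff)
  moreover have "maxid (T n) (x \<inter> T n)" by (rule M.maxid_restrict[OF nN])
  moreover have "\<forall>h\<in>T n. q h = 0 \<longrightarrow> h \<in> x \<inter> T n" using kernel_nul x(2) by blast
  moreover have "w' (H i) \<le> w' G" if i: "i < m" for i
  proof -
    have iN: "n + i < N" using i by (simp add: N_def)
    have GN: "G \<in> T N" and HN: "H i \<in> T N" and XN: "var (n + i) \<in> T N"
      using G(1) H(1)[OF i] T_n_N T_var[OF iN] by auto
    have GX: "G * var (n + i) \<in> T N" by (rule T_mult[OF GN XN])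
    have "G * var (n + i) - H i \<in> x" using quotient_nul[OF i] x(2) by blast
    then have "w (G * var (n + i) - H i) = 0" using w(1) T_diff[OF GX HN] by (simp add: abs_on_def)
    then have "w (H i) = w G * w (var (n + i))"
      using seminorm_cong[OF subrng_T sw GX HN] mult_seminormsD(2)[OF mw GN XN] by simp
    also have "\<dots> \<le> w G * 1"
      using w(2) XN bd_var seminormsD(1)[OF sw GN] unfolding gauss_bounded_def by (intro mult_left_mono) blast+
    finally show ?thesis using w'T[OF G(1)] w'T[OF H(1)[OF i]] by simp
  qed
  ultimately show ?thesis by blast
qed

end

section \<open>Affinoid algebras\<close>

lemma mult_seminormsI:
  assumes S: "subrng S" and w: "\<And>f. f \<notin> S \<Longrightarrow> w f = 0" "\<And>f. f \<in> S \<Longrightarrow> 0 \<le> w f" "w 0 = 0" "w 1 = 1"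
    and m: "\<And>f g. f \<in> S \<Longrightarrow> g \<in> S \<Longrightarrow> w (f * g) = w f * w g"
    and a: "\<And>f g. f \<in> S \<Longrightarrow> g \<in> S \<Longrightarrow> w (f + g) \<le> max (w f) (w g)"
  shows "w \<in> mult_seminorms S"
proof -
  note SD = subrngD[OF S]
  have n1: "- 1 \<in> S" by (intro SD)
  have "w (- 1) * w (- 1) = 1" using m[OF n1 n1] w(4) by simp
  then have "w (- 1) = 1" using w(2)[OF n1] by (metis abs_of_nonneg abs_mult_self_eq abs_one mult_cancel_left1 power2_eq_square power2_eq_1_iff abs_minus_cancel)
  then have "w (- g) = w g" if "g \<in> S" for g using m[OF n1 that] by simp
  then have "w (f - g) \<le> max (w f) (w g)" if "f \<in> S" "g \<in> S" for f g
    using a[OF that(1) SD(6)[OF that(2)]] that by simp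
  then show ?thesis unfolding mult_seminorms_def seminorms_def using w m by auto
qed

context complete_nonarch_field
begin

text \<open>Roots of powers of a single \<open>v c > 1\<close> suffice. When a power of the ratio of
  the end points exceeds \<open>v c\<close>, some power of \<open>v c\<close> falls between the
  corresponding powers of the end points, and its root lies in the interval.\<close>

lemma sqrt_value_group_dense:
  assumes ab: "0 \<le> a" "a < b"
  obtains r where "r \<in> sqrt_value_group v" "a < r" "r < b"
proof -
  \<comment> \<open>A positive left end, so that scaling by a power of \<open>v c\<close> can move
    the interval above 1.\<close>
  define a0 where "a0 = max a (b / 2)"
  have a0: "0 < a0" "a0 < b" "a \<le> a0" using ab by (auto simp: a0_def)
  obtain c where c: "c \<noteq> 0" "1 < v c" using huge_const[of 1] by blast
  define t where "t = v c"
  have t: "1 < t" using c by (simp add: t_def)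
  obtain M where M: "1 / a0 < t ^ M" using real_arch_pow[OF t] by blast
  define a1 where "a1 = a0 * t ^ M"
  define b1 where "b1 = b * t ^ M"
  have tM: "0 < t ^ M" using t by simp
  have a1: "1 < a1" using M a0 by (simp add: a1_def field_simps)
  have b1: "a1 < b1" using a0 tM by (simp add: a1_def b1_def)
  have "1 < b1 / a1" using a1 b1 by simp
  then obtain k where k: "t < (b1 / a1) ^ k" using real_arch_pow by blast
  then have k0: "k \<noteq> 0" using t by (intro notI) simp
  have "\<exists>j. a1 ^ k < t ^ j" using real_arch_pow[OF t] by blast
  \<comment> \<open>The first power of \<open>t\<close> beyond \<open>a1 ^ k\<close>. It exceeds
    \<open>a1 ^ k\<close> at most by the factor \<open>t\<close>, which is less than
    \<open>(b1 / a1) ^ k\<close>, and so stays below \<open>b1 ^ k\<close>.\<close>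
  define j where "j = (LEAST j. a1 ^ k < t ^ j)"
  have j: "a1 ^ k < t ^ j" unfolding j_def by (rule LeastI_ex) fact
  have "1 \<le> a1 ^ k" using a1 by simp
  then have "j \<noteq> 0" using j by (intro notI) simp
  then obtain i where i: "j = Suc i" using not0_implies_Suc by blast
  have "\<not> a1 ^ k < t ^ i" using not_less_Least[of i "\<lambda>j. a1 ^ k < t ^ j"] i unfolding j_def[symmetric] by simp
  then have "t ^ j \<le> t * a1 ^ k" using t i by simp
  also have "\<dots> < (b1 / a1) ^ k * a1 ^ k" using k a1 by (intro mult_strict_right_mono) auto
  also have "\<dots> = b1 ^ k" using a1 by (simp add: power_divide)
  finally have jb: "t ^ j < b1 ^ k" .
  define s where "s = root k (t ^ j)"
  have s: "s ^ k = t ^ j" "0 \<le> s" using k0 t by (simp_all add: s_def)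
  have as: "a1 < s" by (rule power_less_imp_less_base[of _ k]) (use j s in auto)
  have sb: "s < b1" by (rule power_less_imp_less_base[of _ k]) (use jb s b1 a1 in auto)
  define r where "r = s / t ^ M"
  have "r \<in> sqrt_value_group v"
    unfolding sqrt_value_group_def
  proof (intro CollectI conjI exI)
    show "0 < r" using as a1 tM by (simp add: r_def)
    show "k \<ge> 1" using k0 by simp
    show "r ^ k = v (c ^ j / (c ^ M) ^ k)" by (simp add: r_def power_divide s v_divide v_power t_def)
  qed
  moreover have "a0 < r" using as tM by (simp add: r_def a1_def field_simps)
  then have "a < r" using a0(3) by simp
  moreover have "r < b" using sb tM by (simp add: r_def b1_def field_simps)
  ultimately show ?thesis using that by blast
qed

end

text \<open>The points of the Berkovich space without boundedness, which is kept apart because it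
  refers to a presentation.\<close>

definition seminorm_points :: "('a, 'm) ring_scheme \<Rightarrow> ('a \<Rightarrow> real) set" where
  "seminorm_points A = {p \<in> carrier A \<rightarrow>\<^sub>E {0..}. p \<zero>\<^bsub>A\<^esub> = 0 \<and> p \<one>\<^bsub>A\<^esub> = 1 \<and>
     (\<forall>f\<in>carrier A. \<forall>g\<in>carrier A.
        p (f \<otimes>\<^bsub>A\<^esub> g) = p f * p g \<and> p (f \<oplus>\<^bsub>A\<^esub> g) \<le> max (p f) (p g))}"

section \<open>Transfer between an affinoid algebra and a Tate algebra presenting it\<close>

locale presented = complete_nonarch_field v for v :: "'k::field \<Rightarrow> real" +
  fixes A :: "('a, 'm) ring_scheme" (structure) and \<sigma> :: "'k \<Rightarrow> 'a" and n :: nat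
    and \<pi> :: "((nat \<Rightarrow>\<^sub>0 nat) \<Rightarrow> 'k) \<Rightarrow> 'a"
  assumes cring_A: "cring A" and pres: "presentation v A \<sigma> n \<pi>"
begin

sublocale cring A by (rule cring_A)

definition P :: "'k mser \<Rightarrow> 'a" where "P f = \<pi> (cf f)"

lemma carrier_tate: "f \<in> T n \<longleftrightarrow> cf f \<in> carrier (tate_algebra v n)"
  by (simp add: T_restricted tate_algebra_def)

lemma pi_hom: "\<pi> \<in> ring_hom (tate_algebra v n) A" and pi_surj: "\<pi> ` carrier (tate_algebra v n) = carrier A"
  and pi_const: "\<pi> (\<lambda>m. c when m = 0) = \<sigma> c"
  using pres by (auto simp: presentation_def)

lemma P_closed [simp]: "f \<in> T n \<Longrightarrow> P f \<in> carrier A"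
  unfolding P_def pi_surj[symmetric] carrier_tate by (rule imageI)

lemma P_surj: assumes "a \<in> carrier A" obtains f where "f \<in> T n" "P f = a"
proof -
  obtain t where t: "t \<in> carrier (tate_algebra v n)" "\<pi> t = a" using assms unfolding pi_surj[symmetric] by blast
  then have "Ser t \<in> T n" "P (Ser t) = a" by (simp_all add: carrier_tate P_def)
  then show ?thesis using that by blast
qed

lemma P_mult: assumes "f \<in> T n" "g \<in> T n" shows "P (f * g) = P f \<otimes> P g"
proof -
  have "cf (f * g) = cf f \<otimes>\<^bsub>tate_algebra v n\<^esub> cf g" by (rule ext) (simp add: tate_algebra_def cf_mult)
  then show ?thesis using ring_hom_mult[OF pi_hom] assms by (simp add: P_def carrier_tate)
qed

lemma P_add: assumes "f \<in> T n" "g \<in> T n" shows "P (f + g) = P f \<oplus> P g"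
proof -
  have "cf (f + g) = cf f \<oplus>\<^bsub>tate_algebra v n\<^esub> cf g" by (rule ext) (simp add: tate_algebra_def)
  then show ?thesis using ring_hom_add[OF pi_hom] assms by (simp add: P_def carrier_tate)
qed

lemma P_1: "P 1 = \<one>"
proof -
  have "cf (1 :: 'k mser) = \<one>\<^bsub>tate_algebra v n\<^esub>" by (rule ext) (simp add: tate_algebra_def cf_1)
  then show ?thesis using ring_hom_one[OF pi_hom] by (simp add: P_def)
qed

lemma P_const: "P (const c) = \<sigma> c"
  using pi_const by (simp add: P_def const_def)

lemma P_0: "P 0 = \<zero>"
proof -
  have "P 0 \<oplus> P 0 = P 0" using P_add[OF T_0 T_0] by simp
  then show ?thesis using P_closed[OF T_0] add.l_cancel_one by blast
qed

lemma P_uminus: assumes "f \<in> T n" shows "P (- f) = \<ominus> P f"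
proof -
  have "P (- f) \<oplus> P f = \<zero>" using P_add[OF T_uminus[OF assms] assms] P_0 by simp
  then show ?thesis using assms T_uminus[OF assms] by (simp add: minus_equality)
qed

lemma P_diff: assumes "f \<in> T n" "g \<in> T n" shows "P (f - g) = P f \<ominus> P g"
  using P_add[OF assms(1) T_uminus[OF assms(2)]] P_uminus[OF assms(2)] by (simp add: minus_eq)

definition res :: "'a \<Rightarrow> real" where "res = residue_norm v n \<pi>"

lemma res_le: assumes f: "f \<in> T n" "bd r f" shows "res (P f) \<le> r"
proof -
  have nn: "0 \<le> gauss_norm v t" if "t \<in> carrier (tate_algebra v n)" for t
    using bd_nonneg[OF bd_gauss_norm[of "Ser t" n]] that by (simp add: carrier_tate)
  have "res (P f) \<le> gauss_norm v (cf f)"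
    unfolding res_def residue_norm_def
    by (rule cInf_lower) (use f nn in \<open>auto simp: carrier_tate P_def intro!: bdd_belowI[of _ 0]\<close>)
  also have "\<dots> \<le> r" using gauss_norm_le[OF f(1)] f(2) by simp
  finally show ?thesis .
qed

lemma res_less: assumes a: "a \<in> carrier A" "res a < r" obtains f where "f \<in> T n" "P f = a" "bd r f"
proof -
  obtain f0 where "f0 \<in> T n" "P f0 = a" using P_surj[OF a(1)] .
  then have ne: "{gauss_norm v t |t. t \<in> carrier (tate_algebra v n) \<and> \<pi> t = a} \<noteq> {}" (is "?M \<noteq> {}")
    by (auto simp: carrier_tate P_def)
  have "Inf ?M < r" using a(2) by (simp add: res_def residue_norm_def)
  from cInf_lessD[OF ne this] obtain g where "g \<in> ?M" "g < r" ..
  then obtain t where t: "t \<in> carrier (tate_algebra v n)" "\<pi> t = a" "gauss_norm v t < r" by blast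
  then have "Ser t \<in> T n" "P (Ser t) = a" by (simp_all add: carrier_tate P_def)
  moreover have "bd r (Ser t)" using bd_gauss_norm[OF \<open>Ser t \<in> T n\<close>] t(3) by (auto intro: bd_mono)
  ultimately show ?thesis using that by blast
qed

lemma res_nonneg: assumes "a \<in> carrier A" shows "0 \<le> res a"
proof (rule dense_ge)
  fix r assume "res a < r"
  then show "0 \<le> r" using res_less[OF assms] bd_nonneg by metis
qed

subsection \<open>Maximal ideals\<close>

definition lift :: "'a set \<Rightarrow> 'k mser set" where "lift x = {f \<in> T n. P f \<in> x}"

lemma maxid_lift:
  assumes x: "maximalideal x A"
  shows "maxid (T n) (lift x)"
proof -
  interpret x: maximalideal x A by (rule x)
  interpret F: field "A Quot x" by (rule x.quotient_is_field[OF cring_A])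
  have one: "\<one> \<notin> x" using x.one_imp_carrier x.I_notcarr by blast
  have "submod (T n) (lift x)"
    unfolding submod_def lift_def
    using x.zero_closed x.I_l_closed x.a_closed by (auto simp: P_0 P_add P_mult T_add T_mult)
  moreover have "\<exists>z\<in>T n. f * z - 1 \<in> lift x" if f: "f \<in> T n" "f \<notin> lift x" for f
  proof -
    have Pf: "P f \<in> carrier A" "P f \<notin> x" using f by (auto simp: lift_def)
    have "x +> P f \<noteq> x" using Pf x.a_rcos_self by blast
    then have "x +> P f \<in> Units (A Quot x)"
      using Pf(1) F.field_Units by (auto simp: FactRing_def A_RCOSETS_def')
    then obtain c where c: "c \<in> carrier (A Quot x)" "(x +> P f) \<otimes>\<^bsub>A Quot x\<^esub> c = \<one>\<^bsub>A Quot x\<^esub>"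
      unfolding Units_def by blast
    obtain b where b: "b \<in> carrier A" "c = x +> b" using c(1) by (auto simp: FactRing_def A_RCOSETS_def')
    obtain z where z: "z \<in> T n" "P z = b" using P_surj[OF b(1)] .
    have "x +> (P f \<otimes> b) = x +> \<one>"
      using c(2) b x.rcoset_mult_add[OF Pf(1) b(1)] by (simp add: FactRing_def)
    then have "P f \<otimes> b \<ominus> \<one> \<in> x"
      using quotient_eq_iff_same_a_r_cos[OF x.is_ideal] Pf(1) b(1) by simp
    then have "P (f * z - 1) \<in> x" using f z by (simp add: P_diff P_mult P_1 T_mult T_1)
    then show ?thesis using z f by (auto simp: lift_def intro!: bexI[of _ z] T_diff T_mult T_1)
  qed
  ultimately show ?thesis unfolding maxid_def using one by (auto simp: lift_def P_1)
qed

lemma maximalideal_of_maxid: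
  assumes y: "maxid (T n) y" and ker: "\<And>h. h \<in> T n \<Longrightarrow> P h = \<zero> \<Longrightarrow> h \<in> y"
  shows "maximalideal (P ` y) A" "lift (P ` y) = y"
proof -
  note yD = maxidD[OF y]
  have inj: "f \<in> y" if f: "f \<in> T n" "P f \<in> P ` y" for f
  proof -
    obtain h where h: "h \<in> y" "P f = P h" using f(2) by blast
    have hT: "h \<in> T n" using h(1) yD(1) by blast
    have "P (f - h) = \<zero>" using h(2) f(1) hT by (simp add: P_diff minus_eq r_neg)
    then have "f - h \<in> y" using f(1) hT by (intro ker T_diff)
    then have "(f - h) + h \<in> y" using h(1) by (rule submodD(2)[OF yD(2)])
    then show ?thesis by simp
  qed
  show lift: "lift (P ` y) = y" using inj yD(1) by (auto simp: lift_def)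
  have id: "ideal (P ` y) A"
  proof (rule idealI[OF ring_axioms])
    show "subgroup (P ` y) (add_monoid A)"
    proof (rule add.subgroupI)
      show "P ` y \<subseteq> carrier A" using yD(1) by auto
      show "P ` y \<noteq> {}" using submodD(1)[OF yD(2)] by blast
      fix a assume "a \<in> P ` y"
      then obtain f where f: "f \<in> y" "a = P f" by blast
      then have "\<ominus> a = P (- f)" using yD(1) P_uminus by auto
      then show "\<ominus> a \<in> P ` y"
        using submod_uminus[OF subrng_T yD(2) f(1)] by simp
      fix b assume "b \<in> P ` y"
      then obtain g where g: "g \<in> y" "b = P g" by blast
      have "a \<oplus> b = P (f + g)" using f g yD(1) by (auto simp: P_add subset_iff)
      then show "a \<oplus> b \<in> P ` y" using submodD(2)[OF yD(2) f(1) g(1)] by simp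
    qed
    fix a b assume "a \<in> P ` y" and b: "b \<in> carrier A"
    then obtain f where f: "f \<in> y" "a = P f" by blast
    obtain g where g: "g \<in> T n" "P g = b" using P_surj[OF b] .
    have "b \<otimes> a = P (g * f)" using f g yD(1) by (auto simp: P_mult subset_iff)
    then show "b \<otimes> a \<in> P ` y" using submodD(3)[OF yD(2) g(1) f(1)] by simp
    then show "a \<otimes> b \<in> P ` y" using m_comm[of a b] b f yD(1) by auto
  qed
  have one: "\<one> \<notin> P ` y" using inj[OF T_1] yD(3) P_1 by auto
  show "maximalideal (P ` y) A"
  proof (rule maximalidealI[OF id])
    show "carrier A \<noteq> P ` y" using one by blast
    fix J assume J: "ideal J A" "P ` y \<subseteq> J" "J \<subseteq> carrier A"
    interpret J: ideal J A by (rule J(1))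
    show "J = P ` y \<or> J = carrier A"
    proof (rule disjCI)
      assume "J \<noteq> carrier A"
      then have nJ: "\<one> \<notin> J" using J.one_imp_carrier by blast
      have "b \<in> P ` y" if b: "b \<in> J" for b
      proof (rule ccontr)
        assume nb: "b \<notin> P ` y"
        have bc: "b \<in> carrier A" using b J(3) by blast
        obtain f where f: "f \<in> T n" "P f = b" using P_surj[OF bc] .
        then have "f \<notin> y" using nb by blast
        then obtain z where z: "z \<in> T n" "f * z - 1 \<in> y" using yD(4)[OF f(1)] by blast
        have "P (f * z - 1) \<in> J" using z(2) J(2) by blast
        moreover have "P f \<otimes> P z \<in> J" using b f z by (simp add: J.I_r_closed)
        ultimately have "P f \<otimes> P z \<ominus> P (f * z - 1) \<in> J"
          unfolding minus_eq by (intro J.a_closed J.a_inv_closed)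
        moreover have "P f \<otimes> P z \<ominus> P (f * z - 1) = P (f * z - (f * z - 1))"
          unfolding P_mult[OF f(1) z(1), symmetric]
          by (intro P_diff[symmetric] T_mult T_diff T_1 f z)
        ultimately show False using nJ P_1 by simp
      qed
      then show "J = P ` y" using J(2) by blast
    qed
  qed
qed

text \<open>\<open>w\<close> is constant on cosets and descends to the residue field, which gives
  existence. A competing absolute value, pulled back to \<open>T n\<close>, satisfies
  \<open>abs_on\<close> and agrees with \<open>w\<close> by \<open>abs_unique\<close>. Together they
  resolve the definite description.\<close>

lemma abs_at_eq:
  assumes x: "maximalideal x A" and w: "abs_on n (lift x) w" and f: "f \<in> T n"
  shows "abs_at v A \<sigma> (P f) x = w f"
proof -
  interpret x: maximalideal x A by (rule x)
  interpret M: max_ideal v n "lift x" by unfold_locales (rule maxid_lift[OF x])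
  note mw = w[unfolded abs_on_def, THEN conjunct1]
  note sw = mult_seminormsD(1)[OF mw]
  have carr: "\<exists>h. h \<in> T n \<and> X = x +> P h" if "X \<in> carrier (A Quot x)" for X
  proof -
    obtain a where "a \<in> carrier A" "X = x +> a" using \<open>X \<in> carrier (A Quot x)\<close> by (auto simp: FactRing_def A_RCOSETS_def')
    then show ?thesis using P_surj by metis
  qed
  have qm: "(x +> P h) \<otimes>\<^bsub>A Quot x\<^esub> (x +> P k) = x +> P (h * k)"
    and qa: "(x +> P h) \<oplus>\<^bsub>A Quot x\<^esub> (x +> P k) = x +> P (h + k)" if "h \<in> T n" "k \<in> T n" for h k
    using that by (simp_all add: FactRing_def x.rcoset_mult_add x.a_rcos_sum P_mult P_add)
  have q0: "x +> P h = \<zero>\<^bsub>A Quot x\<^esub> \<longleftrightarrow> P h \<in> x" if "h \<in> T n" for h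
    using that x.a_rcos_self[of "P h"] x.a_rcos_const[of "P h"] by (auto simp: FactRing_def)
  have qin: "x +> P h \<in> carrier (A Quot x)" if "h \<in> T n" for h
    using that by (auto simp: FactRing_def A_RCOSETS_def')
  define W where "W X = w (SOME h. h \<in> T n \<and> X = x +> P h)" for X
  have W: "W (x +> P h) = w h" if h: "h \<in> T n" for h
  proof -
    define k where "k = (SOME k. k \<in> T n \<and> x +> P h = x +> P k)"
    have k: "k \<in> T n" "x +> P h = x +> P k"
      using someI_ex[OF carr[OF qin[OF h]]] by (auto simp: k_def)
    have "P h \<ominus> P k \<in> x" using quotient_eq_iff_same_a_r_cos[OF x.is_ideal] h k by simp
    then have "h - k \<in> lift x" using h k by (simp add: lift_def P_diff T_diff)
    then have "w (h - k) = 0" using w T_diff[OF h k(1)] by (simp add: abs_on_def)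
    then show ?thesis using seminorm_cong[OF subrng_T sw h k(1)] by (simp add: W_def k_def)
  qed
  let ?Q = "\<lambda>r. \<exists>w. nonarch_absolute_value (A Quot x) w \<and> (\<forall>c. w (x +> \<sigma> c) = v c) \<and> r = w (x +> P f)"
  have "nonarch_absolute_value (A Quot x) W"
    unfolding nonarch_absolute_value_def
  proof (intro conjI ballI)
    fix X assume "X \<in> carrier (A Quot x)"
    then obtain h where h: "h \<in> T n" "X = x +> P h" using carr by blast
    show "0 \<le> W X" using W h seminormsD(1)[OF sw] by simp
    show "(W X = 0) = (X = \<zero>\<^bsub>A Quot x\<^esub>)" using W h q0 w by (simp add: abs_on_def lift_def)
    fix Y assume "Y \<in> carrier (A Quot x)"
    then obtain k where k: "k \<in> T n" "Y = x +> P k" using carr by blast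
    show "W (X \<otimes>\<^bsub>A Quot x\<^esub> Y) = W X * W Y"
      using h k W T_mult[OF h(1) k(1)] mult_seminormsD(2)[OF mw] by (simp add: qm)
    show "W (X \<oplus>\<^bsub>A Quot x\<^esub> Y) \<le> max (W X) (W Y)"
      using h k W T_add[OF h(1) k(1)] seminorm_add[OF subrng_T sw] by (simp add: qa)
  qed
  moreover have "W (x +> \<sigma> c) = v c" for c using W[OF T_const] w by (simp add: P_const abs_on_def)
  ultimately have "?Q (w f)" using W[OF f] by metis
  moreover have "r = w f" if "?Q r" for r
  proof -
    obtain u where u: "nonarch_absolute_value (A Quot x) u" "\<And>c. u (x +> \<sigma> c) = v c" "r = u (x +> P f)" using \<open>?Q r\<close> by blast
    define w' where "w' h = (if h \<in> T n then u (x +> P h) else 0)" for h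
    have w'T: "w' h = u (x +> P h)" if "h \<in> T n" for h using that by (simp add: w'_def)
    have u0: "0 \<le> u X" "u X = 0 \<longleftrightarrow> X = \<zero>\<^bsub>A Quot x\<^esub>" if "X \<in> carrier (A Quot x)" for X
      using u(1) that by (auto simp: nonarch_absolute_value_def)
    have um: "u (X \<otimes>\<^bsub>A Quot x\<^esub> Y) = u X * u Y" "u (X \<oplus>\<^bsub>A Quot x\<^esub> Y) \<le> max (u X) (u Y)"
      if "X \<in> carrier (A Quot x)" "Y \<in> carrier (A Quot x)" for X Y
      using u(1) that by (auto simp: nonarch_absolute_value_def)
    have c': "w' (const c) = v c" for c using w'T[OF T_const] u(2) by (simp add: P_const)
    have "w' \<in> mult_seminorms (T n)"
    proof (rule mult_seminormsI[OF subrng_T])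
      show "w' 0 = 0" "w' 1 = 1" using c'[of 0] c'[of 1] by simp_all
      fix h k assume hk: "h \<in> T n" "k \<in> T n"
      show "w' (h * k) = w' h * w' k"
        using um(1)[OF qin[OF hk(1)] qin[OF hk(2)]] T_mult[OF hk] hk by (simp add: w'T qm)
      show "w' (h + k) \<le> max (w' h) (w' k)"
        using um(2)[OF qin[OF hk(1)] qin[OF hk(2)]] T_add[OF hk] hk by (simp add: w'T qa)
    qed (use u0(1)[OF qin] in \<open>auto simp: w'_def\<close>)
    moreover have "w' h = 0 \<longleftrightarrow> h \<in> lift x" if "h \<in> T n" for h
      using u0(2)[OF qin[OF that]] that by (simp add: w'T q0 lift_def)
    ultimately have "abs_on n (lift x) w'" using c' by (simp add: abs_on_def)
    then show ?thesis using M.abs_unique[OF w _ f] u(3) f by (simp add: w'T)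
  qed
  ultimately show ?thesis unfolding abs_at_def by (intro the_equality)
qed

lemma abs_at_exists:
  assumes x: "maximalideal x A"
  obtains w where "abs_on n (lift x) w" "gauss_bounded n w" "\<And>f. f \<in> T n \<Longrightarrow> abs_at v A \<sigma> (P f) x = w f"
proof -
  interpret M: max_ideal v n "lift x" by unfold_locales (rule maxid_lift[OF x])
  obtain w where "abs_on n (lift x) w" "gauss_bounded n w" using M.exists_abs by blast
  then show ?thesis using that abs_at_eq[OF x] by blast
qed

section \<open>Seminorms pulled back to the Tate algebra, and density\<close>

definition pull :: "('a \<Rightarrow> real) \<Rightarrow> 'k mser \<Rightarrow> real" where
  "pull p f = (if f \<in> T n then p (P f) else 0)"

lemma pull_mult_seminorm:
  assumes p: "p \<in> seminorm_points A"
  shows "pull p \<in> mult_seminorms (T n)"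
proof (rule mult_seminormsI[OF subrng_T])
  show "pull p 0 = 0" "pull p 1 = 1" using p T_1 by (auto simp: pull_def P_0 P_1 seminorm_points_def)
  show "pull p (f * g) = pull p f * pull p g" "pull p (f + g) \<le> max (pull p f) (pull p g)"
    if "f \<in> T n" "g \<in> T n" for f g
    using that p by (simp_all add: pull_def T_mult T_add P_mult P_add seminorm_points_def)
qed (use p in \<open>auto simp: pull_def seminorm_points_def PiE_def Pi_def\<close>)

text \<open>The constant \<open>c\<close> disappears on passing to powers of \<open>f\<close>, since
  the pulled back seminorm is multiplicative.\<close>

lemma pull_gauss_bounded:
  assumes p: "p \<in> seminorm_points A" and c: "0 < c" "\<And>a. a \<in> carrier A \<Longrightarrow> p a \<le> c * res a"
  shows "gauss_bounded n (pull p)"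
  unfolding gauss_bounded_def
proof (intro ballI allI impI)
  fix f r assume f: "f \<in> T n" "bd r f"
  note mp = pull_mult_seminorm[OF p]
  show "pull p f \<le> r"
  proof (rule le_of_power_le[OF bd_nonneg[OF f(2)] seminormsD(1)[OF mult_seminormsD(1)[OF mp] f(1)] c(1)])
    fix k
    have fk: "f ^ k \<in> T n" by (rule T_power[OF f(1)])
    have "pull p f ^ k = pull p (f ^ k)" using mult_seminorm_power[OF subrng_T mp f(1)] by simp
    also have "\<dots> \<le> c * res (P (f ^ k))" using c(2) fk by (simp add: pull_def)
    also have "\<dots> \<le> c * r ^ k" using res_le[OF fk bd_power[OF f(2)]] c(1) by simp
    finally show "pull p f ^ k \<le> c * r ^ k" .
  qed
qed

text \<open>The conditions \<open>|a| \<le> \<alpha>\<close> and \<open>|b| \<ge> \<beta>\<close> are brought to the form \<open>|h| \<le> |G|\<close>, with \<open>G\<close> the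
  product of the normalised functions \<open>b\<close>; the function \<open>1\<close> is included to ensure \<open>G \<noteq> 0\<close>.\<close>

theorem density:
  assumes p: "p \<in> seminorm_points A" and gb: "gauss_bounded n (pull p)"
    and Fs: "finite Fs" "\<And>a r. (a, r) \<in> Fs \<Longrightarrow> a \<in> carrier A \<and> r \<in> sqrt_value_group v \<and> p a \<le> r"
    and Gs: "finite Gs" "\<And>a r. (a, r) \<in> Gs \<Longrightarrow> a \<in> carrier A \<and> r \<in> sqrt_value_group v \<and> r \<le> p a"
  shows "\<exists>x\<in>max_spec A. (\<forall>(a, r)\<in>Fs. abs_at v A \<sigma> a x \<le> r) \<and> (\<forall>(a, r)\<in>Gs. r \<le> abs_at v A \<sigma> a x)"
proof -
  let ?q = "pull p"
  note mq = pull_mult_seminorm[OF p]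
  have "\<exists>f k z. f \<in> T n \<and> P f = fst e \<and> 1 \<le> k \<and> z \<noteq> 0 \<and> snd e ^ k = v z \<and> 0 < snd e" if e: "e \<in> Fs \<union> Gs" for e
  proof -
    have e': "fst e \<in> carrier A" "snd e \<in> sqrt_value_group v" using e Fs(2)[of "fst e" "snd e"] Gs(2)[of "fst e" "snd e"] by auto
    then obtain z k where zk: "0 < snd e" "1 \<le> k" "snd e ^ k = v z" unfolding sqrt_value_group_def by blast
    then have "0 < v z" using zero_less_power[OF zk(1), of k] by simp
    then have "z \<noteq> 0" by auto
    then show ?thesis using P_surj[OF e'(1)] zk by metis
  qed
  then obtain f k z where fkz: "\<And>e. e \<in> Fs \<union> Gs \<Longrightarrow> f e \<in> T n \<and> P (f e) = fst e \<and> 1 \<le> k e \<and> z e \<noteq> 0 \<and> snd e ^ k e = v (z e) \<and> 0 < snd e"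
    by metis
  \<comment> \<open>Some power of the threshold is the value of a constant \<open>z e\<close>;
    dividing that power of \<open>f e\<close> by \<open>z e\<close> turns the threshold into
    1.\<close>
  define N where "N e = const (inverse (z e)) * f e ^ k e" for e
  have NT: "N e \<in> T n" if "e \<in> Fs \<union> Gs" for e using fkz[OF that] by (auto simp: N_def intro!: T_mult T_const T_power)
  have Nw: "w (N e) \<le> 1 \<longleftrightarrow> w (f e) \<le> snd e" "1 \<le> w (N e) \<longleftrightarrow> snd e \<le> w (f e)"
    if e: "e \<in> Fs \<union> Gs" and w: "w \<in> mult_seminorms (T n)" "\<And>c. w (const c) = v c" for e w
  proof -
    have f: "f e \<in> T n" "1 \<le> k e" "z e \<noteq> 0" "snd e ^ k e = v (z e)" "0 < snd e" using fkz[OF e] by auto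
    have w0: "0 \<le> w (f e)" by (rule seminormsD(1)[OF mult_seminormsD(1)[OF w(1)] f(1)])
    have "w (N e) = w (f e) ^ k e / snd e ^ k e"
      using mult_seminormsD(2)[OF w(1) T_const T_power[OF f(1)]] mult_seminorm_power[OF subrng_T w(1) f(1)] w(2) f(4)
      by (simp add: N_def v_inverse divide_inverse mult.commute)
    moreover have "w (f e) ^ k e \<le> snd e ^ k e \<longleftrightarrow> w (f e) \<le> snd e" "snd e ^ k e \<le> w (f e) ^ k e \<longleftrightarrow> snd e \<le> w (f e)"
      using w0 f(2,5) power_mono_iff[of "w (f e)" "snd e" "k e"] power_mono_iff[of "snd e" "w (f e)" "k e"] by auto
    ultimately show "w (N e) \<le> 1 \<longleftrightarrow> w (f e) \<le> snd e" "1 \<le> w (N e) \<longleftrightarrow> snd e \<le> w (f e)"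
      using f(5) by (simp_all add: divide_le_eq le_divide_eq)
  qed
  have prodw: "w (prod N S) = (\<Prod>e\<in>S. w (N e))" if "S \<subseteq> Fs \<union> Gs" "w \<in> mult_seminorms (T n)" for S w
    using \<open>S \<subseteq> Fs \<union> Gs\<close>
  proof (induction S rule: infinite_finite_induct)
    case (insert e S)
    have "N e \<in> T n" "prod N S \<in> T n" using insert.prems NT by (auto intro!: T_prod)
    then have "w (N e * prod N S) = w (N e) * w (prod N S)" by (rule mult_seminormsD(2)[OF that(2)])
    then show ?case using insert by simp
  qed (use that(2) in \<open>auto simp: seminormsD(3)[OF mult_seminormsD(1)]\<close>)
  have prodT: "prod N S \<in> T n" if "S \<subseteq> Fs \<union> Gs" for S using NT that by (intro T_prod) blast
  have qc: "?q (const c) = v c" for c by (rule gauss_bounded_const[OF mq gb])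
  have qF: "?q (N e) \<le> 1" if "e \<in> Fs" for e
  proof -
    have "?q (f e) \<le> snd e" using Fs(2)[of "fst e" "snd e"] that fkz[of e] by (simp add: pull_def)
    then show ?thesis using Nw(1)[OF _ mq qc] that by blast
  qed
  have qG: "1 \<le> ?q (N e)" if "e \<in> Gs" for e
  proof -
    have "snd e \<le> ?q (f e)" using Gs(2)[of "fst e" "snd e"] that fkz[of e] by (simp add: pull_def)
    then show ?thesis using Nw(2)[OF _ mq qc] that by blast
  qed
  define G where "G = prod N Gs"
  have GT: "G \<in> T n" unfolding G_def by (rule prodT) simp
  have qGG: "?q (prod N S) \<ge> 1" if "S \<subseteq> Gs" for S
  proof -
    have S: "S \<subseteq> Fs \<union> Gs" "\<And>e. e \<in> S \<Longrightarrow> 1 \<le> ?q (N e)" using that qG by auto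
    then show ?thesis unfolding prodw[OF S(1) mq] by (intro prod_ge_1) auto
  qed
  \<comment> \<open>For \<open>e\<close> in \<open>Fs\<close>, cancelling \<open>G\<close> from
    \<open>N e * G \<le> G\<close> bounds \<open>N e\<close> by 1. For \<open>e\<close> in
    \<open>Gs\<close>, the product of the other factors is at most \<open>G\<close>, and cancelling
    this nonzero product bounds \<open>N e\<close> from below by 1.\<close>
  define Hs where "Hs = insert 1 ((\<lambda>e. N e * G) ` Fs \<union> (\<lambda>e. prod N (Gs - {e})) ` Gs)"
  have HsT: "h \<in> T n \<and> ?q h \<le> ?q G" if h: "h \<in> Hs" for h
  proof -
    consider "h = 1" | e where "e \<in> Fs" "h = N e * G" | e where "e \<in> Gs" "h = prod N (Gs - {e})"
      using h unfolding Hs_def by blast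
    then show ?thesis
    proof cases
      case 1
      then show ?thesis using T_1 qGG[of Gs] seminormsD(3)[OF mult_seminormsD(1)[OF mq]] by (simp add: G_def)
    next
      case (2 e)
      then have "?q h = ?q (N e) * ?q G" using mult_seminormsD(2)[OF mq NT GT] by simp
      also have "\<dots> \<le> 1 * ?q G" using qF[OF 2(1)] qGG[of Gs] by (intro mult_right_mono) (auto simp: G_def)
      finally show ?thesis using 2 NT T_mult[OF NT GT] by simp
    next
      case (3 e)
      have hT: "h \<in> T n" unfolding 3(2) by (rule prodT) blast
      have "G = N e * h" using Gs(1) 3 by (simp add: G_def prod.remove)
      then have "?q G = ?q (N e) * ?q h" using mult_seminormsD(2)[OF mq NT hT] 3(1) by simp
      moreover have "1 * ?q h \<le> ?q (N e) * ?q h"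
        using qG[OF 3(1)] seminormsD(1)[OF mult_seminormsD(1)[OF mq] hT] by (intro mult_right_mono) auto
      ultimately show ?thesis using hT by simp
    qed
  qed
  have "finite Hs" using Fs(1) Gs(1) by (simp add: Hs_def)
  then obtain m H where H: "Hs = H ` {i::nat. i < m}" using finite_imp_nat_seg_image_inj_on by metis
  interpret Q: rational_point v n m ?q G H
  proof unfold_locales
    show "pull p \<in> mult_seminorms (T n)" "gauss_bounded n (pull p)" by fact+
    show "G \<in> T n" by fact
    show "0 < pull p G" using qGG[of Gs] by (simp add: G_def)
    show "H i \<in> T n" "pull p (H i) \<le> pull p G" if "i < m" for i using HsT[of "H i"] that H by auto
  qed
  obtain y w where y: "maxid (T n) y" "\<forall>h\<in>T n. ?q h = 0 \<longrightarrow> h \<in> y" and w: "abs_on n y w"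
    and wH: "\<forall>i<m. w (H i) \<le> w G" using Q.rational_point_exists by blast
  have wHs: "w h \<le> w G" if "h \<in> Hs" for h using wH that H by auto
  have ker: "h \<in> y" if "h \<in> T n" "P h = \<zero>" for h using y(2) p that by (simp add: pull_def seminorm_points_def)
  define x where "x = P ` y"
  have x: "maximalideal x A" "lift x = y" using maximalideal_of_maxid[OF y(1) ker] by (auto simp: x_def)
  have mw: "w \<in> mult_seminorms (T n)" and wc: "\<And>c. w (const c) = v c" using w by (auto simp: abs_on_def)
  have ab: "abs_at v A \<sigma> (fst e) x = w (f e)" if "e \<in> Fs \<union> Gs" for e
    using abs_at_eq[OF x(1) _, of w "f e"] w x(2) fkz[OF that] by simp
  have wG1: "1 \<le> w G" using wHs[of 1] seminormsD(3)[OF mult_seminormsD(1)[OF mw]] by (simp add: Hs_def)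
  have "abs_at v A \<sigma> (fst e) x \<le> snd e" if e: "e \<in> Fs" for e
  proof -
    have "w (N e * G) \<le> w G" using e by (intro wHs) (simp add: Hs_def)
    then have "w (N e) * w G \<le> 1 * w G" using mult_seminormsD(2)[OF mw NT GT] e by simp
    then have "w (N e) \<le> 1" using wG1 by (simp add: mult_le_cancel_right)
    then show ?thesis using Nw(1)[OF _ mw wc] ab e by auto
  qed
  moreover have "snd e \<le> abs_at v A \<sigma> (fst e) x" if e: "e \<in> Gs" for e
  proof -
    let ?h = "prod N (Gs - {e})"
    have hT: "?h \<in> T n" by (rule prodT) blast
    have hG: "w ?h \<le> w G" using e by (intro wHs) (simp add: Hs_def)
    have "G = N e * ?h" using Gs(1) e by (simp add: G_def prod.remove)
    then have wG: "w G = w (N e) * w ?h" using mult_seminormsD(2)[OF mw NT hT] e by simp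
    have h0: "0 < w ?h"
      using wG wG1 seminormsD(1)[OF mult_seminormsD(1)[OF mw] hT] by (cases "w ?h = 0") auto
    have "1 * w ?h \<le> w (N e) * w ?h" using hG wG by simp
    then have "1 \<le> w (N e)" using mult_le_cancel_right_pos[OF h0] by blast
    then show ?thesis using Nw(2)[OF _ mw wc] ab e by auto
  qed
  ultimately show ?thesis using x(1) unfolding max_spec_def by (intro bexI[of _ x]) auto
qed

end

context presented
begin

section \<open>The Berkovich space and the embedding of the maximal spectrum\<close>

lemma seminorm_points_pos: "p \<in> seminorm_points A \<Longrightarrow> a \<in> carrier A \<Longrightarrow> 0 \<le> p a"
  by (auto simp: seminorm_points_def PiE_def Pi_def)

text \<open>Boundedness does not depend on the presentation: otherwise the maximal ideals, whose absolute
  values are bounded by every residue norm, would not be dense.\<close>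

lemma berkovich_space_eq:
  "berkovich_space v A \<sigma> = {p \<in> seminorm_points A. \<forall>a\<in>carrier A. p a \<le> res a}"
proof (intro equalityI subsetI)
  fix p assume "p \<in> {p \<in> seminorm_points A. \<forall>a\<in>carrier A. p a \<le> res a}"
  then have p: "p \<in> seminorm_points A" "\<forall>a\<in>carrier A. p a \<le> 1 * residue_norm v n \<pi> a" by (auto simp: res_def)
  then have "\<exists>n \<pi>. presentation v A \<sigma> n \<pi> \<and> (\<exists>c>0. \<forall>f\<in>carrier A. p f \<le> c * residue_norm v n \<pi> f)"
    using pres zero_less_one by blast
  then show "p \<in> berkovich_space v A \<sigma>" using p(1) by (simp add: berkovich_space_def seminorm_points_def)
next
  fix p assume p: "p \<in> berkovich_space v A \<sigma>"
  then have ps: "p \<in> seminorm_points A" by (simp add: berkovich_space_def seminorm_points_def)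
  obtain n1 \<pi>1 c where 1: "presentation v A \<sigma> n1 \<pi>1" "c > 0" "\<forall>f\<in>carrier A. p f \<le> c * residue_norm v n1 \<pi>1 f"
    using p unfolding berkovich_space_def by blast
  interpret Q: presented v A \<sigma> n1 \<pi>1 by unfold_locales (rule 1(1))
  have gb: "gauss_bounded n1 (Q.pull p)"
    by (rule Q.pull_gauss_bounded[OF ps 1(2)]) (use 1(3) in \<open>simp add: Q.res_def\<close>)
  have "p a \<le> res a" if a: "a \<in> carrier A" for a
  proof (rule ccontr)
    assume "\<not> p a \<le> res a"
    then have "res a < p a" by simp
    then obtain r where r: "r \<in> sqrt_value_group v" "res a < r" "r < p a"
      using sqrt_value_group_dense[OF res_nonneg[OF a]] by blast
    \<comment> \<open>Density is applied through the presentation in which \<open>p\<close> is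
      bounded, whereas the bound at \<open>x\<close> comes from the fixed presentation. The two meet
      because \<open>abs_at\<close> refers to neither.\<close>
    have "\<exists>x\<in>max_spec A. (\<forall>(a, r)\<in>{}. abs_at v A \<sigma> a x \<le> r) \<and> (\<forall>(a, r)\<in>{(a, r)}. r \<le> abs_at v A \<sigma> a x)"
      by (rule Q.density[OF ps gb]) (use a r in auto)
    then obtain x where x: "maximalideal x A" "r \<le> abs_at v A \<sigma> a x" by (auto simp: max_spec_def)
    obtain w where w: "gauss_bounded n w" "\<And>f. f \<in> T n \<Longrightarrow> abs_at v A \<sigma> (P f) x = w f" using abs_at_exists[OF x(1)] by metis
    obtain f where f: "f \<in> T n" "P f = a" "bd r f" using res_less[OF a r(2)] .
    \<comment> \<open>A bound strictly below \<open>r\<close> is required to contradict the weak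
      inequality at \<open>x\<close>.\<close>
    obtain s where s: "res a < s" "s < r" using dense r(2) by blast
    obtain g where g: "g \<in> T n" "P g = a" "bd s g" using res_less[OF a s(1)] .
    have "w g \<le> s" using w(1) g unfolding gauss_bounded_def by blast
    then show False using w(2)[OF g(1)] g(2) x(2) s(2) by simp
  qed
  then show "p \<in> {p \<in> seminorm_points A. \<forall>a\<in>carrier A. p a \<le> res a}" using ps by simp
qed

abbreviation "Xan \<equiv> berkovich_space v A \<sigma>"
abbreviation "\<tau> \<equiv> berkovich_topology v A \<sigma>"

lemma Xan_points: "p \<in> Xan \<Longrightarrow> p \<in> seminorm_points A"
  by (simp add: berkovich_space_eq)

lemma Xan_density:
  assumes p: "p \<in> Xan"
    and "finite Fs" "\<And>a r. (a, r) \<in> Fs \<Longrightarrow> a \<in> carrier A \<and> r \<in> sqrt_value_group v \<and> p a \<le> r"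
    and "finite Gs" "\<And>a r. (a, r) \<in> Gs \<Longrightarrow> a \<in> carrier A \<and> r \<in> sqrt_value_group v \<and> r \<le> p a"
  shows "\<exists>x\<in>max_spec A. (\<forall>(a, r)\<in>Fs. abs_at v A \<sigma> a x \<le> r) \<and> (\<forall>(a, r)\<in>Gs. r \<le> abs_at v A \<sigma> a x)"
proof (rule density[OF Xan_points[OF p] _ assms(2-5)])
  show "gauss_bounded n (pull p)"
    by (rule pull_gauss_bounded[OF Xan_points[OF p] zero_less_one]) (use p in \<open>simp add: berkovich_space_eq\<close>)
qed

definition emb :: "'a set \<Rightarrow> 'a \<Rightarrow> real" where
  "emb x = restrict (\<lambda>a. abs_at v A \<sigma> a x) (carrier A)"

lemma emb_apply [simp]: "a \<in> carrier A \<Longrightarrow> emb x a = abs_at v A \<sigma> a x"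
  by (simp add: emb_def)

lemma emb_Xan: assumes "x \<in> max_spec A" shows "emb x \<in> Xan"
proof -
  have x: "maximalideal x A" using assms by (simp add: max_spec_def)
  obtain w where w: "abs_on n (lift x) w" "gauss_bounded n w" "\<And>f. f \<in> T n \<Longrightarrow> abs_at v A \<sigma> (P f) x = w f"
    using abs_at_exists[OF x] by blast
  have mw: "w \<in> mult_seminorms (T n)" using w(1) by (simp add: abs_on_def)
  note sw = mult_seminormsD(1)[OF mw]
  have e: "emb x (P f) = w f" if "f \<in> T n" for f using w(3)[OF that] that by simp
  have "0 \<le> emb x a \<and> emb x a \<le> res a" if a: "a \<in> carrier A" for a
  proof
    obtain f where f: "f \<in> T n" "P f = a" using P_surj[OF a] .
    show "0 \<le> emb x a" using e[OF f(1)] f(2) seminormsD(1)[OF sw f(1)] by simp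
    show "emb x a \<le> res a"
    proof (rule dense_ge)
      fix r assume "res a < r"
      then obtain g where g: "g \<in> T n" "P g = a" "bd r g" using res_less[OF a] by blast
      have "w g \<le> r" using w(2) g unfolding gauss_bounded_def by blast
      then show "emb x a \<le> r" using e[OF g(1)] g(2) by simp
    qed
  qed
  moreover have "emb x (a \<otimes> b) = emb x a * emb x b \<and> emb x (a \<oplus> b) \<le> max (emb x a) (emb x b)"
    if ab: "a \<in> carrier A" "b \<in> carrier A" for a b
  proof -
    obtain f where f: "f \<in> T n" "P f = a" using P_surj[OF ab(1)] .
    obtain g where g: "g \<in> T n" "P g = b" using P_surj[OF ab(2)] .
    have "emb x (P (f * g)) = w f * w g" "emb x (P (f + g)) \<le> max (w f) (w g)"
      using e[OF T_mult[OF f(1) g(1)]] e[OF T_add[OF f(1) g(1)]] mult_seminormsD(2)[OF mw f(1) g(1)]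
        seminorm_add[OF subrng_T sw f(1) g(1)] by simp_all
    then show ?thesis using e[OF f(1)] e[OF g(1)] f g by (simp add: P_mult P_add)
  qed
  moreover have "emb x \<zero> = 0" "emb x \<one> = 1"
    using e[OF T_0] e[OF T_1] seminormsD(2,3)[OF sw] by (simp_all add: P_0 P_1)
  ultimately show ?thesis
    unfolding berkovich_space_eq seminorm_points_def by (auto simp: emb_def)
qed

lemma emb_zero: assumes "x \<in> max_spec A" "a \<in> carrier A" shows "emb x a = 0 \<longleftrightarrow> a \<in> x"
proof -
  have x: "maximalideal x A" using assms by (simp add: max_spec_def)
  obtain w where w: "abs_on n (lift x) w" "\<And>f. f \<in> T n \<Longrightarrow> abs_at v A \<sigma> (P f) x = w f"
    using abs_at_exists[OF x] by metis
  obtain f where f: "f \<in> T n" "P f = a" using P_surj[OF assms(2)] .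
  then show ?thesis using w(2)[OF f(1)] w(1) assms(2) by (auto simp: abs_on_def lift_def)
qed

text \<open>A maximal ideal is recovered as the kernel of its seminorm.\<close>

lemma emb_inj: "inj_on emb (max_spec A)"
proof (rule inj_onI)
  fix x y assume xy: "x \<in> max_spec A" "y \<in> max_spec A" "emb x = emb y"
  have "x \<subseteq> carrier A" "y \<subseteq> carrier A"
    using xy(1,2) ideal.Icarr maximalideal.axioms(1) unfolding max_spec_def by fast+
  then show "x = y" using emb_zero[OF xy(1)] emb_zero[OF xy(2)] xy(3) by (metis subset_antisym subsetD subsetI)
qed

subsection \<open>The topology of the Berkovich space\<close>

abbreviation "subbase \<equiv> {{p \<in> Xan. p f \<in> U} |f U. f \<in> carrier A \<and> open U}"

lemma openin_sub: "f \<in> carrier A \<Longrightarrow> open U \<Longrightarrow> openin \<tau> {p \<in> Xan. p f \<in> U}"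
  unfolding berkovich_topology_def by (rule topology_generated_by_Basis) blast

lemma openin_less: "a \<in> carrier A \<Longrightarrow> openin \<tau> {p \<in> Xan. p a < r}" "a \<in> carrier A \<Longrightarrow> openin \<tau> {p \<in> Xan. r < p a}"
  using openin_sub[of a "{..<r}"] openin_sub[of a "{r<..}"] by simp_all

lemma Union_subbase: "\<Union>subbase = Xan"
proof
  have "{p \<in> Xan. p \<one> \<in> UNIV} \<in> subbase" using one_closed by blast
  then have "{p \<in> Xan. p \<one> \<in> UNIV} \<subseteq> \<Union>subbase" by (rule Union_upper)
  then show "Xan \<subseteq> \<Union>subbase" by simp
qed auto

lemma topspace_tau: "topspace \<tau> = Xan"
  unfolding berkovich_topology_def topology_generated_by_topspace by (rule Union_subbase)

lemma Hausdorff_tau: "Hausdorff_space \<tau>"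
  unfolding Hausdorff_space_def topspace_tau
proof (intro allI impI)
  fix p q assume pq: "p \<in> Xan \<and> q \<in> Xan \<and> p \<noteq> q"
  have "p \<in> extensional (carrier A)" "q \<in> extensional (carrier A)"
    using pq Xan_points by (auto simp: seminorm_points_def PiE_def)
  then obtain f where f: "f \<in> carrier A" "p f \<noteq> q f" using pq extensionalityI by metis
  obtain U V where UV: "open U" "open V" "p f \<in> U" "q f \<in> V" "U \<inter> V = {}" using hausdorff[OF f(2)] by blast
  have "disjnt {r \<in> Xan. r f \<in> U} {r \<in> Xan. r f \<in> V}" using UV(5) by (auto simp: disjnt_iff)
  moreover have "p \<in> {r \<in> Xan. r f \<in> U}" "q \<in> {r \<in> Xan. r f \<in> V}" using pq UV by auto
  ultimately show "\<exists>U V. openin \<tau> U \<and> openin \<tau> V \<and> p \<in> U \<and> q \<in> V \<and> disjnt U V"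
    using openin_sub[OF f(1) UV(1)] openin_sub[OF f(1) UV(2)] by blast
qed

text \<open>The explicit bound by \<open>res\<close> places the points in a product of compact
  intervals, where the algebraic conditions are closed. The identity map from the product topology
  is continuous, so compactness carries over.\<close>

lemma compact_tau: "compact_space \<tau>"
proof -
  let ?\<Pi> = "product_topology (\<lambda>_::'a. euclideanreal) (carrier A)"
  let ?box = "PiE (carrier A) (\<lambda>a. {0..res a})"
  have proj: "continuous_map ?\<Pi> euclideanreal (\<lambda>p. p a)" if "a \<in> carrier A" for a
    using continuous_map_product_projection[of a "carrier A" "\<lambda>_. euclideanreal"] that by simp
  have cl: "closedin ?\<Pi> {p \<in> topspace ?\<Pi>. \<phi> p \<in> C}" if "continuous_map ?\<Pi> euclideanreal \<phi>" "closed C" for \<phi> C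
    using closedin_continuous_map_preimage[OF that(1), of C] that(2) by simp
  let ?cm = "\<lambda>f g. {p \<in> topspace ?\<Pi>. p (f \<otimes> g) - p f * p g \<in> {0}}"
  let ?ca = "\<lambda>f g. {p \<in> topspace ?\<Pi>. p (f \<oplus> g) - max (p f) (p g) \<in> {..0}}"
  let ?F = "{{p \<in> topspace ?\<Pi>. p \<zero> \<in> {0}}, {p \<in> topspace ?\<Pi>. p \<one> \<in> {1}}} \<union>
    (\<lambda>(f, g). ?cm f g) ` (carrier A \<times> carrier A) \<union> (\<lambda>(f, g). ?ca f g) ` (carrier A \<times> carrier A)"
  have "closedin ?\<Pi> C" if "C \<in> ?F" for C
  proof -
    have "closedin ?\<Pi> (?cm f g)" "closedin ?\<Pi> (?ca f g)" if "f \<in> carrier A" "g \<in> carrier A" for f g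
      by (rule cl; use that in \<open>auto intro!: continuous_map_diff continuous_map_real_mult continuous_map_real_max proj\<close>)+
    moreover have "closedin ?\<Pi> {p \<in> topspace ?\<Pi>. p \<zero> \<in> {0}}" "closedin ?\<Pi> {p \<in> topspace ?\<Pi>. p \<one> \<in> {1}}"
      by (rule cl; auto intro!: proj)+
    ultimately show ?thesis using that by auto
  qed
  then have "closedin ?\<Pi> (\<Inter>?F)" by (intro closedin_Inter) auto
  moreover have "compactin ?\<Pi> ?box" by (simp add: compactin_PiE)
  ultimately have "compactin ?\<Pi> (\<Inter>?F \<inter> ?box)" by (rule closed_Int_compactin)
  moreover have "\<Inter>?F \<inter> ?box = Xan"
  proof (intro equalityI subsetI)
    fix p assume p: "p \<in> \<Inter>?F \<inter> ?box"
    have b: "p \<in> ?box" and pF: "p \<in> \<Inter>?F" by (rule IntD2[OF p], rule IntD1[OF p])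
    have F: "p \<in> C" if "C \<in> ?F" for C using pF that by (rule InterD)
    have "p \<zero> = 0" "p \<one> = 1" using F by auto
    moreover have "p (f \<otimes> g) = p f * p g" "p (f \<oplus> g) \<le> max (p f) (p g)" if "f \<in> carrier A" "g \<in> carrier A" for f g
    proof -
      have in_F: "?cm f g \<in> ?F" "?ca f g \<in> ?F" using that by auto
      from F[OF in_F(1)] F[OF in_F(2)] show "p (f \<otimes> g) = p f * p g" "p (f \<oplus> g) \<le> max (p f) (p g)" by auto
    qed
    ultimately show "p \<in> Xan" using b unfolding berkovich_space_eq seminorm_points_def by (auto simp: PiE_iff)
  next
    fix p assume "p \<in> Xan"
    then show "p \<in> \<Inter>?F \<inter> ?box"
      unfolding berkovich_space_eq seminorm_points_def by (auto simp: PiE_iff)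
  qed
  ultimately have c: "compactin ?\<Pi> Xan" by simp
  have top: "topspace (subtopology ?\<Pi> Xan) = Xan" using compactin_subset_topspace[OF c] by (simp add: Int_absorb1)
  have "compact_space (subtopology ?\<Pi> Xan)" by (rule compact_space_subtopology[OF c])
  moreover have "continuous_map (subtopology ?\<Pi> Xan) \<tau> (\<lambda>p. p)"
    unfolding berkovich_topology_def
  proof (rule continuous_on_generated_topo)
    fix V assume "V \<in> subbase"
    then obtain f U where V: "V = {p \<in> Xan. p f \<in> U}" "f \<in> carrier A" "open U" by blast
    have "continuous_map (subtopology ?\<Pi> Xan) euclideanreal (\<lambda>p. p f)"
      by (rule continuous_map_from_subtopology[OF proj[OF V(2)]])
    then have "openin (subtopology ?\<Pi> Xan) {p \<in> topspace (subtopology ?\<Pi> Xan). p f \<in> U}"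
      by (rule openin_continuous_map_preimage) (use V(3) in simp)
    moreover have "(\<lambda>p. p) -` V \<inter> Xan = {p \<in> Xan. p f \<in> U}" unfolding V(1) by auto
    ultimately show "openin (subtopology ?\<Pi> Xan) ((\<lambda>p. p) -` V \<inter> topspace (subtopology ?\<Pi> Xan))"
      unfolding top by metis
  next
    show "(\<lambda>p. p) ` topspace (subtopology ?\<Pi> Xan) \<subseteq> \<Union>subbase"
      unfolding top Union_subbase by simp
  qed
  ultimately have "compactin \<tau> ((\<lambda>p. p) ` topspace (subtopology ?\<Pi> Xan))"
    using image_compactin compact_space_def by metis
  moreover have "(\<lambda>p. p) ` topspace (subtopology ?\<Pi> Xan) = topspace \<tau>"
    unfolding top topspace_tau by simp
  ultimately show ?thesis by (simp add: compact_space_def)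
qed

subsection \<open>Laurent domains\<close>

text \<open>Finite sets of pairs replace indexed families, so that intersecting two domains amounts
  to taking unions of their data.\<close>

definition Laurent_data :: "('a \<times> real) set \<Rightarrow> bool" where
  "Laurent_data Fs \<longleftrightarrow> finite Fs \<and> (\<forall>(a, r)\<in>Fs. a \<in> carrier A \<and> r \<in> sqrt_value_group v)"

definition Lan :: "('a \<times> real) set \<Rightarrow> ('a \<times> real) set \<Rightarrow> ('a \<Rightarrow> real) set" where
  "Lan Fs Gs = {p \<in> Xan. (\<forall>(a, r)\<in>Fs. p a < r) \<and> (\<forall>(a, r)\<in>Gs. r < p a)}"

lemma Laurent_data_enum:
  assumes "Laurent_data Fs"
  obtains s :: nat and f \<alpha> where "Fs = (\<lambda>i. (f i, \<alpha> i)) ` {1..s}" "\<forall>i\<in>{1..s}. f i \<in> carrier A \<and> \<alpha> i \<in> sqrt_value_group v"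
proof -
  have "finite Fs" using assms by (simp add: Laurent_data_def)
  then obtain h where h: "bij_betw h {1..card Fs} Fs" using ex_bij_betw_nat_finite_1 by blast
  have "Fs = (\<lambda>i. (fst (h i), snd (h i))) ` {1..card Fs}" using bij_betw_imp_surj_on[OF h] by simp
  moreover have "fst (h i) \<in> carrier A \<and> snd (h i) \<in> sqrt_value_group v" if "i \<in> {1..card Fs}" for i
    using bij_betwE[OF h] that assms unfolding Laurent_data_def by (metis (no_types, lifting) case_prod_beta)
  ultimately show ?thesis by (intro that[where s = "card Fs" and f = "\<lambda>i. fst (h i)" and \<alpha> = "\<lambda>i. snd (h i)"]) auto
qed

lemma emb_Lan:
  assumes "Laurent_data Fs" "Laurent_data Gs"
  shows "emb -` Lan Fs Gs \<inter> max_spec A =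
    {x \<in> max_spec A. (\<forall>(a, r)\<in>Fs. abs_at v A \<sigma> a x < r) \<and> (\<forall>(a, r)\<in>Gs. r < abs_at v A \<sigma> a x)}"
  using assms emb_Xan unfolding Lan_def Laurent_data_def by fastforce

lemma open_Laurent_domain_iff:
  "open_Laurent_domain v A \<sigma> U \<longleftrightarrow> (\<exists>Fs Gs. Laurent_data Fs \<and> Laurent_data Gs \<and> U = emb -` Lan Fs Gs \<inter> max_spec A)"
proof
  assume "open_Laurent_domain v A \<sigma> U"
  then obtain s t :: nat and f g \<alpha> \<beta> where
    f: "\<forall>i\<in>{1..s}. f i \<in> carrier A \<and> \<alpha> i \<in> sqrt_value_group v" and
    g: "\<forall>j\<in>{1..t}. g j \<in> carrier A \<and> \<beta> j \<in> sqrt_value_group v" and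
    U: "U = {x \<in> max_spec A. (\<forall>i\<in>{1..s}. abs_at v A \<sigma> (f i) x < \<alpha> i) \<and> (\<forall>j\<in>{1..t}. abs_at v A \<sigma> (g j) x > \<beta> j)}"
    unfolding open_Laurent_domain_def by blast
  let ?Fs = "(\<lambda>i. (f i, \<alpha> i)) ` {1..s}" and ?Gs = "(\<lambda>i. (g i, \<beta> i)) ` {1..t}"
  have d: "Laurent_data ?Fs" "Laurent_data ?Gs" using f g by (auto simp: Laurent_data_def)
  have "U = emb -` Lan ?Fs ?Gs \<inter> max_spec A" unfolding emb_Lan[OF d] U by simp
  then show "\<exists>Fs Gs. Laurent_data Fs \<and> Laurent_data Gs \<and> U = emb -` Lan Fs Gs \<inter> max_spec A" using d by blast
next
  assume "\<exists>Fs Gs. Laurent_data Fs \<and> Laurent_data Gs \<and> U = emb -` Lan Fs Gs \<inter> max_spec A"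
  then obtain Fs Gs where d: "Laurent_data Fs" "Laurent_data Gs" and U: "U = emb -` Lan Fs Gs \<inter> max_spec A" by blast
  obtain s :: nat and f \<alpha> where f: "Fs = (\<lambda>i. (f i, \<alpha> i)) ` {1..s}" "\<forall>i\<in>{1..s}. f i \<in> carrier A \<and> \<alpha> i \<in> sqrt_value_group v"
    using Laurent_data_enum[OF d(1)] .
  obtain t :: nat and g \<beta> where g: "Gs = (\<lambda>i. (g i, \<beta> i)) ` {1..t}" "\<forall>i\<in>{1..t}. g i \<in> carrier A \<and> \<beta> i \<in> sqrt_value_group v"
    using Laurent_data_enum[OF d(2)] .
  have "U = {x \<in> max_spec A. (\<forall>i\<in>{1..s}. abs_at v A \<sigma> (f i) x < \<alpha> i) \<and> (\<forall>j\<in>{1..t}. abs_at v A \<sigma> (g j) x > \<beta> j)}"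
    unfolding U emb_Lan[OF d] unfolding f(1) g(1) by (intro Collect_cong) auto
  then show "open_Laurent_domain v A \<sigma> U" unfolding open_Laurent_domain_def using f(2) g(2) by blast
qed

lemma Lan_open: assumes d: "Laurent_data Fs" "Laurent_data Gs" shows "openin \<tau> (Lan Fs Gs)"
proof -
  have eq: "Lan Fs Gs = topspace \<tau> \<inter> \<Inter>((\<lambda>(a, r). {p \<in> Xan. p a \<in> {..<r}}) ` Fs \<union> (\<lambda>(a, r). {p \<in> Xan. p a \<in> {r<..}}) ` Gs)"
    unfolding Lan_def topspace_tau by (auto simp: ball_Un split_beta)
  have "openin \<tau> V" if "V \<in> (\<lambda>(a, r). {p \<in> Xan. p a \<in> {..<r}}) ` Fs \<union> (\<lambda>(a, r). {p \<in> Xan. p a \<in> {r<..}}) ` Gs" for V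
    using that d by (auto simp: Laurent_data_def intro!: openin_less)
  moreover have "finite ((\<lambda>(a, r). {p \<in> Xan. p a \<in> {..<r}}) ` Fs \<union> (\<lambda>(a, r). {p \<in> Xan. p a \<in> {r<..}}) ` Gs)"
    using d by (simp add: Laurent_data_def)
  ultimately show ?thesis unfolding eq
    by (cases "(\<lambda>(a, r). {p \<in> Xan. p a \<in> {..<r}}) ` Fs \<union> (\<lambda>(a, r). {p \<in> Xan. p a \<in> {r<..}}) ` Gs = {}")
      (auto intro!: openin_Int openin_Inter simp del: Union_iff)
qed

lemma Lan_Int: "Lan Fs Gs \<inter> Lan Fs' Gs' = Lan (Fs \<union> Fs') (Gs \<union> Gs')"
  unfolding Lan_def by fastforce

lemma Laurent_data_Un: "Laurent_data Fs \<Longrightarrow> Laurent_data Fs' \<Longrightarrow> Laurent_data (Fs \<union> Fs')"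
  unfolding Laurent_data_def by auto

text \<open>Density of the admissible thresholds allows the value \<open>p f\<close> to be enclosed
  as tightly as required, so an open interval around it is reached by strict conditions of Laurent
  type.\<close>

lemma Lan_base:
  assumes "openin \<tau> V" "p \<in> V"
  shows "\<exists>Fs Gs. Laurent_data Fs \<and> Laurent_data Gs \<and> p \<in> Lan Fs Gs \<and> Lan Fs Gs \<subseteq> V"
proof -
  have "generate_topology_on subbase V" using assms(1) by (simp add: berkovich_topology_def openin_topology_generated_by_iff)
  then show ?thesis using assms(2)
  proof (induction rule: generate_topology_on.induct)
    case Empty
    then show ?case by simp
  next
    case (Int V W)
    then obtain Fs Gs Fs' Gs' where d: "Laurent_data Fs" "Laurent_data Gs" "Laurent_data Fs'" "Laurent_data Gs'"
      and p: "p \<in> Lan Fs Gs" "p \<in> Lan Fs' Gs'" and sub: "Lan Fs Gs \<subseteq> V" "Lan Fs' Gs' \<subseteq> W" by blast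
    have "p \<in> Lan (Fs \<union> Fs') (Gs \<union> Gs')" "Lan (Fs \<union> Fs') (Gs \<union> Gs') \<subseteq> V \<inter> W"
      using p sub unfolding Lan_Int[symmetric] by blast+
    then show ?case using Laurent_data_Un[OF d(1,3)] Laurent_data_Un[OF d(2,4)] by blast
  next
    case (UN K)
    then obtain k where k: "k \<in> K" "p \<in> k" by blast
    then obtain Fs Gs where "Laurent_data Fs" "Laurent_data Gs" "p \<in> Lan Fs Gs" "Lan Fs Gs \<subseteq> k"
      using UN.IH[OF k(1)] by blast
    then show ?case using k(1) by blast
  next
    case (Basis V)
    then obtain f U where V: "V = {p \<in> Xan. p f \<in> U}" "f \<in> carrier A" "open U" by blast
    have p: "p \<in> Xan" "p f \<in> U" using Basis.prems V(1) by auto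
    obtain e where e: "0 < e" "\<And>r. \<bar>r - p f\<bar> < e \<Longrightarrow> r \<in> U"
      using V(3) p(2) unfolding open_dist dist_real_def by blast
    have p0: "0 \<le> q f" if "q \<in> Xan" for q using seminorm_points_pos[OF Xan_points[OF that] V(2)] .
    obtain \<alpha> where \<alpha>: "\<alpha> \<in> sqrt_value_group v" "p f < \<alpha>" "\<alpha> < p f + e"
      using sqrt_value_group_dense[of "p f" "p f + e"] p0[OF p(1)] e(1) by auto
    show ?case
    proof (cases "p f = 0")
      \<comment> \<open>Thresholds are positive, so no lower condition can hold at a zero of
        \<open>p\<close>; nonnegativity of the seminorms serves as the lower bound instead.\<close>
      case True
      have "Lan {(f, \<alpha>)} {} \<subseteq> V"
      proof
        fix q assume q: "q \<in> Lan {(f, \<alpha>)} {}"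
        then have "\<bar>q f - p f\<bar> < e" using \<alpha>(3) True p0[of q] by (auto simp: Lan_def)
        then show "q \<in> V" using e(2) q by (simp add: V(1) Lan_def)
      qed
      moreover have "p \<in> Lan {(f, \<alpha>)} {}" using \<alpha>(2) p(1) by (simp add: Lan_def)
      ultimately show ?thesis using \<alpha>(1) V(2)
        by (intro exI[of _ "{(f, \<alpha>)}"] exI[of _ "{}"]) (simp add: Laurent_data_def)
    next
      case False
      then have "0 < p f" using p0[OF p(1)] by simp
      then obtain \<beta> where \<beta>: "\<beta> \<in> sqrt_value_group v" "max 0 (p f - e) < \<beta>" "\<beta> < p f"
        using sqrt_value_group_dense[of "max 0 (p f - e)" "p f"] e(1) by auto
      have "Lan {(f, \<alpha>)} {(f, \<beta>)} \<subseteq> V"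
      proof
        fix q assume q: "q \<in> Lan {(f, \<alpha>)} {(f, \<beta>)}"
        then have "\<bar>q f - p f\<bar> < e" using \<alpha>(3) \<beta>(2) by (auto simp: Lan_def)
        then show "q \<in> V" using e(2) q by (simp add: V(1) Lan_def)
      qed
      moreover have "p \<in> Lan {(f, \<alpha>)} {(f, \<beta>)}" using \<alpha>(2) \<beta>(3) p(1) by (simp add: Lan_def)
      ultimately show ?thesis using \<alpha>(1) \<beta>(1) V(2)
        by (intro exI[of _ "{(f, \<alpha>)}"] exI[of _ "{(f, \<beta>)}"]) (simp add: Laurent_data_def)
    qed
  qed
qed

lemma emb_dense: "\<tau> closure_of (emb ` max_spec A) = Xan"
proof -
  have "p \<in> \<tau> closure_of (emb ` max_spec A)" if p: "p \<in> Xan" for p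
    unfolding in_closure_of topspace_tau
  proof (intro conjI p allI impI)
    fix V assume "p \<in> V \<and> openin \<tau> V"
    then obtain Fs Gs where d: "Laurent_data Fs" "Laurent_data Gs" and L: "p \<in> Lan Fs Gs" "Lan Fs Gs \<subseteq> V"
      using Lan_base by blast
    \<comment> \<open>Thresholds strictly between the value and the given bound: the weak
      inequalities obtained from density then imply the strict ones. The lower conditions are
      treated in the same way with \<open>\<mu>\<close>.\<close>
    have "\<exists>r. r \<in> sqrt_value_group v \<and> p (fst e) < r \<and> r < snd e" if e: "e \<in> Fs" for e
    proof -
      have "p (fst e) < snd e" "fst e \<in> carrier A" using L(1) d(1) e by (auto simp: Lan_def Laurent_data_def)
      then show ?thesis using sqrt_value_group_dense seminorm_points_pos[OF Xan_points[OF p]] by metis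
    qed
    then obtain \<rho> where \<rho>: "\<And>e. e \<in> Fs \<Longrightarrow> \<rho> e \<in> sqrt_value_group v \<and> p (fst e) < \<rho> e \<and> \<rho> e < snd e" by metis
    have "\<exists>r. r \<in> sqrt_value_group v \<and> snd e < r \<and> r < p (fst e)" if e: "e \<in> Gs" for e
    proof -
      have "snd e < p (fst e)" "0 < snd e" using L(1) d(2) e by (auto simp: Lan_def Laurent_data_def sqrt_value_group_def)
      then show ?thesis using sqrt_value_group_dense by (metis less_imp_le)
    qed
    then obtain \<mu> where \<mu>: "\<And>e. e \<in> Gs \<Longrightarrow> \<mu> e \<in> sqrt_value_group v \<and> snd e < \<mu> e \<and> \<mu> e < p (fst e)" by metis
    let ?Fs = "(\<lambda>e. (fst e, \<rho> e)) ` Fs" and ?Gs = "(\<lambda>e. (fst e, \<mu> e)) ` Gs"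
    have "\<exists>x\<in>max_spec A. (\<forall>(a, r)\<in>?Fs. abs_at v A \<sigma> a x \<le> r) \<and> (\<forall>(a, r)\<in>?Gs. r \<le> abs_at v A \<sigma> a x)"
    proof (rule Xan_density[OF p])
      show "finite ?Fs" "finite ?Gs" using d by (auto simp: Laurent_data_def)
      show "a \<in> carrier A \<and> r \<in> sqrt_value_group v \<and> p a \<le> r" if "(a, r) \<in> ?Fs" for a r
        using that \<rho> d(1) by (fastforce simp: Laurent_data_def)
      show "a \<in> carrier A \<and> r \<in> sqrt_value_group v \<and> r \<le> p a" if "(a, r) \<in> ?Gs" for a r
        using that \<mu> d(2) by (fastforce simp: Laurent_data_def)
    qed
    then obtain x where x: "x \<in> max_spec A" "\<forall>e\<in>Fs. abs_at v A \<sigma> (fst e) x \<le> \<rho> e" "\<forall>e\<in>Gs. \<mu> e \<le> abs_at v A \<sigma> (fst e) x"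
      by auto
    have "\<forall>e\<in>Fs. abs_at v A \<sigma> (fst e) x < snd e" "\<forall>e\<in>Gs. snd e < abs_at v A \<sigma> (fst e) x"
      using x \<rho> \<mu> by (meson le_less_trans less_le_trans)+
    then have "x \<in> emb -` Lan Fs Gs \<inter> max_spec A" unfolding emb_Lan[OF d] using x(1) by force
    then show "\<exists>y. y \<in> emb ` max_spec A \<and> y \<in> V" using L(2) by blast
  qed
  then show ?thesis using closure_of_subset_topspace[of \<tau> "emb ` max_spec A"] topspace_tau by blast
qed

lemma Lan_cover:
  assumes D: "finite D" "\<And>U. U \<in> D \<Longrightarrow> Laurent_data (Fs U) \<and> Laurent_data (Gs U)"
    and cov: "max_spec A \<subseteq> (\<Union>U\<in>D. emb -` Lan (Fs U) (Gs U))"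
  shows "Xan \<subseteq> (\<Union>U\<in>D. Lan (Fs U) (Gs U))"
proof (rule ccontr)
  assume "\<not> Xan \<subseteq> (\<Union>U\<in>D. Lan (Fs U) (Gs U))"
  then obtain p where p: "p \<in> Xan" "\<And>U. U \<in> D \<Longrightarrow> p \<notin> Lan (Fs U) (Gs U)" by blast
  have "\<exists>a r. (a, r) \<in> Fs U \<and> r \<le> p a \<or> (a, r) \<in> Gs U \<and> p a \<le> r" if "U \<in> D" for U
    using p(2)[OF that] p(1) by (force simp: Lan_def not_less)
  then obtain a r where ar: "\<And>U. U \<in> D \<Longrightarrow> (a U, r U) \<in> Fs U \<and> r U \<le> p (a U) \<or> (a U, r U) \<in> Gs U \<and> p (a U) \<le> r U" by metis
  \<comment> \<open>One violated inequality is chosen for each member. A violated upper condition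
    becomes a lower bound (\<open>?DF\<close>), a violated lower condition an upper bound
    (\<open>?DG\<close>).\<close>
  let ?DF = "{U\<in>D. (a U, r U) \<in> Fs U \<and> r U \<le> p (a U)}" and ?DG = "{U\<in>D. (a U, r U) \<in> Gs U \<and> p (a U) \<le> r U}"
  have "\<exists>x\<in>max_spec A. (\<forall>(a, r)\<in>(\<lambda>U. (a U, r U)) ` ?DG. abs_at v A \<sigma> a x \<le> r) \<and>
      (\<forall>(a, r)\<in>(\<lambda>U. (a U, r U)) ` ?DF. r \<le> abs_at v A \<sigma> a x)"
  proof (rule Xan_density[OF p(1)])
    show "finite ((\<lambda>U. (a U, r U)) ` ?DG)" "finite ((\<lambda>U. (a U, r U)) ` ?DF)" using D(1) by auto
    show "b \<in> carrier A \<and> s \<in> sqrt_value_group v \<and> p b \<le> s" if "(b, s) \<in> (\<lambda>U. (a U, r U)) ` ?DG" for b s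
      using that D(2) by (fastforce simp: Laurent_data_def)
    show "b \<in> carrier A \<and> s \<in> sqrt_value_group v \<and> s \<le> p b" if "(b, s) \<in> (\<lambda>U. (a U, r U)) ` ?DF" for b s
      using that D(2) by (fastforce simp: Laurent_data_def)
  qed
  then obtain x where x: "x \<in> max_spec A" "\<forall>U\<in>?DG. abs_at v A \<sigma> (a U) x \<le> r U" "\<forall>U\<in>?DF. r U \<le> abs_at v A \<sigma> (a U) x"
    by auto
  obtain U where U: "U \<in> D" "emb x \<in> Lan (Fs U) (Gs U)" using cov x(1) by blast
  then have "x \<in> emb -` Lan (Fs U) (Gs U) \<inter> max_spec A" using x(1) by blast
  then have L: "\<forall>(a, r)\<in>Fs U. abs_at v A \<sigma> a x < r" "\<forall>(a, r)\<in>Gs U. r < abs_at v A \<sigma> a x"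
    using emb_Lan[of "Fs U" "Gs U"] D(2)[OF U(1)] by auto
  show False using ar[OF U(1)]
  proof
    assume "(a U, r U) \<in> Fs U \<and> r U \<le> p (a U)"
    then show False using L(1) x(3) U(1) by fastforce
  next
    assume "(a U, r U) \<in> Gs U \<and> p (a U) \<le> r U"
    then show False using L(2) x(2) U(1) by fastforce
  qed
qed

text \<open>A finite Laurent covering extends to an open covering of the Berkovich space by
  \<open>Lan_cover\<close>. Conversely an open covering is refined by Laurent neighbourhoods, and
  compactness leaves finitely many.\<close>

theorem Laurent_coverings_induced:
  "Laurent_coverings v A \<sigma> = induced_coverings (max_spec A) emb (open_coverings \<tau>)"
proof (intro equalityI subsetI)
  let ?pb = "\<lambda>D. (\<lambda>U. emb -` U \<inter> max_spec A) ` D"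
  fix C assume "C \<in> Laurent_coverings v A \<sigma>"
  then obtain D where C: "covering (max_spec A) C" and D: "finite D" "covering (max_spec A) D"
    "\<forall>U\<in>D. open_Laurent_domain v A \<sigma> U" "refines D C" unfolding Laurent_coverings_def by blast
  have "\<forall>U\<in>D. \<exists>e. Laurent_data (fst e) \<and> Laurent_data (snd e) \<and> U = emb -` Lan (fst e) (snd e) \<inter> max_spec A"
    using D(3) unfolding open_Laurent_domain_iff by (metis fst_conv snd_conv)
  from bchoice[OF this] obtain e where e: "\<forall>U\<in>D. Laurent_data (fst (e U)) \<and> Laurent_data (snd (e U)) \<and>
      U = emb -` Lan (fst (e U)) (snd (e U)) \<inter> max_spec A" ..
  define L where "L U = Lan (fst (e U)) (snd (e U))" for U
  have "Xan \<subseteq> (\<Union>U\<in>D. L U)"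
    unfolding L_def
  proof (rule Lan_cover[OF D(1)])
    show "Laurent_data (fst (e U)) \<and> Laurent_data (snd (e U))" if "U \<in> D" for U using e that by blast
    show "max_spec A \<subseteq> (\<Union>U\<in>D. emb -` Lan (fst (e U)) (snd (e U)))"
      using D(2) e unfolding covering_def by blast
  qed
  moreover have "L U \<subseteq> Xan" for U by (auto simp: L_def Lan_def)
  ultimately have "covering (topspace \<tau>) (L ` D)"
    using D(2) unfolding covering_def topspace_tau by auto
  moreover have "openin \<tau> V" if "V \<in> L ` D" for V
    using that e Lan_open by (auto simp: L_def)
  ultimately have "L ` D \<in> open_coverings \<tau>" by (rule open_coveringsI)
  moreover have "refines (?pb (L ` D)) C"
    unfolding refines_def
  proof
    fix V assume "V \<in> ?pb (L ` D)"
    then obtain U where U: "U \<in> D" "V = emb -` L U \<inter> max_spec A" by blast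
    then have "V = U" using e by (simp add: L_def)
    then show "\<exists>W\<in>C. V \<subseteq> W" using U(1) D(4) unfolding refines_def by blast
  qed
  ultimately show "C \<in> induced_coverings (max_spec A) emb (open_coverings \<tau>)"
    using C unfolding induced_coverings_def by blast
next
  let ?pb = "\<lambda>D. (\<lambda>U. emb -` U \<inter> max_spec A) ` D"
  fix C assume "C \<in> induced_coverings (max_spec A) emb (open_coverings \<tau>)"
  then obtain E0 where C: "covering (max_spec A) C" and E0: "E0 \<in> open_coverings \<tau>" "refines (?pb E0) C"
    unfolding induced_coverings_def by blast
  obtain E where E: "covering Xan E" "\<forall>U\<in>E. openin \<tau> U" "refines E E0"
    using E0(1) unfolding open_coverings_def topspace_tau by blast
  have "\<exists>V e. V \<in> E \<and> Laurent_data (fst e) \<and> Laurent_data (snd e) \<and> p \<in> Lan (fst e) (snd e) \<and> Lan (fst e) (snd e) \<subseteq> V"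
    if p: "p \<in> Xan" for p
  proof -
    obtain V where V: "V \<in> E" "p \<in> V" using E(1) p unfolding covering_def by blast
    have "openin \<tau> V" using E(2) V(1) by blast
    then obtain Fs Gs where "Laurent_data Fs" "Laurent_data Gs" "p \<in> Lan Fs Gs" "Lan Fs Gs \<subseteq> V"
      using Lan_base[OF _ V(2)] by blast
    then show ?thesis using V(1) by (intro exI[of _ V] exI[of _ "(Fs, Gs)"]) simp
  qed
  then obtain V e where Ve: "\<And>p. p \<in> Xan \<Longrightarrow> V p \<in> E \<and> Laurent_data (fst (e p)) \<and> Laurent_data (snd (e p)) \<and>
      p \<in> Lan (fst (e p)) (snd (e p)) \<and> Lan (fst (e p)) (snd (e p)) \<subseteq> V p" by metis
  define L where "L p = Lan (fst (e p)) (snd (e p))" for p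
  have "openin \<tau> (L p) \<and> p \<in> L p" if "p \<in> topspace \<tau>" for p
    using Ve[of p] that Lan_open unfolding L_def topspace_tau by blast
  then obtain S where S: "finite S" "S \<subseteq> Xan" "Xan \<subseteq> (\<Union>s\<in>S. L s)"
    using compact_space_subcover[OF compact_tau, of L] unfolding topspace_tau by metis
  \<comment> \<open>The empty set is the Laurent domain where zero has absolute value greater than
    1. Adding it keeps the covering \<open>D\<close> nonempty when the spectrum is empty.\<close>
  have "Laurent_data {} \<and> Laurent_data {(\<zero>, 1)}"
    unfolding Laurent_data_def sqrt_value_group_def by (auto intro!: exI[of _ 1])
  moreover have "\<not> 1 < p \<zero>" if "p \<in> Xan" for p using Xan_points[OF that] by (simp add: seminorm_points_def)
  then have "Lan {} {(\<zero>, 1)} = {}" by (auto simp: Lan_def)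
  ultimately have emp: "open_Laurent_domain v A \<sigma> {}" unfolding open_Laurent_domain_iff by (metis Int_empty_left vimage_empty)
  define D where "D = insert {} (?pb (L ` S))"
  have "\<Union>D = (\<Union>p\<in>S. emb -` L p \<inter> max_spec A)" by (auto simp: D_def)
  moreover have "max_spec A \<subseteq> (\<Union>p\<in>S. emb -` L p \<inter> max_spec A)"
  proof
    fix x assume x: "x \<in> max_spec A"
    have "emb x \<in> (\<Union>s\<in>S. L s)" by (rule subsetD[OF S(3) emb_Xan[OF x]])
    then obtain s where "s \<in> S" "emb x \<in> L s" ..
    then show "x \<in> (\<Union>p\<in>S. emb -` L p \<inter> max_spec A)" using x by blast
  qed
  ultimately have "covering (max_spec A) D" unfolding covering_def by (auto simp: D_def)
  moreover have "finite D" using S(1) by (simp add: D_def)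
  moreover have "open_Laurent_domain v A \<sigma> U" if "U \<in> D" for U
  proof (cases "U = {}")
    case False
    then obtain p where p: "p \<in> S" "U = emb -` L p \<inter> max_spec A" using \<open>U \<in> D\<close> unfolding D_def by blast
    then show ?thesis unfolding open_Laurent_domain_iff using Ve[of p] S(2) unfolding L_def by blast
  qed (use emp in simp)
  moreover have "refines D C"
    unfolding refines_def
  proof
    fix U assume "U \<in> D"
    then consider "U = {}" | p where "p \<in> S" "U = emb -` L p \<inter> max_spec A" unfolding D_def by blast
    then show "\<exists>W\<in>C. U \<subseteq> W"
    proof cases
      case 1
      then show ?thesis using C unfolding covering_def by blast
    next
      case (2 p)
      then have "L p \<subseteq> V p" "V p \<in> E" using Ve[of p] S(2) unfolding L_def by blast+
      then obtain V0 where V0: "V0 \<in> E0" "L p \<subseteq> V0" using E(3) unfolding refines_def by (meson order_trans)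
      then obtain W where "W \<in> C" "emb -` V0 \<inter> max_spec A \<subseteq> W" using E0(2) unfolding refines_def by blast
      then show ?thesis using V0(2) 2(2) by blast
    qed
  qed
  ultimately show "C \<in> Laurent_coverings v A \<sigma>" unfolding Laurent_coverings_def using C by blast
qed

theorem emb_completion:
  "is_completion (max_spec A) (Laurent_coverings v A \<sigma>) Xan (open_coverings \<tau>) emb"
proof -
  have "uniform_topology Xan (open_coverings \<tau>) = \<tau>"
    using open_coverings_compatible[OF compact_tau Hausdorff_tau]
    by (simp add: compatible_uniform_structure_def topspace_tau)
  then show ?thesis
    unfolding is_completion_def
    using open_coverings_uniform[OF compact_tau Hausdorff_tau] compact_complete_uniform[OF compact_tau Hausdorff_tau]
      emb_Xan emb_inj emb_dense Laurent_coverings_induced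
    by (auto simp: topspace_tau)
qed

end

theorem mainTheorem1:
  fixes v :: "'k::field \<Rightarrow> real"
    and A :: "('a, 'm) ring_scheme"
    and \<sigma> :: "'k \<Rightarrow> 'a"
  assumes "complete_nonarch_field v"
    and "affinoid_algebra v A \<sigma>"
  shows "Hausdorff_uniform_structure (max_spec A) (Laurent_coverings v A \<sigma>) \<and>
    compact_space (berkovich_topology v A \<sigma>) \<and>
    Hausdorff_space (berkovich_topology v A \<sigma>) \<and>
    (\<exists>!\<U>. compatible_uniform_structure (berkovich_topology v A \<sigma>) \<U>) \<and>
    (\<exists>i. is_completion (max_spec A) (Laurent_coverings v A \<sigma>)
           (berkovich_space v A \<sigma>) (the_uniform_structure (berkovich_topology v A \<sigma>)) i) \<and>
    (\<forall>(Y :: 'y set) \<D> i.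
       is_completion (max_spec A) (Laurent_coverings v A \<sigma>) Y \<D> i \<longrightarrow>
       (\<exists>h. uniform_isomorphism Y \<D>
              (berkovich_space v A \<sigma>) (the_uniform_structure (berkovich_topology v A \<sigma>)) h) \<and>
       uniform_topology Y \<D> homeomorphic_space berkovich_topology v A \<sigma>)"
proof -
  interpret complete_nonarch_field v by (rule assms(1))
  obtain n \<pi> where "cring A" "presentation v A \<sigma> n \<pi>"
    using assms(2) unfolding affinoid_algebra_def by blast
  then interpret presented v A \<sigma> n \<pi> by (intro presented.intro presented_axioms.intro assms(1))
  note the_eq = the_uniform_structure_eq[OF compact_tau Hausdorff_tau]
  have Hu: "Hausdorff_uniform_structure Xan (open_coverings \<tau>)"
    using open_coverings_uniform[OF compact_tau Hausdorff_tau] by (simp add: topspace_tau)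
  then have u: "uniform_structure Xan (open_coverings \<tau>)" by (simp add: Hausdorff_uniform_structure_def)
  have top: "uniform_topology Xan (open_coverings \<tau>) = \<tau>"
    using open_coverings_compatible[OF compact_tau Hausdorff_tau]
    by (simp add: compatible_uniform_structure_def topspace_tau)
  have "Hausdorff_uniform_structure (max_spec A) (Laurent_coverings v A \<sigma>)"
    unfolding Laurent_coverings_induced by (rule induced_Hausdorff[OF Hu _ emb_inj]) (use emb_Xan in blast)
  moreover have "(\<exists>h. uniform_isomorphism Y \<D> Xan (open_coverings \<tau>) h) \<and> uniform_topology Y \<D> homeomorphic_space \<tau>"
    if Y: "is_completion (max_spec A) (Laurent_coverings v A \<sigma>) Y \<D> i" for Y :: "'y set" and \<D> i
  proof -
    obtain h where h: "uniform_isomorphism Y \<D> Xan (open_coverings \<tau>) h"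
      using completion_unique[OF Y emb_completion] by blast
    have "uniform_structure Y \<D>" using Y by (simp add: is_completion_def Hausdorff_uniform_structure_def)
    then have "uniform_topology Y \<D> homeomorphic_space \<tau>"
      using uniform_isomorphism_homeomorphic[OF _ u h] top by simp
    then show ?thesis using h by blast
  qed
  ultimately show ?thesis
    unfolding the_eq(2) using compact_tau Hausdorff_tau the_eq(1) emb_completion by blast
qed

end
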